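(* Let $P$ be a finite poset and let $D\colon P\to \mathcal{FP}$ be a functor. Then there is a spectral sequence $$E^2_{p,q}=H_p(P;\mathcal{H}_q)\Rightarrow H_{p+q}(\underline{\mathrm{hocolim}}\,D;\mathbb{Z})$$ where, for each $q\in\mathbb{Z}$, the functor $\mathcal{H}_q\colon P\to\mathrm{Ab}$ is defined as the composition $H_q(D(-);\mathbb{Z})$.
   Context: $\mathrm{Ab}$ is the category of abelian groups and $\mathcal{FP}$ is the category of finite posets and order-preserving maps. A poset $X$ is regarded as a small category with a unique morphism $x\to y$ iff $x\le y$; functors are covariant. The non-Hausdorff homotopy colimit $\underline{\mathrm{hocolim}}\,D$ of $D\colon P\to\mathcal{FP}$ is the Grothendieck construction on $D$: the poset of pairs $(p,x)$ with $p\in P$, $x\in D(p)$, ordered by $(p,x)\le (p',x')$ iff $p\le p'$ in $P$ and $D(p\le p')(x)\le x'$ in $D(p')$. For a poset $X$ and $n\ge 0$, $\mathrm{Ch}_n(X)$ is the set of totally ordered subsets of $X$ of cardinality $n+1$. For a functor $\mathcal{F}\colon X\to\mathrm{Ab}$, $H_n(X;\mathcal{F})$ is the homology of the chain complex $C(X;\mathcal{F})$ with $C_n(X;\mathcal{F})=\bigoplus_{\sigma\in \mathrm{Ch}_n(X)}\mathcal{F}(\min\sigma)$ for $n\geq 0$ (and $0$ for $n<0$), whose differential for $n\geq 1$ is given, for $\sigma=\{\sigma_0<\dots<\sigma_n\}$ and $g\in\mathcal{F}(\sigma_0)$, by $d(g\sigma)=\mathcal{F}(\sigma_0<\sigma_1)(g)\,(\sigma-\{\sigma_0\})+\sum_{i=1}^n(-1)^i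 g\,(\sigma-\{\sigma_i\})$. $H_n(X;\mathbb{Z})$ is the case of the constant functor $\mathbb{Z}$ with identity maps, i.e. the integral simplicial homology of the order complex of $X$ (the simplicial complex of non-empty finite chains of $X$). Spectral sequences are (first-quadrant) homological spectral sequences. *)

theory Defs
  imports "HOL-Algebra.FiniteProduct" "HOL-Algebra.Product_Groups"
begin

section \<open>Finite posets and diagrams of finite posets\<close>

text \<open>
  A poset is a relation \<open>X\<close> with \<^term>\<open>Partial_order X\<close>; its set of elements is \<^term>\<open>Field X\<close>
  (a partial order is reflexive on its field, so the relation determines its ground set, and the
  empty relation is the empty poset).
\<close>

definition finite_poset :: "'a rel \<Rightarrow> bool" where
  "finite_poset X \<longleftrightarrow> Partial_order X \<and> finite (Field X)"

text \<open>
  A functor from a poset \<open>P\<close> to finite posets: \<open>D p\<close> is the value at \<open>p\<close> and \<open>\<phi> p q\<close> the map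
  \<open>D p \<rightarrow> D q\<close> for \<open>p \<le> q\<close>. By reflexivity, \<^const>\<open>compat\<close> also says that \<open>\<phi> p q\<close> maps
  \<^term>\<open>Field (D p)\<close> into \<^term>\<open>Field (D q)\<close>. All values live in one type, which for
  finite \<open>P\<close> and finite posets \<open>D p\<close> is no restriction.
\<close>

locale finite_poset_functor =
  fixes P :: "'a rel" and D :: "'a \<Rightarrow> 'b rel" and \<phi> :: "'a \<Rightarrow> 'a \<Rightarrow> 'b \<Rightarrow> 'b"
  assumes finite_poset_obj: "p \<in> Field P \<Longrightarrow> finite_poset (D p)"
    and order_preserving: "(p, q) \<in> P \<Longrightarrow> compat (D p) (D q) (\<phi> p q)"
    and map_id: "\<lbrakk>p \<in> Field P; x \<in> Field (D p)\<rbrakk> \<Longrightarrow> \<phi> p p x = x"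
    and map_comp: "\<lbrakk>(p, q) \<in> P; (q, r) \<in> P; x \<in> Field (D p)\<rbrakk> \<Longrightarrow> \<phi> q r (\<phi> p q x) = \<phi> p r x"

definition hocolim :: "'a rel \<Rightarrow> ('a \<Rightarrow> 'b rel) \<Rightarrow> ('a \<Rightarrow> 'a \<Rightarrow> 'b \<Rightarrow> 'b) \<Rightarrow> ('a \<times> 'b) rel" where
  "hocolim P D \<phi> = {((p, x), (p', x')). (p, p') \<in> P \<and> x \<in> Field (D p) \<and> x' \<in> Field (D p') \<and>
     (\<phi> p p' x, x') \<in> D p'}"

lemma Partial_orderD:
  assumes "Partial_order r"
  shows "x \<in> Field r \<Longrightarrow> (x, x) \<in> r"
    and "\<lbrakk>(x, y) \<in> r; (y, z) \<in> r\<rbrakk> \<Longrightarrow> (x, z) \<in> r"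
    and "\<lbrakk>(x, y) \<in> r; (y, x) \<in> r\<rbrakk> \<Longrightarrow> x = y"
  using assms
  by (auto simp: partial_order_on_def preorder_on_def refl_on_def dest: transD antisymD)

lemma finite_poset_hocolim:
  assumes P: "finite_poset P" and D: "finite_poset_functor P D \<phi>"
  shows "Field (hocolim P D \<phi>) = Sigma (Field P) (\<lambda>p. Field (D p))"
    and "finite_poset (hocolim P D \<phi>)"
proof -
  interpret finite_poset_functor P D \<phi> by fact
  have po: "Partial_order P" and fin: "finite (Field P)"
    using P by (auto simp: finite_poset_def)
  have poD: "Partial_order (D p)" and finD: "finite (Field (D p))" if "p \<in> Field P" for p
    using finite_poset_obj[OF that] by (auto simp: finite_poset_def)
  note P' = Partial_orderD[OF po]
  have refl: "((p, x), (p, x)) \<in> hocolim P D \<phi>" if "p \<in> Field P" "x \<in> Field (D p)" for p x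
    using that P'(1) Partial_orderD(1)[OF poD] map_id by (auto simp: hocolim_def)
  show F: "Field (hocolim P D \<phi>) = Sigma (Field P) (\<lambda>p. Field (D p))"
  proof
    show "Field (hocolim P D \<phi>) \<subseteq> Sigma (Field P) (\<lambda>p. Field (D p))"
      by (auto simp: hocolim_def Field_def)
    show "Sigma (Field P) (\<lambda>p. Field (D p)) \<subseteq> Field (hocolim P D \<phi>)"
      using refl by (auto intro: FieldI1)
  qed
  have "trans (hocolim P D \<phi>)"
  proof (rule transI, clarify)
    fix p x q y r z
    assume "((p, x), (q, y)) \<in> hocolim P D \<phi>" "((q, y), (r, z)) \<in> hocolim P D \<phi>"
    then have *: "(p, q) \<in> P" "(q, r) \<in> P" "x \<in> Field (D p)" "z \<in> Field (D r)"
      "(\<phi> p q x, y) \<in> D q" "(\<phi> q r y, z) \<in> D r"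
      by (auto simp: hocolim_def)
    have "(\<phi> q r (\<phi> p q x), \<phi> q r y) \<in> D r"
      using order_preserving[OF *(2)] *(5) by (auto simp: compat_def)
    then have "(\<phi> p r x, z) \<in> D r"
      using map_comp[OF *(1,2,3)] *(6) Partial_orderD(2)[OF poD] *(2) FieldI2 by metis
    then show "((p, x), (r, z)) \<in> hocolim P D \<phi>"
      using * P'(2) by (auto simp: hocolim_def)
  qed
  moreover have "antisym (hocolim P D \<phi>)"
  proof (rule antisymI, clarify)
    fix p x q y
    assume a: "((p, x), (q, y)) \<in> hocolim P D \<phi>" "((q, y), (p, x)) \<in> hocolim P D \<phi>"
    then have "p = q" using P'(3) by (auto simp: hocolim_def)
    moreover have "x = y"
      using a map_id Partial_orderD(3)[OF poD] \<open>p = q\<close> unfolding hocolim_def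
      by simp (metis FieldI1)
    ultimately show "p = q \<and> x = y" by simp
  qed
  moreover have "refl_on (Field (hocolim P D \<phi>)) (hocolim P D \<phi>)"
    unfolding F using refl by (auto simp: refl_on_def)
  moreover have "hocolim P D \<phi> \<subseteq> Field (hocolim P D \<phi>) \<times> Field (hocolim P D \<phi>)"
    by (auto intro: FieldI1 FieldI2)
  ultimately have "Partial_order (hocolim P D \<phi>)"
    by (simp add: partial_order_on_def preorder_on_def)
  moreover have "finite (Field (hocolim P D \<phi>))"
    unfolding F using fin finD by auto
  ultimately show "finite_poset (hocolim P D \<phi>)" by (simp add: finite_poset_def)
qed


section \<open>Homology of a poset with coefficients in a functor\<close>

text \<open>Chains with \<open>n + 1\<close> elements; there are none for \<open>n < 0\<close>.\<close>

definition Ch :: "int \<Rightarrow> 'a rel \<Rightarrow> 'a set set" where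
  "Ch n X = {\<sigma> \<in> Chains X. 0 \<le> n \<and> int (card \<sigma>) = n + 1}"

text \<open>
  \<open>vertex X \<sigma> i\<close> is \<open>\<sigma>\<^sub>i\<close> in \<open>\<sigma> = {\<sigma>\<^sub>0 < \<dots> < \<sigma>\<^sub>n}\<close>: the element of \<open>\<sigma>\<close> with exactly \<open>i\<close>
  elements of \<open>\<sigma>\<close> strictly below it. In particular \<open>vertex X \<sigma> 0\<close> is \<open>min \<sigma>\<close>.
\<close>

definition vertex :: "'a rel \<Rightarrow> 'a set \<Rightarrow> nat \<Rightarrow> 'a" where
  "vertex X \<sigma> i = (THE x. x \<in> \<sigma> \<and> card {y \<in> \<sigma>. (y, x) \<in> X \<and> y \<noteq> x} = i)"

text \<open>
  A functor from \<open>X\<close> to abelian groups is given by its values \<open>F x\<close> and its maps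
  \<open>\<psi> x y : F x \<rightarrow> F y\<close> for \<open>x \<le> y\<close>. Abelian groups are written multiplicatively, as in HOL-Algebra.
\<close>

definition chain_group :: "int \<Rightarrow> 'a rel \<Rightarrow> ('a \<Rightarrow> 'c monoid) \<Rightarrow> ('a set \<Rightarrow> 'c) monoid" where
  "chain_group n X F = sum_group (Ch n X) (\<lambda>\<sigma>. F (vertex X \<sigma> 0))"

text \<open>The element \<open>g \<tau>\<close> of the direct sum, for \<open>\<tau> \<in> Ch n X\<close> and \<open>g \<in> F (min \<tau>)\<close>.\<close>

definition simplex_chain ::
  "int \<Rightarrow> 'a rel \<Rightarrow> ('a \<Rightarrow> 'c monoid) \<Rightarrow> 'c \<Rightarrow> 'a set \<Rightarrow> ('a set \<Rightarrow> 'c)" where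
  "simplex_chain n X F g \<tau> = (\<lambda>\<sigma>\<in>Ch n X. if \<sigma> = \<tau> then g else \<one>\<^bsub>F (vertex X \<sigma> 0)\<^esub>)"

definition simplex_boundary ::
  "int \<Rightarrow> 'a rel \<Rightarrow> ('a \<Rightarrow> 'c monoid) \<Rightarrow> ('a \<Rightarrow> 'a \<Rightarrow> 'c \<Rightarrow> 'c) \<Rightarrow> 'c \<Rightarrow> 'a set \<Rightarrow> ('a set \<Rightarrow> 'c)" where
  "simplex_boundary n X F \<psi> g \<sigma> =
     simplex_chain (n - 1) X F (\<psi> (vertex X \<sigma> 0) (vertex X \<sigma> 1) g) (\<sigma> - {vertex X \<sigma> 0})
     \<otimes>\<^bsub>chain_group (n - 1) X F\<^esub>
     (\<Otimes>\<^bsub>chain_group (n - 1) X F\<^esub>i\<in>{1..nat n}.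
        simplex_chain (n - 1) X F (g [^]\<^bsub>F (vertex X \<sigma> 0)\<^esub> ((- 1) ^ i :: int)) (\<sigma> - {vertex X \<sigma> i}))"

definition chain_boundary ::
  "int \<Rightarrow> 'a rel \<Rightarrow> ('a \<Rightarrow> 'c monoid) \<Rightarrow> ('a \<Rightarrow> 'a \<Rightarrow> 'c \<Rightarrow> 'c) \<Rightarrow> ('a set \<Rightarrow> 'c) \<Rightarrow> ('a set \<Rightarrow> 'c)" where
  "chain_boundary n X F \<psi> c =
     (if n < 1 then \<one>\<^bsub>chain_group (n - 1) X F\<^esub>
      else \<Otimes>\<^bsub>chain_group (n - 1) X F\<^esub>\<sigma>\<in>{\<sigma> \<in> Ch n X. c \<sigma> \<noteq> \<one>\<^bsub>F (vertex X \<sigma> 0)\<^esub>}.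
             simplex_boundary n X F \<psi> (c \<sigma>) \<sigma>)"

text \<open>The homology at \<open>B\<close> of \<open>A \<rightarrow> B \<rightarrow> C\<close> with maps \<open>f\<close> and \<open>g\<close>.\<close>

definition homology_at ::
  "'a monoid \<Rightarrow> ('a \<Rightarrow> 'b) \<Rightarrow> 'b monoid \<Rightarrow> ('b \<Rightarrow> 'c) \<Rightarrow> 'c monoid \<Rightarrow> 'b set monoid" where
  "homology_at A f B g C = (B\<lparr>carrier := kernel B C g\<rparr>) Mod (f ` carrier A)"

definition poset_homology ::
  "int \<Rightarrow> 'a rel \<Rightarrow> ('a \<Rightarrow> 'c monoid) \<Rightarrow> ('a \<Rightarrow> 'a \<Rightarrow> 'c \<Rightarrow> 'c) \<Rightarrow> ('a set \<Rightarrow> 'c) set monoid" where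
  "poset_homology n X F \<psi> =
     homology_at (chain_group (n + 1) X F) (chain_boundary (n + 1) X F \<psi>)
                 (chain_group n X F) (chain_boundary n X F \<psi>)
                 (chain_group (n - 1) X F)"


section \<open>Integral homology of posets as a functor\<close>

abbreviation const_Z :: "'a \<Rightarrow> int monoid" where
  "const_Z \<equiv> \<lambda>_. integer_group"

abbreviation const_Z_map :: "'a \<Rightarrow> 'a \<Rightarrow> int \<Rightarrow> int" where
  "const_Z_map \<equiv> \<lambda>_ _ k. k"

definition integral_homology :: "int \<Rightarrow> 'b rel \<Rightarrow> ('b set \<Rightarrow> int) set monoid" where
  "integral_homology n X = poset_homology n X const_Z const_Z_map"

text \<open>
  The simplicial chain map of an order-preserving map \<open>f : X \<rightarrow> Y\<close> of finite posets. Only simplices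
  \<open>\<sigma>\<close> on which \<open>f\<close> is injective contribute, since \<open>f ` \<sigma> = \<tau>\<close> forces \<open>card (f ` \<sigma>) = card \<sigma>\<close>; the
  others are sent to zero. No signs occur because \<open>f\<close> preserves the order of the vertices.
\<close>

definition induced_chain_map ::
  "int \<Rightarrow> 'b rel \<Rightarrow> 'd rel \<Rightarrow> ('b \<Rightarrow> 'd) \<Rightarrow> ('b set \<Rightarrow> int) \<Rightarrow> ('d set \<Rightarrow> int)" where
  "induced_chain_map n X Y f c = (\<lambda>\<tau>\<in>Ch n Y. \<Sum>\<sigma> | \<sigma> \<in> Ch n X \<and> f ` \<sigma> = \<tau>. c \<sigma>)"

text \<open>
  The induced map on homology classes (cosets): the class \<open>A\<close> of a cycle \<open>c\<close> goes to the class of the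
  image of \<open>c\<close>. The union over all representatives \<open>c\<close> of \<open>A\<close> is a union of equal cosets.
\<close>

definition induced_homology_map ::
  "int \<Rightarrow> 'b rel \<Rightarrow> 'd rel \<Rightarrow> ('b \<Rightarrow> 'd) \<Rightarrow> ('b set \<Rightarrow> int) set \<Rightarrow> ('d set \<Rightarrow> int) set" where
  "induced_homology_map n X Y f A =
     (\<Union>c\<in>A. (chain_boundary (n + 1) Y const_Z const_Z_map ` carrier (chain_group (n + 1) Y const_Z))
        #>\<^bsub>chain_group n Y const_Z\<^esub> induced_chain_map n X Y f c)"


section \<open>First-quadrant spectral sequences\<close>

text \<open>
  A homological first-quadrant spectral sequence, starting at the second page: \<open>E r p q\<close> is
  \<open>E\<^sup>r\<^sub>p\<^sub>,\<^sub>q\<close> and \<open>d r p q\<close> its outgoing differential. Nothing is required of \<open>E r\<close> and \<open>d r\<close>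
  for \<open>r < 2\<close>.
\<close>

locale spectral_sequence =
  fixes E :: "nat \<Rightarrow> int \<Rightarrow> int \<Rightarrow> 'e monoid" and d :: "nat \<Rightarrow> int \<Rightarrow> int \<Rightarrow> 'e \<Rightarrow> 'e"
  assumes abelian: "2 \<le> r \<Longrightarrow> comm_group (E r p q)"
    and first_quadrant: "\<lbrakk>2 \<le> r; p < 0 \<or> q < 0\<rbrakk> \<Longrightarrow> trivial_group (E r p q)"
    and differential: "2 \<le> r \<Longrightarrow> d r p q \<in> hom (E r p q) (E r (p - int r) (q + int r - 1))"
    and differential_squared: "\<lbrakk>2 \<le> r; x \<in> carrier (E r p q)\<rbrakk> \<Longrightarrow>
          d r (p - int r) (q + int r - 1) (d r p q x)
            = \<one>\<^bsub>E r (p - int r - int r) (q + int r - 1 + int r - 1)\<^esub>"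
    and next_page: "2 \<le> r \<Longrightarrow>
          E (Suc r) p q \<cong>
            homology_at (E r (p + int r) (q - int r + 1)) (d r (p + int r) (q - int r + 1))
                        (E r p q) (d r p q)
                        (E r (p - int r) (q + int r - 1))"

text \<open>
  Convergence \<open>E\<^sub>p\<^sub>,\<^sub>q \<Rightarrow> H\<^sub>p\<^sub>+\<^sub>q\<close>: each \<open>H n\<close> has a filtration
  \<open>0 = \<Phi> (-1) \<subseteq> \<Phi> 0 \<subseteq> \<dots> \<subseteq> \<Phi> n = H n\<close> with \<open>\<Phi> p / \<Phi> (p - 1)\<close> isomorphic to the
  limit term at position \<open>(p, n - p)\<close>. In a first-quadrant spectral sequence the terms at a fixed
  position are isomorphic to the limit term for all large \<open>r\<close>.
\<close>

definition converges_to :: "(nat \<Rightarrow> int \<Rightarrow> int \<Rightarrow> 'e monoid) \<Rightarrow> (int \<Rightarrow> 'h monoid) \<Rightarrow> bool" where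
  "converges_to E H \<longleftrightarrow>
     (\<forall>n. \<exists>\<Phi> :: int \<Rightarrow> 'h set.
        (\<forall>p. subgroup (\<Phi> p) (H n)) \<and>
        (\<forall>p. \<Phi> (p - 1) \<subseteq> \<Phi> p) \<and>
        \<Phi> (- 1) = {\<one>\<^bsub>H n\<^esub>} \<and>
        \<Phi> n = carrier (H n) \<and>
        (\<forall>p. \<forall>\<^sub>F r in sequentially. ((H n)\<lparr>carrier := \<Phi> p\<rparr>) Mod \<Phi> (p - 1) \<cong> E r p (n - p)))"

end

theory Submission
  imports Defs "HOL-Library.Function_Algebras"
begin

text \<open>
  Write \<open>Z\<close> for the homotopy colimit and \<open>M = Z \<squnion> P\<close> for the mapping cylinder of the projection
  \<open>\<pi> : Z \<rightarrow> P\<close>, with \<open>z < t\<close> iff \<open>\<pi> z \<le> t\<close>. The chains of \<open>M\<close> that meet both \<open>Z\<close> and \<open>P\<close> span the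
  relative chain complex of \<open>(M, Z \<squnion> P)\<close>. Since \<open>M\<close> retracts to \<open>P\<close>, its homology is that of \<open>Z\<close>, shifted
  by one. Filter it by the dimension of the \<open>P\<close>-part \<open>\<tau>\<close> of a chain: the part of the associated graded
  complex over a fixed \<open>\<tau>\<close> is the chain complex of \<open>{z \<in> Z. \<pi> z \<le> min \<tau>}\<close>, which retracts to
  \<open>D (min \<tau>)\<close>. Hence the first page is the complex \<open>C (P; H\<^sub>q)\<close>. Both retractions are instances of one
  acyclicity lemma: if \<open>f l\<close> is the least element above \<open>l \<in> L\<close> of the complement of a lower set \<open>L\<close>,
  then adding or removing \<open>f (max (\<sigma> \<inter> L))\<close> contracts the complex of chains \<open>\<sigma>\<close> that meet \<open>L\<close>,
  up to terms that shrink \<open>\<sigma> \<inter> L\<close>.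
\<close>

section \<open>Additive groups and their quotients\<close>

text \<open>A chain of the homotopy colimit does not split into a part in a fibre and a part in
  \<open>P\<close>, so its complex carries no evident double grading. The chains of the cylinder
  that meet both parts do split: they are the pairs of a chain \<open>s\<close> of \<open>Z\<close>
  and a chain \<open>\<tau>\<close> of \<open>P\<close> with \<open>s\<close> lying over elements up
  to min \<open>\<tau>\<close>. With \<open>P\<close> above \<open>Z\<close>, the coefficients sit
  at the minimum of \<open>\<tau>\<close>, as \<open>chain_group\<close> demands. Chains are total
  integer functions, zero off their support, so sums and boundaries are those of the function type;
  the groups of the statement are reached only through \<open>restrict\<close> and
  \<open>homology_class\<close>. Two obstacles concern types. Each page is a homology of the
  previous one, so its elements are naturally sets of elements of that page, yet all pages must
  share one type. A filtered complex solves this, since its pages are quotients of subgroups of one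
  group. The statement also asks for equality, not isomorphism, on the second page, in another type;
  later pages are carried into that type by injections of sets along which the group structure is
  transported.\<close>

definition additive_subgroup :: "'g::ab_group_add set \<Rightarrow> bool" where
  "additive_subgroup A \<longleftrightarrow> 0 \<in> A \<and> (\<forall>x\<in>A. \<forall>y\<in>A. x - y \<in> A)"

definition additive_group :: "'g::ab_group_add set \<Rightarrow> 'g monoid" where
  "additive_group A = \<lparr>carrier = A, monoid.mult = (+), one = 0\<rparr>"

lemma additive_group_simps [simp]:
  "carrier (additive_group A) = A"
  "x \<otimes>\<^bsub>additive_group A\<^esub> y = x + y"
  "\<one>\<^bsub>additive_group A\<^esub> = 0"
  by (simp_all add: additive_group_def)

lemma additive_subgroupD:
  assumes "additive_subgroup A"
  shows "0 \<in> A" "\<lbrakk>x \<in> A; y \<in> A\<rbrakk> \<Longrightarrow> x - y \<in> A" "x \<in> A \<Longrightarrow> - x \<in> A" "\<lbrakk>x \<in> A; y \<in> A\<rbrakk> \<Longrightarrow> x + y \<in> A"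
proof -
  show 0: "0 \<in> A" and diff: "\<And>x y. \<lbrakk>x \<in> A; y \<in> A\<rbrakk> \<Longrightarrow> x - y \<in> A"
    using assms by (auto simp: additive_subgroup_def)
  show minus: "- x \<in> A" if "x \<in> A" for x using diff[OF 0 that] by simp
  show "x + y \<in> A" if "x \<in> A" "y \<in> A" using diff[OF that(1) minus[OF that(2)]] by simp
qed

lemma comm_group_additive_group:
  assumes "additive_subgroup A" shows "comm_group (additive_group A)"
proof (rule comm_groupI)
  show "\<exists>y\<in>carrier (additive_group A). y \<otimes>\<^bsub>additive_group A\<^esub> x = \<one>\<^bsub>additive_group A\<^esub>"
    if "x \<in> carrier (additive_group A)" for x
    using that additive_subgroupD[OF assms] by (intro bexI[of _ "- x"]) auto
qed (use additive_subgroupD[OF assms] in \<open>auto simp: ac_simps\<close>)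

lemma inv_additive_group [simp]:
  assumes "additive_subgroup A" "x \<in> A"
  shows "inv\<^bsub>additive_group A\<^esub> x = - x"
proof -
  interpret comm_group "additive_group A" by (rule comm_group_additive_group) fact
  show ?thesis using inv_equality[of "- x" x] assms additive_subgroupD(3)[OF assms] by simp
qed

lemma subgroup_additive_group:
  assumes "additive_subgroup A" "additive_subgroup B" "B \<subseteq> A"
  shows "subgroup B (additive_group A)"
proof -
  interpret comm_group "additive_group A" by (rule comm_group_additive_group) fact
  show ?thesis
    by (rule subgroupI) (use assms additive_subgroupD[OF assms(2)] in \<open>auto\<close>)
qed

section \<open>First isomorphism theorem and the homology of a three-term complex\<close>

lemma FactGroup_iso_of_surj_hom:
  assumes "group G" "group H" "h \<in> hom G H" "h ` carrier G = carrier H"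
    "N = {x \<in> carrier G. h x = \<one>\<^bsub>H\<^esub>}"
  shows "G Mod N \<cong> H"
proof -
  interpret group_hom G H h using assms by (simp add: group_hom_def group_hom_axioms_def)
  show ?thesis using FactGroup_iso[OF assms(4)] assms(5) by (simp add: kernel_def)
qed

lemma comm_group_restrict:
  assumes "comm_group G" "subgroup K G" shows "comm_group (G\<lparr>carrier := K\<rparr>)"
proof -
  interpret comm_group G by fact
  show ?thesis
    using subgroup.subgroup_is_group[OF assms(2) is_group] subgroup.mem_carrier[OF assms(2)]
    by (intro group.group_comm_groupI) (auto simp: m_comm)
qed

context
  fixes A :: "'a monoid" and B :: "'b monoid" and C :: "'c monoid" and f g
  assumes A: "group A" and B: "comm_group B" and C: "group C"
    and f: "f \<in> hom A B" and g: "g \<in> hom B C"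
    and gf: "\<forall>a\<in>carrier A. g (f a) = \<one>\<^bsub>C\<^esub>"
begin

lemma subgroup_kernel_boundaries:
  shows "subgroup (kernel B C g) B" "subgroup (f ` carrier A) (B\<lparr>carrier := kernel B C g\<rparr>)"
    "comm_group (B\<lparr>carrier := kernel B C g\<rparr>)"
proof -
  interpret gg: group_hom B C g using B C g
    by (simp add: group_hom_def group_hom_axioms_def comm_group.axioms)
  interpret ff: group_hom A B f using A f
    by (simp add: group_hom_def group_hom_axioms_def gg.is_group)
  show 1: "subgroup (kernel B C g) B" by (rule gg.subgroup_kernel)
  show "subgroup (f ` carrier A) (B\<lparr>carrier := kernel B C g\<rparr>)"
    by (rule group.subgroup_incl[OF comm_group.axioms(2)[OF B] ff.img_is_subgroup 1]) (use gf in \<open>auto simp: kernel_def\<close>)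
  show "comm_group (B\<lparr>carrier := kernel B C g\<rparr>)" by (rule comm_group_restrict[OF B 1])
qed

lemma comm_group_homology_at: "comm_group (homology_at A f B g C)"
  unfolding homology_at_def
  by (rule comm_group.abelian_FactGroup[OF subgroup_kernel_boundaries(3,2)])

text \<open>Restricting the carrier does not change the multiplication, so cosets taken in
  \<open>B\<close> agree with cosets taken in the group of cycles; classes can be written without
  mentioning the kernel.\<close>

lemma homology_at_class_hom:
  "(\<lambda>x. f ` carrier A #>\<^bsub>B\<^esub> x) \<in> hom (B\<lparr>carrier := kernel B C g\<rparr>) (homology_at A f B g C)"
proof -
  interpret comm_group "B\<lparr>carrier := kernel B C g\<rparr>" by (rule subgroup_kernel_boundaries)
  have "f ` carrier A \<lhd> B\<lparr>carrier := kernel B C g\<rparr>"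
    using subgroup_imp_normal subgroup_kernel_boundaries(2) by blast
  from normal.r_coset_hom_Mod[OF this] show ?thesis
    by (simp add: homology_at_def r_coset_def)
qed

lemma carrier_homology_at:
  "carrier (homology_at A f B g C) = (\<lambda>x. f ` carrier A #>\<^bsub>B\<^esub> x) ` kernel B C g"
  by (simp add: homology_at_def carrier_FactGroup r_coset_def)

lemma one_homology_at: "\<one>\<^bsub>homology_at A f B g C\<^esub> = f ` carrier A"
  by (simp add: homology_at_def)

lemma homology_at_class_eq_one_iff:
  assumes "x \<in> kernel B C g"
  shows "f ` carrier A #>\<^bsub>B\<^esub> x = \<one>\<^bsub>homology_at A f B g C\<^esub> \<longleftrightarrow> x \<in> f ` carrier A"
proof -
  interpret comm_group "B\<lparr>carrier := kernel B C g\<rparr>" by (rule subgroup_kernel_boundaries)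
  show ?thesis
    unfolding one_homology_at
    using coset_join1[of "f ` carrier A" x] coset_join2[of x "f ` carrier A"] assms
      subgroup_kernel_boundaries(2) subgroup.subset[OF subgroup_kernel_boundaries(2)]
    by (auto simp: r_coset_def)
qed

end

section \<open>Quotients of additive subgroups and the maps between them\<close>

definition quotient_group :: "'g::ab_group_add set \<Rightarrow> 'g set \<Rightarrow> 'g set monoid" where
  "quotient_group A B = additive_group A Mod B"

definition coset :: "'g::ab_group_add set \<Rightarrow> 'g \<Rightarrow> 'g set" where
  "coset B x = (\<lambda>b. b + x) ` B"

lemma r_coset_additive_group [simp]: "B #>\<^bsub>additive_group A\<^esub> x = coset B x"
  by (auto simp: r_coset_def coset_def)

context
  fixes A B :: "'g::ab_group_add set"
  assumes A: "additive_subgroup A" and B: "additive_subgroup B" and BA: "B \<subseteq> A"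
begin

lemma comm_group_quotient_group: "comm_group (quotient_group A B)"
  unfolding quotient_group_def
  by (intro comm_group.abelian_FactGroup comm_group_additive_group subgroup_additive_group A B BA)

lemma coset_hom: "coset B \<in> hom (additive_group A) (quotient_group A B)"
proof -
  interpret comm_group "additive_group A" by (rule comm_group_additive_group) fact
  have "B \<lhd> additive_group A"
    using subgroup_imp_normal subgroup_additive_group A B BA by blast
  from normal.r_coset_hom_Mod[OF this] show ?thesis by (simp add: quotient_group_def)
qed

end

lemma carrier_quotient_group: "carrier (quotient_group A B) = coset B ` A"
  by (simp add: quotient_group_def carrier_FactGroup)

lemma one_quotient_group [simp]: "\<one>\<^bsub>quotient_group A B\<^esub> = B"
  by (simp add: quotient_group_def)

lemma coset_eq_iff:
  assumes "additive_subgroup B"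
  shows "coset B x = coset B y \<longleftrightarrow> x - y \<in> B"
proof
  assume "coset B x = coset B y"
  moreover have "x \<in> coset B x"
    unfolding coset_def using additive_subgroupD(1)[OF assms] by (intro image_eqI[of _ _ 0]) auto
  ultimately show "x - y \<in> B" by (auto simp: coset_def)
next
  have *: "coset B x \<subseteq> coset B y" if "x - y \<in> B" for x y
  proof
    fix z assume "z \<in> coset B x"
    then obtain b where "b \<in> B" "z = b + x" by (auto simp: coset_def)
    then have "z = (b + (x - y)) + y" "b + (x - y) \<in> B"
      using additive_subgroupD(4)[OF assms] that by auto
    then show "z \<in> coset B y" unfolding coset_def by (rule image_eqI)
  qed
  assume "x - y \<in> B"
  moreover from this have "y - x \<in> B" using additive_subgroupD(3)[OF assms] by fastforce
  ultimately show "coset B x = coset B y" using * by blast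
qed

lemma coset_eq_self_iff:
  assumes "additive_subgroup B"
  shows "coset B x = B \<longleftrightarrow> x \<in> B"
  using coset_eq_iff[OF assms, of x 0] by (simp add: coset_def)

lemma mult_coset:
  assumes "additive_subgroup A" "additive_subgroup B" "B \<subseteq> A" "x \<in> A" "y \<in> A"
  shows "coset B x \<otimes>\<^bsub>quotient_group A B\<^esub> coset B y = coset B (x + y)"
  using hom_mult[OF coset_hom[OF assms(1-3)], of x y] assms by simp

text \<open>The map of quotients induced by \<open>d\<close>, where \<open>B\<close> is the subgroup
  divided out in the target. It works on whole cosets, so no representative is chosen; independence
  of representatives is the assumption \<open>dB\<close> of the next lemma.\<close>

definition quotient_map :: "('g::ab_group_add \<Rightarrow> 'g) \<Rightarrow> 'g set \<Rightarrow> 'g set \<Rightarrow> 'g set" where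
  "quotient_map d B S = {b + d s |b s. b \<in> B \<and> s \<in> S}"

lemma quotient_map_coset:
  assumes d: "\<And>x y. d (x + y) = d x + d y"
    and B: "additive_subgroup B" and B': "additive_subgroup B'" and dB: "d ` B \<subseteq> B'"
  shows "quotient_map d B' (coset B x) = coset B' (d x)"
proof (intro equalityI subsetI)
  fix z assume "z \<in> quotient_map d B' (coset B x)"
  then obtain b b' where "b \<in> B" "b' \<in> B'" "z = b' + d (b + x)"
    by (auto simp: quotient_map_def coset_def)
  then have "z = (b' + d b) + d x" "b' + d b \<in> B'"
    using d dB additive_subgroupD(4)[OF B'] by (auto simp: add.assoc)
  then show "z \<in> coset B' (d x)" by (auto simp: coset_def)
next
  fix z assume "z \<in> coset B' (d x)"
  then show "z \<in> quotient_map d B' (coset B x)"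
    using additive_subgroupD(1)[OF B] by (force simp: quotient_map_def coset_def)
qed

lemma quotient_group_iso:
  assumes "additive_subgroup A" "group H" "h \<in> hom (additive_group A) H" "h ` A = carrier H"
    "B = {x \<in> A. h x = \<one>\<^bsub>H\<^esub>}"
  shows "quotient_group A B \<cong> H"
  unfolding quotient_group_def
  by (rule FactGroup_iso_of_surj_hom)
    (use assms comm_group_additive_group[OF assms(1)] in \<open>auto simp: comm_group_def\<close>)

lemma trivial_quotient_group:
  assumes "additive_subgroup A" shows "trivial_group (quotient_group A A)"
proof -
  have "group (quotient_group A A)"
    using comm_group_quotient_group[OF assms assms] by (simp add: comm_group_def)
  moreover have "coset A ` A = {A}"
    using coset_eq_self_iff[OF assms] additive_subgroupD(1)[OF assms] by auto
  ultimately show ?thesis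
    by (auto simp: trivial_group_def carrier_quotient_group)
qed

section \<open>Transporting a spectral sequence along an isomorphism of second pages\<close>

text \<open>Transport of structure along a map that is injective on the carrier. The target is a
  bare type, so the operation goes back through \<open>inv_into\<close> and is meaningful only on
  the image of \<open>h\<close>.\<close>

definition transported_group :: "('a \<Rightarrow> 'b) \<Rightarrow> 'a monoid \<Rightarrow> 'b monoid" where
  "transported_group h G = (let k = inv_into (carrier G) h in
     \<lparr>carrier = h ` carrier G, monoid.mult = \<lambda>x y. h (k x \<otimes>\<^bsub>G\<^esub> k y), one = h \<one>\<^bsub>G\<^esub>\<rparr>)"

lemma transported_group:
  assumes "comm_group G" "inj_on h (carrier G)"
  shows "h \<in> iso G (transported_group h G)" "comm_group (transported_group h G)"
proof -
  interpret comm_group G by fact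
  note [simp] = inv_into_f_f[OF assms(2)]
  show "h \<in> iso G (transported_group h G)"
    using assms(2) by (auto simp: iso_def hom_def transported_group_def Let_def bij_betw_def)
  show "comm_group (transported_group h G)"
  proof (rule comm_groupI)
    show "\<exists>y\<in>carrier (transported_group h G).
        y \<otimes>\<^bsub>transported_group h G\<^esub> x = \<one>\<^bsub>transported_group h G\<^esub>"
      if "x \<in> carrier (transported_group h G)" for x
    proof -
      obtain g where "g \<in> carrier G" "x = h g"
        using \<open>x \<in> _\<close> by (auto simp: transported_group_def Let_def)
      then show ?thesis
        by (intro bexI[of _ "h (inv\<^bsub>G\<^esub> g)"]) (auto simp: transported_group_def Let_def)
    qed
  qed (auto simp: transported_group_def Let_def m_ac)
qed

text \<open>Take \<open>j\<close> on cycles, followed by the class map of the second complex. This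
  is one surjection whose kernel consists exactly of the boundaries of the first complex, so the
  first isomorphism theorem applies.\<close>

lemma homology_at_iso:
  assumes grp: "group A" "comm_group B" "group C" "group A'" "comm_group B'" "group C'"
    and f: "f \<in> hom A B" and g: "g \<in> hom B C" and gf: "\<forall>a\<in>carrier A. g (f a) = \<one>\<^bsub>C\<^esub>"
    and f': "f' \<in> hom A' B'" and g': "g' \<in> hom B' C'"
    and gf': "\<forall>a\<in>carrier A'. g' (f' a) = \<one>\<^bsub>C'\<^esub>"
    and i: "i \<in> iso A A'" and j: "j \<in> iso B B'" and k: "k \<in> iso C C'"
    and fi: "\<And>a. a \<in> carrier A \<Longrightarrow> f' (i a) = j (f a)"
    and gj: "\<And>b. b \<in> carrier B \<Longrightarrow> g' (j b) = k (g b)"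
  shows "homology_at A f B g C \<cong> homology_at A' f' B' g' C'"
proof -
  note H' = grp(4,5,6) f' g' gf'
  let ?H' = "homology_at A' f' B' g' C'" and ?K = "B\<lparr>carrier := kernel B C g\<rparr>"
  interpret K: comm_group ?K by (rule subgroup_kernel_boundaries(3)[OF grp(1,2,3) f g gf])
  interpret kk: group_hom C C' k
    using grp k by (simp add: group_hom_def group_hom_axioms_def iso_def)
  have j_hom: "j \<in> hom B B'" and j_bij: "bij_betw j (carrier B) (carrier B')"
    and i_surj: "i ` carrier A = carrier A'" and k_inj: "inj_on k (carrier C)"
    using i j k by (auto simp: iso_def bij_betw_def)
  \<comment> \<open>Injectivity of \<open>k\<close> makes \<open>j\<close> reflect cycles and not
    only preserve them.\<close>
  have jker: "j b \<in> kernel B' C' g' \<longleftrightarrow> b \<in> kernel B C g" if "b \<in> carrier B" for b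
  proof -
    have "k (g b) = \<one>\<^bsub>C'\<^esub> \<longleftrightarrow> g b = \<one>\<^bsub>C\<^esub>"
      using k_inj hom_in_carrier[OF g that] unfolding kk.inj_on_one_iff by auto
    then show ?thesis using that bij_betwE[OF j_bij] gj by (simp add: kernel_def)
  qed
  have jK: "j \<in> hom ?K (B'\<lparr>carrier := kernel B' C' g'\<rparr>)"
    using j_hom jker by (auto simp: hom_def kernel_def)
  let ?\<theta> = "(\<lambda>x. f' ` carrier A' #>\<^bsub>B'\<^esub> x) \<circ> j"
  have "?\<theta> \<in> hom ?K ?H'"
    by (rule hom_compose[OF jK homology_at_class_hom[OF H']])
  moreover have "?\<theta> ` carrier ?K = carrier ?H'"
  proof -
    have "j ` kernel B C g = kernel B' C' g'"
      using jker bij_betw_imp_surj_on[OF j_bij] by (fastforce simp: kernel_def)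
    then have "(\<lambda>x. f' ` carrier A' #>\<^bsub>B'\<^esub> x) ` j ` kernel B C g = carrier ?H'"
      by (simp add: carrier_homology_at[OF H'])
    then show ?thesis by (simp add: image_image)
  qed
  moreover have "f ` carrier A = {x \<in> carrier ?K. ?\<theta> x = \<one>\<^bsub>?H'\<^esub>}"
  proof -
    have "?\<theta> x = \<one>\<^bsub>?H'\<^esub> \<longleftrightarrow> x \<in> f ` carrier A" if "x \<in> kernel B C g" for x
    proof -
      have x: "x \<in> carrier B" using that by (simp add: kernel_def)
      have "?\<theta> x = \<one>\<^bsub>?H'\<^esub> \<longleftrightarrow> j x \<in> f' ` carrier A'"
        using homology_at_class_eq_one_iff[OF H', of "j x"] jker[OF x] that by simp
      also have "\<dots> \<longleftrightarrow> j x \<in> j ` f ` carrier A"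
        using fi by (auto simp: i_surj[symmetric] image_image)
      also have "\<dots> \<longleftrightarrow> x \<in> f ` carrier A"
        using inj_on_image_mem_iff[OF _ x, of j "f ` carrier A"] j_bij hom_in_carrier[OF f]
        by (auto simp: bij_betw_def)
      finally show ?thesis .
    qed
    moreover have "f ` carrier A \<subseteq> kernel B C g"
      using gf hom_in_carrier[OF f] by (auto simp: kernel_def)
    ultimately show ?thesis by auto
  qed
  ultimately show ?thesis
    unfolding homology_at_def[of A]
    using FactGroup_iso_of_surj_hom[OF K.is_group comm_group.axioms(2)[OF comm_group_homology_at[OF H']]]
    by blast
qed

text \<open>Taking homology raises the type of the elements by one set level. Cosets are nonempty
  and pairwise disjoint, so choosing representatives embeds the homology, as a mere set, back into
  the middle group.\<close>

lemma inj_on_homology_at_representative: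
  assumes "group A" "comm_group B" "group C" "f \<in> hom A B" "g \<in> hom B C"
    "\<forall>a\<in>carrier A. g (f a) = \<one>\<^bsub>C\<^esub>"
  shows "inj_on (\<lambda>S. SOME x. x \<in> S) (carrier (homology_at A f B g C))"
    "(\<lambda>S. SOME x. x \<in> S) ` carrier (homology_at A f B g C) \<subseteq> carrier B"
proof -
  let ?K = "B\<lparr>carrier := kernel B C g\<rparr>" and ?N = "f ` carrier A"
  interpret K: comm_group ?K by (rule subgroup_kernel_boundaries(3)[OF assms])
  interpret N: subgroup ?N ?K by (rule subgroup_kernel_boundaries(2)[OF assms])
  have *: "(SOME x. x \<in> S) \<in> S" if "S \<in> carrier (homology_at A f B g C)" for S
    using N.rcosets_non_empty[of S] that K.is_group
    by (auto simp: homology_at_def FactGroup_def some_in_eq)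
  have disj: "pairwise disjnt (carrier (homology_at A f B g C))"
    using K.rcos_disjoint[OF N.subgroup_axioms] by (simp add: homology_at_def FactGroup_def)
  show "inj_on (\<lambda>S. SOME x. x \<in> S) (carrier (homology_at A f B g C))"
  proof (rule inj_onI)
    fix S T assume S: "S \<in> carrier (homology_at A f B g C)" and T: "T \<in> carrier (homology_at A f B g C)"
      and "(SOME x. x \<in> S) = (SOME x. x \<in> T)"
    then show "S = T" using *[OF S] *[OF T] disj by (auto simp: pairwise_def disjnt_def)
  qed
  have "S \<subseteq> carrier B" if "S \<in> carrier (homology_at A f B g C)" for S
  proof -
    have "S \<subseteq> carrier ?K"
      using that K.rcosets_part_G[OF N.subgroup_axioms] by (auto simp: homology_at_def FactGroup_def)
    then show ?thesis by (auto simp: kernel_def)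
  qed
  then show "(\<lambda>S. SOME x. x \<in> S) ` carrier (homology_at A f B g C) \<subseteq> carrier B"
    using * by blast
qed

section \<open>Moving all pages into the type of a copy of the second page\<close>

context spectral_sequence
begin

lemma group_page: "2 \<le> r \<Longrightarrow> group (E r p q)"
  using abelian comm_group.axioms(2) by blast

lemma differential_in:
  assumes "2 \<le> r"
  shows "d r (p + int r) (q - int r + 1) \<in> hom (E r (p + int r) (q - int r + 1)) (E r p q)"
  using differential[OF assms, of "p + int r" "q - int r + 1"] by simp

lemma differential_squared_in:
  assumes "2 \<le> r"
  shows "\<forall>x\<in>carrier (E r (p + int r) (q - int r + 1)).
    d r p q (d r (p + int r) (q - int r + 1) x) = \<one>\<^bsub>E r (p - int r) (q + int r - 1)\<^esub>"
  using differential_squared[OF assms, of _ "p + int r" "q - int r + 1"] by simp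

lemmas page_homology_facts =
  group_page abelian group_page differential_in differential differential_squared_in

text \<open>Compose the isomorphism with homology, the choice of representatives and the embedding
  of the previous page. The result respects no group structure; it only has to supply enough room in
  the type.\<close>

lemma page_embeds_in_second_page:
  assumes "2 \<le> r"
  shows "\<exists>h. inj_on h (carrier (E r p q)) \<and> h ` carrier (E r p q) \<subseteq> carrier (E 2 p q)"
  using assms
proof (induction r rule: nat_induct_at_least)
  case base
  show ?case by (intro exI[of _ id]) simp
next
  case (Suc r)
  note P = page_homology_facts[OF Suc.hyps]
  let ?H = "homology_at (E r (p + int r) (q - int r + 1)) (d r (p + int r) (q - int r + 1))
    (E r p q) (d r p q) (E r (p - int r) (q + int r - 1))"
  obtain i where i: "i \<in> iso (E (Suc r) p q) ?H"
    using next_page[OF Suc.hyps] by (auto simp: is_iso_def)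
  obtain h where h: "inj_on h (carrier (E r p q))" "h ` carrier (E r p q) \<subseteq> carrier (E 2 p q)"
    using Suc.IH by blast
  let ?s = "\<lambda>S. SOME x. x \<in> S"
  have s: "inj_on ?s (carrier ?H)" "?s ` carrier ?H \<subseteq> carrier (E r p q)"
    by (rule inj_on_homology_at_representative[OF P])+
  have i': "inj_on i (carrier (E (Suc r) p q))" "i ` carrier (E (Suc r) p q) = carrier ?H"
    using i by (auto simp: iso_def bij_betw_def)
  have "inj_on (h \<circ> (?s \<circ> i)) (carrier (E (Suc r) p q))"
  proof (intro comp_inj_on)
    show "inj_on h ((?s \<circ> i) ` carrier (E (Suc r) p q))"
      by (rule inj_on_subset[OF h(1)]) (use s(2) i'(2) in auto)
  qed (use i' s in auto)
  moreover have "(h \<circ> (?s \<circ> i)) ` carrier (E (Suc r) p q) \<subseteq> carrier (E 2 p q)"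
    using h(2) s(2) i'(2) by (auto simp: image_subset_iff)
  ultimately show ?case by blast
qed

text \<open>All pages are subquotients of the second one, so they embed into any copy of it.\<close>

lemma transport_second_page:
  assumes G: "\<And>p q. comm_group (G p q)" and iso2: "\<And>p q. E 2 p q \<cong> G p q"
  shows "\<exists>E' d'. spectral_sequence E' d' \<and> (\<forall>p q. E' 2 p q = G p q) \<and>
    (\<forall>r p q. 2 \<le> r \<longrightarrow> E r p q \<cong> E' r p q)"
proof -
  have "\<forall>p q. \<exists>i. i \<in> iso (E 2 p q) (G p q)" using iso2 by (auto simp: is_iso_def)
  then obtain i where i: "\<And>p q. i p q \<in> iso (E 2 p q) (G p q)" by metis
  have "\<exists>h. 2 \<le> r \<longrightarrow> inj_on h (carrier (E r p q)) \<and> h ` carrier (E r p q) \<subseteq> carrier (E 2 p q)"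
    for r p q using page_embeds_in_second_page[of r p q] by blast
  then obtain e where e: "\<And>r p q. 2 \<le> r \<Longrightarrow> inj_on (e r p q) (carrier (E r p q))"
    "\<And>r p q. 2 \<le> r \<Longrightarrow> e r p q ` carrier (E r p q) \<subseteq> carrier (E 2 p q)" by metis
  \<comment> \<open>On the second page this is the prescribed isomorphism; later pages reach the
    type of \<open>G\<close> through their injection into \<open>E 2\<close>.\<close>
  define h where "h r p q = (if r = 2 then i p q else i p q \<circ> e r p q)" for r p q
  \<comment> \<open>The second page is set to \<open>G\<close> itself: a transported record could
    differ from it off the carrier, which would spoil the equality.\<close>
  define E' where "E' r p q = (if r = 2 then G p q else transported_group (h r p q) (E r p q))" for r p q
  have h_inj: "inj_on (h r p q) (carrier (E r p q))" if "2 \<le> r" for r p q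
  proof -
    have inj: "inj_on (i p q) (carrier (E 2 p q))" using i[of p q] by (simp add: iso_def bij_betw_def)
    show ?thesis
    proof (cases "r = 2")
      case False
      then show ?thesis
        using e[OF that, of p q] comp_inj_on[of "e r p q" _ "i p q"] inj_on_subset[OF inj]
        by (simp add: h_def)
    qed (simp add: h_def inj)
  qed
  have h: "h r p q \<in> iso (E r p q) (E' r p q)" and E': "comm_group (E' r p q)" if "2 \<le> r" for r p q
    using transported_group[OF abelian[OF that] h_inj[OF that], of p q] i G
    by (auto simp: E'_def h_def)
  have E'_group: "group (E' r p q)" if "2 \<le> r" for r p q
    using E'[OF that] by (simp add: comm_group_def)
  define k where "k r p q = inv_into (carrier (E r p q)) (h r p q)" for r p q
  define d' where "d' r p q = h r (p - int r) (q + int r - 1) \<circ> (d r p q \<circ> k r p q)" for r p q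
  have h_hom: "h r p q \<in> hom (E r p q) (E' r p q)" if "2 \<le> r" for r p q
    using h[OF that] by (simp add: iso_def)
  have k_hom: "k r p q \<in> hom (E' r p q) (E r p q)" if "2 \<le> r" for r p q
    using group.iso_set_sym[OF group_page[OF that] h[OF that]] by (simp add: k_def iso_def)
  have kh: "k r p q (h r p q x) = x" if "2 \<le> r" "x \<in> carrier (E r p q)" for r p q x
    unfolding k_def by (rule inv_into_f_f[OF h_inj[OF that(1)] that(2)])
  have d'_hom: "d' r p q \<in> hom (E' r p q) (E' r (p - int r) (q + int r - 1))" if "2 \<le> r" for r p q
    unfolding d'_def by (rule hom_compose[OF hom_compose[OF k_hom[OF that] differential[OF that]] h_hom[OF that]])
  have d'_sq: "d' r (p - int r) (q + int r - 1) (d' r p q x)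
      = \<one>\<^bsub>E' r (p - int r - int r) (q + int r - 1 + int r - 1)\<^esub>"
    if r: "2 \<le> r" and x: "x \<in> carrier (E' r p q)" for r p q x
  proof -
    have kx: "k r p q x \<in> carrier (E r p q)" by (rule hom_in_carrier[OF k_hom[OF r] x])
    show ?thesis
      using kh[OF r hom_in_carrier[OF differential[OF r] kx]] differential_squared[OF r kx]
        hom_one[OF h_hom[OF r] group_page[OF r] E'_group[OF r]]
      by (simp add: d'_def)
  qed
  have "spectral_sequence E' d'"
  proof (rule spectral_sequence.intro)
    fix r :: nat and p q :: int assume r: "2 \<le> r"
    show "comm_group (E' r p q)" by (rule E'[OF r])
    show "d' r p q \<in> hom (E' r p q) (E' r (p - int r) (q + int r - 1))" by (rule d'_hom[OF r])
    have d'_in: "d' r (p + int r) (q - int r + 1) \<in> hom (E' r (p + int r) (q - int r + 1)) (E' r p q)"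
      using d'_hom[OF r, of "p + int r" "q - int r + 1"] by simp
    have d'_sq_in: "\<forall>x\<in>carrier (E' r (p + int r) (q - int r + 1)).
        d' r p q (d' r (p + int r) (q - int r + 1) x) = \<one>\<^bsub>E' r (p - int r) (q + int r - 1)\<^esub>"
      using d'_sq[OF r, of _ "p + int r" "q - int r + 1"] by simp
    have "E (Suc r) p q \<cong> E' (Suc r) p q" using h[of "Suc r" p q] r by (auto simp: is_iso_def)
    then have "E' (Suc r) p q \<cong> E (Suc r) p q"
      by (rule group.iso_sym[OF group_page, rotated]) (use r in simp)
    also have "E (Suc r) p q \<cong> homology_at (E r (p + int r) (q - int r + 1))
        (d r (p + int r) (q - int r + 1)) (E r p q) (d r p q) (E r (p - int r) (q + int r - 1))"
      by (rule next_page[OF r])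
    also have "\<dots> \<cong> homology_at (E' r (p + int r) (q - int r + 1))
        (d' r (p + int r) (q - int r + 1)) (E' r p q) (d' r p q) (E' r (p - int r) (q + int r - 1))"
      by (rule homology_at_iso[OF page_homology_facts(1-3)[OF r] E'_group[OF r] E'[OF r]
            E'_group[OF r] page_homology_facts(4-6)[OF r] d'_in d'_hom[OF r] d'_sq_in
            h[OF r] h[OF r] h[OF r]])
        (auto simp: d'_def kh[OF r])
    finally show "E' (Suc r) p q \<cong> homology_at (E' r (p + int r) (q - int r + 1))
        (d' r (p + int r) (q - int r + 1)) (E' r p q) (d' r p q) (E' r (p - int r) (q + int r - 1))" .
  next
    fix r :: nat and p q :: int assume "2 \<le> r" "p < 0 \<or> q < 0"
    then show "trivial_group (E' r p q)"
      using isomorphic_group_triviality1[OF is_isoI[OF h] E'_group first_quadrant] by blast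
  qed (rule d'_sq)
  moreover have "\<forall>p q. E' 2 p q = G p q" by (simp add: E'_def)
  moreover have "\<forall>r p q. 2 \<le> r \<longrightarrow> E r p q \<cong> E' r p q" using h by (auto simp: is_iso_def)
  ultimately show ?thesis by blast
qed

end

lemma converges_to_iso:
  assumes conv: "converges_to E H" and iso: "\<And>r p q. 2 \<le> r \<Longrightarrow> E r p q \<cong> E' r p q"
  shows "converges_to E' H"
  unfolding converges_to_def
proof
  fix n
  from conv[unfolded converges_to_def, THEN spec, of n]
  show "\<exists>\<Phi>. (\<forall>p. subgroup (\<Phi> p) (H n)) \<and> (\<forall>p. \<Phi> (p - 1) \<subseteq> \<Phi> p) \<and>
      \<Phi> (- 1) = {\<one>\<^bsub>H n\<^esub>} \<and> \<Phi> n = carrier (H n) \<and>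
      (\<forall>p. \<forall>\<^sub>F r in sequentially. ((H n)\<lparr>carrier := \<Phi> p\<rparr>) Mod \<Phi> (p - 1) \<cong> E' r p (n - p))"
  proof (elim exE conjE, intro exI conjI)
    fix \<Phi>
    assume lim: "\<forall>p. \<forall>\<^sub>F r in sequentially. ((H n)\<lparr>carrier := \<Phi> p\<rparr>) Mod \<Phi> (p - 1) \<cong> E r p (n - p)"
    show "\<forall>p. \<forall>\<^sub>F r in sequentially. ((H n)\<lparr>carrier := \<Phi> p\<rparr>) Mod \<Phi> (p - 1) \<cong> E' r p (n - p)"
    proof
      fix p
      show "\<forall>\<^sub>F r in sequentially. ((H n)\<lparr>carrier := \<Phi> p\<rparr>) Mod \<Phi> (p - 1) \<cong> E' r p (n - p)"
        using lim[THEN spec, of p] eventually_ge_at_top[of 2]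
        by eventually_elim (rule iso_trans[OF _ iso])
    qed
  qed
qed

section \<open>The spectral sequence of a filtered complex\<close>

lemma hom_additive_group_restrict:
  assumes "h \<in> hom (additive_group A) H" "A' \<subseteq> A" "h ` A' \<subseteq> K"
  shows "h \<in> hom (additive_group A') (H\<lparr>carrier := K\<rparr>)"
  by (rule homI) (use assms hom_mult[OF assms(1)] in \<open>auto simp: subset_iff\<close>)

text \<open>\<open>F p n\<close> is filtration step \<open>p\<close> in degree \<open>n\<close>,
  inside one ambient group with one operator for all degrees. The whole group in degree
  \<open>n\<close> is \<open>F n n\<close>, by \<open>F_top\<close>; with \<open>F_neg\<close> this
  bounds the filtration in each degree and puts the pages into the first quadrant.\<close>

locale filtered_complex =
  fixes F :: "int \<Rightarrow> int \<Rightarrow> 'g::ab_group_add set" and d :: "'g \<Rightarrow> 'g"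
  assumes F_subgroup: "additive_subgroup (F p n)"
    and F_step: "F (p - 1) n \<subseteq> F p n"
    and d_add: "d (x + y) = d x + d y"
    and d_F: "x \<in> F p n \<Longrightarrow> d x \<in> F p (n - 1)"
    and d_d: "d (d x) = 0"
    and F_neg: "p < 0 \<Longrightarrow> F p n = {0}"
    and F_top: "n \<le> p \<Longrightarrow> F p n = F n n"
begin

lemma F_mono: "p \<le> p' \<Longrightarrow> F p n \<subseteq> F p' n"
proof (induction p' rule: int_ge_induct)
  case (step i)
  then show ?case using F_step[of "i + 1" n] by auto
qed simp

lemma F_le_top: "F p n \<subseteq> F n n"
  using F_mono[of p n n] F_top[of n p] by (cases "p \<le> n") auto

lemma d_zero [simp]: "d 0 = 0"
  using d_add[of 0 0] by simp

lemma d_minus: "d (- x) = - d x"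
  using d_add[of "- x" x] by (simp add: eq_neg_iff_add_eq_0)

lemma d_diff: "d (x - y) = d x - d y"
  using d_add[of x "- y"] by (simp add: d_minus)

lemmas F_zero = additive_subgroupD(1)[OF F_subgroup]
lemmas F_diff = additive_subgroupD(2)[OF F_subgroup]
lemmas F_minus = additive_subgroupD(3)[OF F_subgroup]
lemmas F_add = additive_subgroupD(4)[OF F_subgroup]

section \<open>Approximate cycles and boundaries, pages and their differentials\<close>

definition Z :: "int \<Rightarrow> int \<Rightarrow> int \<Rightarrow> 'g set" where
  "Z k p n = {x \<in> F p n. d x \<in> F (p - k) (n - 1)}"

text \<open>The usual denominator
  \<open>d (Z (k - 1) (p + k - 1) (n + 1)) + Z (k - 1) (p - 1) n\<close> of page \<open>k\<close>,
  with the two shifted groups of approximate cycles written out. The index \<open>k\<close> is an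
  integer, so \<open>k - 1\<close> is not truncated.\<close>

definition B :: "int \<Rightarrow> int \<Rightarrow> int \<Rightarrow> 'g set" where
  "B k p n = {d u + f |u f. u \<in> F (p + k - 1) (n + 1) \<and> d u \<in> F p n \<and>
     f \<in> F (p - 1) n \<and> d f \<in> F (p - k) (n - 1)}"

lemma B_I:
  assumes "x = d u + f" "u \<in> F (p + k - 1) (n + 1)" "d u \<in> F p n" "f \<in> F (p - 1) n"
    "d f \<in> F (p - k) (n - 1)"
  shows "x \<in> B k p n"
  using assms unfolding B_def by blast

lemma Z_subgroup: "additive_subgroup (Z k p n)"
  by (auto simp: additive_subgroup_def Z_def F_zero F_diff d_diff)

lemma B_subgroup: "additive_subgroup (B k p n)"
proof -
  have "0 \<in> B k p n" by (intro B_I[of _ 0 0]) (simp_all add: F_zero)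
  moreover have "x - y \<in> B k p n" if "x \<in> B k p n" "y \<in> B k p n" for x y
  proof -
    obtain u f v g where *: "x = d u + f" "u \<in> F (p + k - 1) (n + 1)" "d u \<in> F p n"
      "f \<in> F (p - 1) n" "d f \<in> F (p - k) (n - 1)"
      "y = d v + g" "v \<in> F (p + k - 1) (n + 1)" "d v \<in> F p n"
      "g \<in> F (p - 1) n" "d g \<in> F (p - k) (n - 1)"
      using \<open>x \<in> _\<close> \<open>y \<in> _\<close> by (auto simp: B_def)
    then have "x - y = d (u - v) + (f - g)" by (simp add: d_diff)
    then show ?thesis by (intro B_I[of _ "u - v" "f - g"]) (use * F_diff d_diff in \<open>auto\<close>)
  qed
  ultimately show ?thesis by (auto simp: additive_subgroup_def)
qed

lemma B_le_Z: "B k p n \<subseteq> Z k p n"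
  unfolding B_def Z_def using F_step[of p n] F_add by (auto simp: d_add d_d)

lemma d_Z: "x \<in> Z k p n \<Longrightarrow> d x \<in> Z k (p - k) (n - 1)"
  using F_zero by (simp add: Z_def d_d)

lemma d_B: "x \<in> B k p n \<Longrightarrow> d x \<in> B k (p - k) (n - 1)"
proof -
  assume "x \<in> B k p n"
  then obtain u f where "x = d u + f" "f \<in> F (p - 1) n" "d f \<in> F (p - k) (n - 1)"
    by (auto simp: B_def)
  then show ?thesis
    by (intro B_I[of _ f 0]) (use F_zero in \<open>auto simp: d_add d_d\<close>)
qed

definition page :: "nat \<Rightarrow> int \<Rightarrow> int \<Rightarrow> 'g set monoid" where
  "page r p q = quotient_group (Z (int r) p (p + q)) (B (int r) p (p + q))"

definition page_differential :: "nat \<Rightarrow> int \<Rightarrow> int \<Rightarrow> 'g set \<Rightarrow> 'g set" where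
  "page_differential r p q = quotient_map d (B (int r) (p - int r) (p + q - 1))"

lemma comm_group_page: "comm_group (page r p q)"
  unfolding page_def by (rule comm_group_quotient_group[OF Z_subgroup B_subgroup B_le_Z])

lemma page_coset_hom: "coset (B (int r) p (p + q)) \<in> hom (additive_group (Z (int r) p (p + q))) (page r p q)"
  unfolding page_def by (rule coset_hom[OF Z_subgroup B_subgroup B_le_Z])

lemma carrier_page: "carrier (page r p q) = coset (B (int r) p (p + q)) ` Z (int r) p (p + q)"
  by (simp add: page_def carrier_quotient_group)

lemma one_page: "\<one>\<^bsub>page r p q\<^esub> = B (int r) p (p + q)"
  by (simp add: page_def)

lemma page_differential_coset:
  "page_differential r p q (coset (B (int r) p (p + q)) x) = coset (B (int r) (p - int r) (p + q - 1)) (d x)"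
  unfolding page_differential_def using d_B
  by (intro quotient_map_coset) (auto intro: B_subgroup d_add)

lemma page_differential_hom:
  "page_differential r p q \<in> hom (page r p q) (page r (p - int r) (q + int r - 1))"
proof -
  have n: "p - int r + (q + int r - 1) = p + q - 1" by simp
  show ?thesis
  proof (rule homI)
    fix x assume "x \<in> carrier (page r p q)"
    then show "page_differential r p q x \<in> carrier (page r (p - int r) (q + int r - 1))"
      by (auto simp: carrier_page n page_differential_coset d_Z)
  next
    fix x y assume "x \<in> carrier (page r p q)" "y \<in> carrier (page r p q)"
    then obtain a b where *: "a \<in> Z (int r) p (p + q)" "x = coset (B (int r) p (p + q)) a"
      "b \<in> Z (int r) p (p + q)" "y = coset (B (int r) p (p + q)) b"
      by (auto simp: carrier_page)
    have "page_differential r p q (x \<otimes>\<^bsub>page r p q\<^esub> y)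
        = coset (B (int r) (p - int r) (p + q - 1)) (d a + d b)"
      using * mult_coset[OF Z_subgroup B_subgroup B_le_Z] by (simp add: page_def page_differential_coset d_add)
    also have "\<dots> = page_differential r p q x
        \<otimes>\<^bsub>page r (p - int r) (q + int r - 1)\<^esub> page_differential r p q y"
      using * d_Z mult_coset[OF Z_subgroup B_subgroup B_le_Z]
      by (simp add: page_def n page_differential_coset)
    finally show "page_differential r p q (x \<otimes>\<^bsub>page r p q\<^esub> y) = page_differential r p q x
        \<otimes>\<^bsub>page r (p - int r) (q + int r - 1)\<^esub> page_differential r p q y" .
  qed
qed

text \<open>The substance is the passage to the next page: \<open>Z (k + 1) p\<close> maps onto the
  kernel of the differential of page \<open>k\<close>, and the elements whose classes become
  boundaries there are exactly \<open>B (k + 1) p\<close>.\<close>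

lemma spectral_sequence_page: "spectral_sequence page page_differential"
proof (rule spectral_sequence.intro)
  fix r :: nat and p q :: int assume r: "2 \<le> r"
  show "comm_group (page r p q)" by (rule comm_group_page)
  show "page_differential r p q \<in> hom (page r p q) (page r (p - int r) (q + int r - 1))"
    by (rule page_differential_hom)
  let ?k = "int r" and ?n = "p + q"
  let ?A = "page r (p + int r) (q - int r + 1)" and ?f = "page_differential r (p + int r) (q - int r + 1)"
    and ?B = "page r p q" and ?g = "page_differential r p q"
    and ?C = "page r (p - int r) (q + int r - 1)"
  have idx: "p + ?k + (q - ?k + 1) = ?n + 1" "p - ?k + (q + ?k - 1) = ?n - 1" by simp_all
  have f: "?f \<in> hom ?A ?B" using page_differential_hom[of r "p + ?k" "q - ?k + 1"] by simp
  have fc: "?f (coset (B ?k (p + ?k) (?n + 1)) x) = coset (B ?k p ?n) (d x)" for x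
    using page_differential_coset[of r "p + ?k" "q - ?k + 1" x] by (simp add: idx)
  have gf: "\<forall>S\<in>carrier ?A. ?g (?f S) = \<one>\<^bsub>?C\<^esub>"
  proof
    fix S assume "S \<in> carrier ?A"
    then obtain x where "S = coset (B ?k (p + ?k) (?n + 1)) x" by (auto simp: carrier_page idx)
    then have "?g (?f S) = coset (B ?k (p - ?k) (?n - 1)) 0"
      by (simp add: fc page_differential_coset d_d)
    also have "\<dots> = \<one>\<^bsub>?C\<^esub>" by (simp add: coset_def one_page idx)
    finally show "?g (?f S) = \<one>\<^bsub>?C\<^esub>" .
  qed
  note grp = comm_group.axioms(2)[OF comm_group_page]
  note H = grp[of r "p + ?k" "q - ?k + 1"] comm_group_page[of r p q]
    grp[of r "p - ?k" "q + ?k - 1"] f page_differential_hom[of r p q] gf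
  let ?H = "homology_at ?A ?f ?B ?g ?C"
  let ?c = "coset (B ?k p ?n)"
  have Z_step: "Z (?k + 1) p ?n \<subseteq> Z ?k p ?n"
    using F_mono[of "p - (?k + 1)" "p - ?k"] by (auto simp: Z_def)
  have in_ker: "?c x \<in> kernel ?B ?C ?g \<longleftrightarrow> d x \<in> B ?k (p - ?k) (?n - 1)" if "x \<in> Z ?k p ?n" for x
    using that coset_eq_self_iff[OF B_subgroup]
    by (auto simp: kernel_def carrier_page page_differential_coset one_page idx)
  have Z_ker: "?c x \<in> kernel ?B ?C ?g" if "x \<in> Z (?k + 1) p ?n" for x
  proof -
    have "d x \<in> B ?k (p - ?k) (?n - 1)"
      by (intro B_I[of _ 0 "d x"]) (use that F_zero in \<open>auto simp: Z_def d_d diff_diff_eq\<close>)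
    then show ?thesis using in_ker that Z_step by blast
  qed
  have "?c \<in> hom (additive_group (Z (?k + 1) p ?n)) (?B\<lparr>carrier := kernel ?B ?C ?g\<rparr>)"
    by (rule hom_additive_group_restrict[OF page_coset_hom Z_step]) (use Z_ker in auto)
  from hom_compose[OF this homology_at_class_hom[OF H]]
  have \<theta>: "(\<lambda>S. ?f ` carrier ?A #>\<^bsub>?B\<^esub> S) \<circ> ?c \<in> hom (additive_group (Z (?k + 1) p ?n)) ?H" by simp
  have surj: "?c ` Z (?k + 1) p ?n = kernel ?B ?C ?g"
  proof (intro equalityI subsetI)
    fix S assume S: "S \<in> kernel ?B ?C ?g"
    then obtain y where y: "y \<in> Z ?k p ?n" "S = ?c y" by (auto simp: kernel_def carrier_page)
    then have "d y \<in> B ?k (p - ?k) (?n - 1)" using in_ker S by blast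
    \<comment> \<open>A zero class in the target means that \<open>d y\<close> agrees with
      \<open>d w\<close> up to step \<open>p - k - 1\<close>, with \<open>w\<close> one step below
      \<open>y\<close>. So \<open>y - w\<close> is in \<open>Z (k + 1)\<close>, and \<open>w\<close>
      is in \<open>B k p\<close>, which leaves the class unchanged.\<close>
    then obtain w f where w: "d y = d w + f" "w \<in> F (p - 1) ?n" "d w \<in> F (p - ?k) (?n - 1)"
      "f \<in> F (p - ?k - 1) (?n - 1)" by (auto simp: B_def)
    then have "y - w \<in> Z (?k + 1) p ?n"
      using y w F_step[of p ?n] F_diff[of y p ?n w] by (auto simp: Z_def d_diff algebra_simps)
    moreover have "w \<in> B ?k p ?n"
      by (intro B_I[of _ 0 w]) (use w F_zero in \<open>auto\<close>)
    then have "?c (y - w) = S" using coset_eq_iff[OF B_subgroup] additive_subgroupD(3)[OF B_subgroup] y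
      by simp
    ultimately show "S \<in> ?c ` Z (?k + 1) p ?n" by blast
  qed (use Z_ker in auto)
  have kernel: "B (?k + 1) p ?n = {x \<in> Z (?k + 1) p ?n.
      ((\<lambda>S. ?f ` carrier ?A #>\<^bsub>?B\<^esub> S) \<circ> ?c) x = \<one>\<^bsub>?H\<^esub>}"
  proof -
    have "?c z \<in> ?f ` carrier ?A \<longleftrightarrow> z \<in> B (?k + 1) p ?n" if z: "z \<in> Z (?k + 1) p ?n" for z
    proof
      assume "?c z \<in> ?f ` carrier ?A"
      then obtain u where u: "u \<in> Z ?k (p + ?k) (?n + 1)" "?c z = ?c (d u)"
        by (auto simp: carrier_page idx fc)
      then have "z - d u \<in> B ?k p ?n" using coset_eq_iff[OF B_subgroup] by blast
      then obtain w f where w: "z - d u = d w + f" "w \<in> F (p + ?k - 1) (?n + 1)" "d w \<in> F p ?n"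
        "f \<in> F (p - 1) ?n" by (auto simp: B_def)
      \<comment> \<open>The boundary of \<open>u\<close> and the ambiguity \<open>d w\<close> merge
        into one boundary; \<open>u + w\<close> lies in step \<open>p + k\<close>, exactly the bound
        in \<open>B (k + 1)\<close>.\<close>
      then have zeq: "z = d (u + w) + f" by (simp add: d_add algebra_simps)
      then have "d f = d z" by (simp add: d_add d_d)
      moreover have "u + w \<in> F (p + ?k) (?n + 1)" "d (u + w) \<in> F p ?n"
        using u w F_add[of u "p + ?k" "?n + 1" w] F_add[of "d u" p ?n "d w"] F_step[of "p + ?k" "?n + 1"]
        by (auto simp: Z_def d_add)
      ultimately show "z \<in> B (?k + 1) p ?n"
        by (intro B_I[of _ "u + w" f]) (use zeq w z in \<open>auto simp: Z_def\<close>)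
    next
      assume "z \<in> B (?k + 1) p ?n"
      then obtain u f where u: "z = d u + f" "u \<in> F (p + ?k) (?n + 1)" "d u \<in> F p ?n"
        "f \<in> F (p - 1) ?n" "d f \<in> F (p - (?k + 1)) (?n - 1)" by (auto simp: B_def)
      then have "u \<in> Z ?k (p + ?k) (?n + 1)" by (simp add: Z_def)
      moreover have "f \<in> B ?k p ?n"
        by (intro B_I[of _ 0 f]) (use u F_zero F_mono[of "p - (?k + 1)" "p - ?k"] in \<open>auto\<close>)
      then have "?c z = ?c (d u)" using coset_eq_iff[OF B_subgroup] u by simp
      ultimately show "?c z \<in> ?f ` carrier ?A" by (auto simp: carrier_page idx fc[symmetric])
    qed
    then show ?thesis
      using homology_at_class_eq_one_iff[OF H Z_ker] B_le_Z[of "?k + 1" p ?n] by auto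
  qed
  have "((\<lambda>S. ?f ` carrier ?A #>\<^bsub>?B\<^esub> S) \<circ> ?c) ` Z (?k + 1) p ?n = carrier ?H"
    by (simp only: image_comp[symmetric] surj carrier_homology_at[OF H])
  from quotient_group_iso[OF Z_subgroup comm_group.axioms(2)[OF comm_group_homology_at[OF H]] \<theta> this kernel]
  show "page (Suc r) p q \<cong> ?H" by (simp add: page_def add.commute)
next
  fix r :: nat and p q x assume "2 \<le> r" "x \<in> carrier (page r p q)"
  then obtain y where "x = coset (B (int r) p (p + q)) y" by (auto simp: carrier_page)
  then have "page_differential r (p - int r) (q + int r - 1) (page_differential r p q x)
      = coset (B (int r) (p - int r - int r) (p - int r + (q + int r - 1) - 1)) (d (d y))"
    using page_differential_coset[of r "p - int r" "q + int r - 1" "d y"]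
    by (simp add: page_differential_coset add_diff_eq)
  also have "\<dots> = B (int r) (p - int r - int r) (p - int r + (q + int r - 1) - 1)"
    by (simp add: d_d coset_def)
  also have "\<dots> = \<one>\<^bsub>page r (p - int r - int r) (q + int r - 1 + int r - 1)\<^esub>"
    unfolding one_page by (rule arg_cong[of _ _ "B _ _"]) simp
  finally show "page_differential r (p - int r) (q + int r - 1) (page_differential r p q x)
      = \<one>\<^bsub>page r (p - int r - int r) (q + int r - 1 + int r - 1)\<^esub>" .
next
  fix r :: nat and p q :: int assume r: "2 \<le> r" and pq: "p < 0 \<or> q < 0"
  have "Z (int r) p (p + q) \<subseteq> B (int r) p (p + q)"
  proof
    fix x assume x: "x \<in> Z (int r) p (p + q)"
    \<comment> \<open>If \<open>p < 0\<close> both are zero; if \<open>q < 0\<close> the degree is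
      at most \<open>p - 1\<close>, so both are the whole group. Then every approximate cycle counts
      as a lower-order term of \<open>B\<close>.\<close>
    have "F (p - 1) (p + q) = F p (p + q)"
      using pq F_neg[of p] F_neg[of "p - 1"] F_top[of "p + q" p] F_top[of "p + q" "p - 1"] by auto
    then show "x \<in> B (int r) p (p + q)"
      by (intro B_I[of _ 0 x]) (use x F_zero in \<open>auto simp: Z_def\<close>)
  qed
  then have "B (int r) p (p + q) = Z (int r) p (p + q)" using B_le_Z by blast
  then show "trivial_group (page r p q)"
    unfolding page_def using trivial_quotient_group[OF Z_subgroup] by simp
qed


text \<open>Recognises the second page from a description of the first. By
  \<open>\<zeta>_ker\<close> the kernel of \<open>\<zeta>\<close> is \<open>B 1 p (p + q)\<close>,
  so \<open>\<zeta>\<close> identifies page 1 with \<open>A\<close> and, by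
  \<open>\<zeta>_d\<close>, its differential with \<open>\<delta>\<close>. That
  \<open>\<delta>\<close> is a homomorphism of square zero is read off from \<open>d\<close> along
  the surjection \<open>\<zeta>\<close>.\<close>

lemma second_page_iso:
  fixes A :: "int \<Rightarrow> int \<Rightarrow> 'h monoid"
  assumes A: "\<And>p q. comm_group (A p q)"
    and \<zeta>_hom: "\<And>p q. \<zeta> p q \<in> hom (additive_group (Z 1 p (p + q))) (A p q)"
    and \<zeta>_surj: "\<And>p q. \<zeta> p q ` Z 1 p (p + q) = carrier (A p q)"
    and \<zeta>_ker: "\<And>p q x. x \<in> Z 1 p (p + q) \<Longrightarrow>
      \<zeta> p q x = \<one>\<^bsub>A p q\<^esub> \<longleftrightarrow> (\<exists>w \<in> F p (p + q + 1). x - d w \<in> F (p - 1) (p + q))"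
    and \<zeta>_d: "\<And>p q x. x \<in> Z 1 p (p + q) \<Longrightarrow> \<delta> p q (\<zeta> p q x) = \<zeta> (p - 1) q (d x)"
  shows "comm_group (homology_at (A (p + 1) q) (\<delta> (p + 1) q) (A p q) (\<delta> p q) (A (p - 1) q))"
    and "page 2 p q \<cong> homology_at (A (p + 1) q) (\<delta> (p + 1) q) (A p q) (\<delta> p q) (A (p - 1) q)"
proof -
  have d_Z1: "d x \<in> Z 1 (p - 1) (p - 1 + q)" if "x \<in> Z 1 p (p + q)" for p q x
    using d_Z[OF that] by (simp add: algebra_simps)
  have \<zeta>_closed: "\<zeta> p q x \<in> carrier (A p q)" if "x \<in> Z 1 p (p + q)" for p q x
    using \<zeta>_surj that by blast
  have \<zeta>_add: "\<zeta> p q (x + y) = \<zeta> p q x \<otimes>\<^bsub>A p q\<^esub> \<zeta> p q y" if "x \<in> Z 1 p (p + q)" "y \<in> Z 1 p (p + q)" for p q x y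
    using hom_mult[OF \<zeta>_hom] that by fastforce
  have \<zeta>_zero: "\<zeta> p q 0 = \<one>\<^bsub>A p q\<^esub>" for p q
    using F_zero additive_subgroupD(1)[OF Z_subgroup] by (intro iffD2[OF \<zeta>_ker] bexI[of _ 0]) auto
  have \<zeta>_eq: "\<zeta> p q x = \<zeta> p q y" if "x \<in> Z 1 p (p + q)" "y \<in> Z 1 p (p + q)" "\<zeta> p q (x - y) = \<one>\<^bsub>A p q\<^esub>"
    for p q x y
    using \<zeta>_add[OF additive_subgroupD(2)[OF Z_subgroup that(1,2)] that(2)] that
      \<zeta>_closed comm_group.axioms(2)[OF A, THEN group.is_monoid] by (simp add: monoid.l_one)
  have \<zeta>_sub: "\<zeta> p q (x - y) = \<one>\<^bsub>A p q\<^esub>" if "x \<in> Z 1 p (p + q)" "y \<in> Z 1 p (p + q)" "\<zeta> p q x = \<zeta> p q y"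
    for p q x y
  proof -
    interpret comm_group "A p q" by (rule A)
    have xy: "x - y \<in> Z 1 p (p + q)" by (rule additive_subgroupD(2)[OF Z_subgroup that(1,2)])
    have "\<zeta> p q (x - y) \<otimes>\<^bsub>A p q\<^esub> \<zeta> p q y = \<zeta> p q y"
      using \<zeta>_add[OF xy that(2)] that(3) by simp
    then show ?thesis using \<zeta>_closed[OF xy] \<zeta>_closed[OF that(2)] by simp
  qed
  have \<delta>_hom: "\<delta> p q \<in> hom (A p q) (A (p - 1) q)" for p q
  proof (rule homI)
    fix a assume "a \<in> carrier (A p q)"
    then obtain x where "x \<in> Z 1 p (p + q)" "a = \<zeta> p q x" unfolding \<zeta>_surj[symmetric] by blast
    then show "\<delta> p q a \<in> carrier (A (p - 1) q)"
      using \<zeta>_closed[OF d_Z1] by (simp add: \<zeta>_d)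
  next
    fix a b assume "a \<in> carrier (A p q)" "b \<in> carrier (A p q)"
    then obtain x y where xy: "x \<in> Z 1 p (p + q)" "y \<in> Z 1 p (p + q)" "a = \<zeta> p q x" "b = \<zeta> p q y"
      unfolding \<zeta>_surj[symmetric] by blast
    have "\<delta> p q (a \<otimes>\<^bsub>A p q\<^esub> b) = \<zeta> (p - 1) q (d x + d y)"
      using xy \<zeta>_d[OF additive_subgroupD(4)[OF Z_subgroup]] by (simp add: \<zeta>_add[symmetric] d_add)
    then show "\<delta> p q (a \<otimes>\<^bsub>A p q\<^esub> b) = \<delta> p q a \<otimes>\<^bsub>A (p - 1) q\<^esub> \<delta> p q b"
      using xy d_Z1 \<zeta>_add \<zeta>_d by simp
  qed
  let ?A = "A (p + 1) q" and ?f = "\<delta> (p + 1) q" and ?B = "A p q" and ?g = "\<delta> p q" and ?C = "A (p - 1) q"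
  let ?n = "p + q"
  have \<zeta>_d': "?f (\<zeta> (p + 1) q u) = \<zeta> p q (d u)" if "u \<in> Z 1 (p + 1) (?n + 1)" for u
    using \<zeta>_d[of u "p + 1" q] that by (simp add: algebra_simps)
  have surj': "\<zeta> (p + 1) q ` Z 1 (p + 1) (?n + 1) = carrier ?A"
    using \<zeta>_surj[of "p + 1" q] by (simp add: algebra_simps)
  have d_Z1': "d u \<in> Z 1 p ?n" if "u \<in> Z 1 (p + 1) (?n + 1)" for u
    using d_Z1[of u "p + 1" q] that by (simp add: algebra_simps)
  have gf: "\<forall>a\<in>carrier ?A. ?g (?f a) = \<one>\<^bsub>?C\<^esub>"
  proof
    fix a assume "a \<in> carrier ?A"
    then obtain u where u: "u \<in> Z 1 (p + 1) (?n + 1)" "a = \<zeta> (p + 1) q u" using surj' by blast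
    then show "?g (?f a) = \<one>\<^bsub>?C\<^esub>" using \<zeta>_d' \<zeta>_d d_Z1' by (simp add: d_d \<zeta>_zero)
  qed
  have f: "?f \<in> hom ?A ?B" using \<delta>_hom[of "p + 1" q] by simp
  note H = comm_group.axioms(2)[OF A[of "p + 1" q]] A[of p q] comm_group.axioms(2)[OF A[of "p - 1" q]]
    f \<delta>_hom[of p q] gf
  let ?H = "homology_at ?A ?f ?B ?g ?C"
  show comm: "comm_group ?H" by (rule comm_group_homology_at[OF H])
  have Z_step: "Z 2 p ?n \<subseteq> Z 1 p ?n" using F_step[of "p - 1"] by (auto simp: Z_def)
  have ker_d: "\<zeta> p q x = \<one>\<^bsub>A p q\<^esub>" if "x \<in> F (p - 1) ?n" "x \<in> Z 1 p ?n" for x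
    using \<zeta>_ker[OF that(2)] that(1) F_zero by (intro iffD2[OF \<zeta>_ker[OF that(2)]] bexI[of _ 0]) auto
  have Z_ker: "\<zeta> p q x \<in> kernel ?B ?C ?g" if "x \<in> Z 2 p ?n" for x
  proof -
    have x: "x \<in> Z 1 p ?n" using that Z_step by blast
    have "\<zeta> (p - 1) q (d x) = \<one>\<^bsub>?C\<^esub>"
      using that F_zero by (intro iffD2[OF \<zeta>_ker[OF d_Z1[OF x]]] bexI[of _ 0]) (auto simp: Z_def algebra_simps)
    then show ?thesis using x \<zeta>_closed \<zeta>_d by (simp add: kernel_def)
  qed
  have "\<zeta> p q \<in> hom (additive_group (Z 2 p ?n)) (?B\<lparr>carrier := kernel ?B ?C ?g\<rparr>)"
    by (rule hom_additive_group_restrict[OF \<zeta>_hom Z_step]) (use Z_ker in auto)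
  from hom_compose[OF this homology_at_class_hom[OF H]]
  have \<theta>: "(\<lambda>a. ?f ` carrier ?A #>\<^bsub>?B\<^esub> a) \<circ> \<zeta> p q \<in> hom (additive_group (Z 2 p ?n)) ?H" by simp
  have surj: "\<zeta> p q ` Z 2 p ?n = kernel ?B ?C ?g"
  proof (intro equalityI subsetI)
    fix a assume a: "a \<in> kernel ?B ?C ?g"
    then obtain x where x: "x \<in> Z 1 p ?n" "a = \<zeta> p q x" using \<zeta>_surj by (force simp: kernel_def)
    then have "\<zeta> (p - 1) q (d x) = \<one>\<^bsub>?C\<^esub>" using a \<zeta>_d by (simp add: kernel_def)
    \<comment> \<open>Subtracting \<open>w\<close> pushes the boundary down to step
      \<open>p - 2\<close>, while \<open>\<zeta>\<close> does not see \<open>w\<close>, which lies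
      in step \<open>p - 1\<close>.\<close>
    then obtain w where w: "w \<in> F (p - 1) ?n" "d x - d w \<in> F (p - 2) (?n - 1)"
      using \<zeta>_ker[OF d_Z1[OF x(1)]] by (auto simp: algebra_simps)
    have wp: "w \<in> F p ?n" using w(1) F_step[of p ?n] by blast
    have wZ: "w \<in> Z 1 p ?n" using w(1) wp d_F by (simp add: Z_def)
    have "x - w \<in> Z 2 p ?n" using x w(2) wp F_diff by (simp add: Z_def d_diff)
    moreover have "\<zeta> p q (x - w) = a"
      using \<zeta>_eq[of "x - w" p q x] x wZ ker_d[of "- w"] F_minus[OF w(1)]
        additive_subgroupD(2,3)[OF Z_subgroup] by simp
    ultimately show "a \<in> \<zeta> p q ` Z 2 p ?n" by blast
  qed (use Z_ker in auto)
  have kernel: "B 2 p ?n = {x \<in> Z 2 p ?n.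
      ((\<lambda>a. ?f ` carrier ?A #>\<^bsub>?B\<^esub> a) \<circ> \<zeta> p q) x = \<one>\<^bsub>?H\<^esub>}"
  proof -
    have "\<zeta> p q x \<in> ?f ` carrier ?A \<longleftrightarrow> x \<in> B 2 p ?n" if x: "x \<in> Z 2 p ?n" for x
    proof
      assume "\<zeta> p q x \<in> ?f ` carrier ?A"
      then obtain u where u: "u \<in> Z 1 (p + 1) (?n + 1)" "\<zeta> p q x = \<zeta> p q (d u)"
        using \<zeta>_d' by (auto simp: surj'[symmetric])
      have "x \<in> Z 1 p ?n" using x Z_step by blast
      then have "\<zeta> p q (x - d u) = \<one>\<^bsub>A p q\<^esub>" "x - d u \<in> Z 1 p ?n"
        using \<zeta>_sub u d_Z1' additive_subgroupD(2)[OF Z_subgroup] by auto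
      then obtain w where w: "w \<in> F p (?n + 1)" "x - d u - d w \<in> F (p - 1) ?n"
        using \<zeta>_ker by blast
      define f where "f = x - d u - d w"
      have "x = d (u + w) + f" by (simp add: f_def d_add)
      moreover have "u + w \<in> F (p + 1) (?n + 1)"
        using u(1) w(1) F_step[of "p + 1" "?n + 1"] F_add[of u "p + 1" "?n + 1" w] by (auto simp: Z_def)
      moreover have "d (u + w) \<in> F p ?n"
        using u(1) d_F[OF w(1)] F_add[of "d u" p ?n "d w"] by (simp add: Z_def d_add)
      moreover have "d f \<in> F (p - 2) (?n - 1)" using x by (simp add: f_def d_diff d_d Z_def)
      ultimately show "x \<in> B 2 p ?n"
        by (intro B_I[of _ "u + w" f]) (use w(2) in \<open>simp_all add: f_def add.commute\<close>)
    next
      assume "x \<in> B 2 p ?n"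
      then obtain u f where u: "x = d u + f" "u \<in> F (p + 1) (?n + 1)" "d u \<in> F p ?n"
        "f \<in> F (p - 1) ?n" "d f \<in> F (p - 2) (?n - 1)" by (auto simp: B_def algebra_simps)
      then have uZ: "u \<in> Z 1 (p + 1) (?n + 1)" by (simp add: Z_def)
      have "f \<in> Z 1 p ?n" using u(4) F_step[of p ?n] d_F[OF u(4)] by (auto simp: Z_def)
      then have "\<zeta> p q x = \<zeta> p q (d u)"
        using \<zeta>_eq[of x p q "d u"] u d_Z1'[OF uZ] ker_d[OF u(4)] x Z_step by auto
      then show "\<zeta> p q x \<in> ?f ` carrier ?A" using uZ \<zeta>_d'[OF uZ] surj' by (metis imageI)
    qed
    then show ?thesis
      using homology_at_class_eq_one_iff[OF H Z_ker] B_le_Z[of 2 p ?n] by auto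
  qed
  have "((\<lambda>a. ?f ` carrier ?A #>\<^bsub>?B\<^esub> a) \<circ> \<zeta> p q) ` Z 2 p ?n = carrier ?H"
    by (simp only: image_comp[symmetric] surj carrier_homology_at[OF H])
  from quotient_group_iso[OF Z_subgroup comm_group.axioms(2)[OF comm] \<theta> this kernel]
  show "page 2 p q \<cong> ?H" by (simp add: page_def)
qed

section \<open>Convergence to the homology of the whole complex\<close>

lemma converges_to_page:
  fixes H :: "int \<Rightarrow> 'h monoid"
  assumes H: "\<And>n. comm_group (H n)"
    and \<eta>_hom: "\<And>n. \<eta> n \<in> hom (additive_group {x \<in> F n n. d x = 0}) (H n)"
    and \<eta>_surj: "\<And>n. \<eta> n ` {x \<in> F n n. d x = 0} = carrier (H n)"
    and \<eta>_ker: "\<And>n x. \<lbrakk>x \<in> F n n; d x = 0\<rbrakk> \<Longrightarrow> \<eta> n x = \<one>\<^bsub>H n\<^esub> \<longleftrightarrow> x \<in> d ` F (n + 1) (n + 1)"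
  shows "converges_to page H"
  unfolding converges_to_def
proof
  fix n
  let ?C = "\<lambda>p. {x \<in> F p n. d x = 0}"
  \<comment> \<open>The classes that have a representative cycle in filtration step
    \<open>p\<close>.\<close>
  define \<Phi> where "\<Phi> p = \<eta> n ` ?C p" for p
  interpret H: comm_group "H n" by (rule H)
  have C: "additive_subgroup (?C p)" for p
    by (auto simp: additive_subgroup_def F_zero F_diff d_diff)
  have C_top: "?C p \<subseteq> ?C n" for p using F_le_top by auto
  have C_step: "?C (p - 1) \<subseteq> ?C p" for p using F_step by auto
  have \<eta>_p: "\<eta> n \<in> hom (additive_group (?C p)) (H n)" for p
    using hom_additive_group_restrict[OF \<eta>_hom[of n] C_top[of p], of "carrier (H n)"] \<eta>_surj[of n] C_top
    by auto
  have \<Phi>_sub: "subgroup (\<Phi> p) (H n)" for p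
  proof -
    interpret group_hom "additive_group (?C p)" "H n" "\<eta> n"
      using comm_group_additive_group[OF C, of p] \<eta>_p
      by (simp add: group_hom_def group_hom_axioms_def comm_group_def)
    show ?thesis using img_is_subgroup by (simp add: \<Phi>_def)
  qed
  have \<Phi>_step: "\<Phi> (p - 1) \<subseteq> \<Phi> p" for p using C_step by (auto simp: \<Phi>_def)
  have \<eta>_zero: "\<eta> n 0 = \<one>\<^bsub>H n\<^esub>"
    using hom_one[OF \<eta>_hom[of n]] comm_group_additive_group[OF C, of n] by (simp add: comm_group_def)
  have \<Phi>_neg: "\<Phi> (- 1) = {\<one>\<^bsub>H n\<^esub>}" 
  proof -
    have "?C (- 1) = {0}" unfolding F_neg[of "- 1" n, simplified] by auto
    then show ?thesis unfolding \<Phi>_def by (simp only: image_insert image_empty \<eta>_zero)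
  qed
  \<comment> \<open>For \<open>r > p\<close> the step \<open>p - r\<close> is zero, so
    \<open>Z r p n\<close> consists of all cycles in \<open>F p n\<close>. For
    \<open>p + r - 1 \<ge> n + 1\<close> the step \<open>p + r - 1\<close> in degree
    \<open>n + 1\<close> is everything, so \<open>B r p n\<close> consists of the cycles homologous
    to one in step \<open>p - 1\<close>. From there on the page is stationary.\<close>
  have lim: "((H n)\<lparr>carrier := \<Phi> p\<rparr>) Mod \<Phi> (p - 1) \<cong> page r p (n - p)"
    if r: "2 \<le> r" "p < int r" "n + 2 \<le> p + int r" for p r
  proof -
    let ?G = "(H n)\<lparr>carrier := \<Phi> p\<rparr>"
    interpret G: comm_group ?G by (rule comm_group_restrict[OF H \<Phi>_sub])
    have sub: "subgroup (\<Phi> (p - 1)) ?G" by (rule H.subgroup_incl[OF \<Phi>_sub \<Phi>_sub \<Phi>_step])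
    have N: "\<Phi> (p - 1) \<lhd> ?G" by (rule G.subgroup_imp_normal[OF sub])
    have Q: "comm_group (?G Mod \<Phi> (p - 1))" by (rule G.abelian_FactGroup[OF sub])
    have Z: "Z (int r) p n = ?C p" using F_neg[of "p - int r"] r by (auto simp: Z_def)
    have "\<eta> n \<in> hom (additive_group (?C p)) ?G"
      by (rule hom_additive_group_restrict[OF \<eta>_p]) (auto simp: \<Phi>_def)
    from hom_compose[OF this normal.r_coset_hom_Mod[OF N]]
    have \<theta>: "(\<lambda>a. \<Phi> (p - 1) #>\<^bsub>?G\<^esub> a) \<circ> \<eta> n \<in> hom (additive_group (?C p)) (?G Mod \<Phi> (p - 1))" .
    have surj: "((\<lambda>a. \<Phi> (p - 1) #>\<^bsub>?G\<^esub> a) \<circ> \<eta> n) ` ?C p = carrier (?G Mod \<Phi> (p - 1))"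
      unfolding image_comp[symmetric] by (simp add: carrier_FactGroup \<Phi>_def)
    have "B (int r) p n = {x \<in> ?C p. \<eta> n x \<in> \<Phi> (p - 1)}"
    proof (intro equalityI subsetI CollectI conjI)
      fix x assume "x \<in> B (int r) p n"
      then have "x \<in> ?C p" using B_le_Z Z by blast
      then show "x \<in> F p n" "d x = 0" by auto
      obtain u f where u: "x = d u + f" "u \<in> F (p + int r - 1) (n + 1)" "f \<in> F (p - 1) n" "d f = 0"
        using \<open>x \<in> B _ _ _\<close> F_neg[of "p - int r"] r by (auto simp: B_def)
      have "\<eta> n (d u) = \<one>\<^bsub>H n\<^esub>"
        using u F_le_top d_F[of u "n + 1" "n + 1"] F_top[of n "n + 1"] d_d
        by (intro iffD2[OF \<eta>_ker]) (auto simp: subset_iff)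
      moreover have "d u \<in> ?C n" "f \<in> ?C n"
        using u F_le_top d_F[of u "n + 1" "n + 1"] F_top[of n "n + 1"] d_d by (auto simp: subset_iff)
      ultimately have "\<eta> n x = \<eta> n f"
        using hom_mult[OF \<eta>_hom, of "d u" n f] u(1) hom_in_carrier[OF \<eta>_hom, of f n] by simp
      then show "\<eta> n x \<in> \<Phi> (p - 1)" using u by (auto simp: \<Phi>_def)
    next
      fix x assume "x \<in> {x \<in> ?C p. \<eta> n x \<in> \<Phi> (p - 1)}"
      then obtain f where x: "x \<in> ?C p" and f: "f \<in> ?C (p - 1)" "\<eta> n x = \<eta> n f" by (auto simp: \<Phi>_def)
      have xC: "x \<in> ?C n" and fC: "f \<in> ?C n" using x f C_top by blast+
      have xf: "x - f \<in> ?C n" by (rule additive_subgroupD(2)[OF C xC fC])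
      have "\<eta> n (x - f) \<otimes>\<^bsub>H n\<^esub> \<eta> n f = \<eta> n f"
        using hom_mult[OF \<eta>_hom, of "x - f" n f] xf fC f(2) by simp
      moreover have "\<eta> n (x - f) \<in> carrier (H n)" "\<eta> n f \<in> carrier (H n)" using xf fC \<eta>_surj by blast+
      ultimately have "\<eta> n (x - f) = \<one>\<^bsub>H n\<^esub>" by simp
      then obtain u where u: "u \<in> F (n + 1) (n + 1)" "x - f = d u" using \<eta>_ker xf by blast
      have "u \<in> F (p + int r - 1) (n + 1)" using u(1) F_mono[of "n + 1" "p + int r - 1"] r by auto
      moreover have "d u \<in> F p n" using u(2) x f C_step[of p] F_diff by (auto simp flip: u(2))
      moreover have "x = d u + f" using u(2) by (simp add: algebra_simps)
      ultimately show "x \<in> B (int r) p n"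
        by (intro B_I[of _ u f]) (use f(1) F_zero in \<open>auto\<close>)
    qed
    also have "\<dots> = {x \<in> ?C p.
        ((\<lambda>a. \<Phi> (p - 1) #>\<^bsub>?G\<^esub> a) \<circ> \<eta> n) x = \<one>\<^bsub>?G Mod \<Phi> (p - 1)\<^esub>}"
    proof -
      have "\<Phi> (p - 1) #>\<^bsub>?G\<^esub> \<eta> n x = \<Phi> (p - 1) \<longleftrightarrow> \<eta> n x \<in> \<Phi> (p - 1)" if "x \<in> ?C p" for x
      proof -
        have "\<eta> n x \<in> carrier ?G" using that by (simp add: \<Phi>_def)
        then show ?thesis using G.coset_join1[OF _ _ sub] G.coset_join2[OF _ sub] by blast
      qed
      then show ?thesis by auto
    qed
    finally have "page r p (n - p) \<cong> ?G Mod \<Phi> (p - 1)"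
      using quotient_group_iso[OF C comm_group.axioms(2)[OF Q] \<theta> surj] Z by (simp add: page_def)
    then show ?thesis by (rule group.iso_sym[OF comm_group.axioms(2)[OF comm_group_page]])
  qed
  show "\<exists>\<Phi>. (\<forall>p. subgroup (\<Phi> p) (H n)) \<and> (\<forall>p. \<Phi> (p - 1) \<subseteq> \<Phi> p) \<and>
      \<Phi> (- 1) = {\<one>\<^bsub>H n\<^esub>} \<and> \<Phi> n = carrier (H n) \<and>
      (\<forall>p. \<forall>\<^sub>F r in sequentially. ((H n)\<lparr>carrier := \<Phi> p\<rparr>) Mod \<Phi> (p - 1) \<cong> page r p (n - p))"
  proof (intro exI[of _ \<Phi>] conjI allI)
    show "\<forall>\<^sub>F r in sequentially. ((H n)\<lparr>carrier := \<Phi> p\<rparr>) Mod \<Phi> (p - 1) \<cong> page r p (n - p)" for p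
      \<comment> \<open>The bound only has to dominate 2, \<open>p + 1\<close> and
        \<open>n + 2 - p\<close>; absolute values do this without case distinctions.\<close>
      using eventually_ge_at_top[of "nat (2 + \<bar>p\<bar> + \<bar>n\<bar> + \<bar>p\<bar>)"]
      by eventually_elim (rule lim; linarith)
  qed (use \<Phi>_sub \<Phi>_step \<Phi>_neg \<eta>_surj[of n] in \<open>auto simp: \<Phi>_def\<close>)
qed

end

section \<open>Relative simplicial chain complexes\<close>

definition simplices :: "'v rel \<Rightarrow> 'v set set" where
  "simplices X = {\<sigma> \<in> Chains X. \<sigma> \<noteq> {} \<and> finite \<sigma>}"

lemma simplices_subset: "\<lbrakk>\<sigma> \<in> simplices X; \<rho> \<subseteq> \<sigma>; \<rho> \<noteq> {}\<rbrakk> \<Longrightarrow> \<rho> \<in> simplices X"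
  unfolding simplices_def Chains_def by (blast intro: finite_subset)

lemma finite_simplices:
  assumes "finite (Field X)" shows "finite (simplices X)"
proof (rule finite_subset)
  show "simplices X \<subseteq> Pow (Field X)" by (auto simp: simplices_def Chains_def Field_def)
qed (use assms in simp)

text \<open>\<open>S\<close> serves only to order the vertices of each simplex and may differ from
  the order that defines the simplices. For \<open>v\<close> outside \<open>\<rho>\<close> the
  exponent is the position of \<open>v\<close> in \<open>insert v \<rho>\<close>.\<close>

definition face_sign :: "'v rel \<Rightarrow> 'v \<Rightarrow> 'v set \<Rightarrow> int" where
  "face_sign S v \<rho> = (- 1) ^ card {u \<in> \<rho>. (u, v) \<in> S \<and> u \<noteq> v}"

text \<open>The boundary is read off at a face, by collecting its cofaces. Faces outside
  \<open>K\<close> are dropped, which gives the relative boundary, and the operator is defined on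
  all functions, whatever their support.\<close>

definition bd :: "'v rel \<Rightarrow> 'v set set \<Rightarrow> ('v set \<Rightarrow> int) \<Rightarrow> 'v set \<Rightarrow> int" where
  "bd S K x \<rho> = (if \<rho> \<in> K
     then \<Sum>v | v \<notin> \<rho> \<and> insert v \<rho> \<in> K. face_sign S v \<rho> * x (insert v \<rho>) else 0)"

definition chains_on :: "'v set set \<Rightarrow> int \<Rightarrow> ('v set \<Rightarrow> int) set" where
  "chains_on K n = {x. \<forall>\<sigma>. x \<sigma> \<noteq> 0 \<longrightarrow> \<sigma> \<in> K \<and> int (card \<sigma>) = n + 1}"

text \<open>The last condition makes \<open>K\<close> a set of simplices of a complex relative to a subcomplex.\<close>

definition simplex_family :: "'v rel \<Rightarrow> 'v set set \<Rightarrow> bool" where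
  "simplex_family S K \<longleftrightarrow> antisym S \<and> finite K \<and> K \<subseteq> simplices S \<and>
     (\<forall>\<rho>\<in>K. \<forall>\<sigma>\<in>K. \<forall>\<tau>. \<rho> \<subseteq> \<tau> \<and> \<tau> \<subseteq> \<sigma> \<longrightarrow> \<tau> \<in> K)"

lemma face_sign_square [simp]: "face_sign S v \<rho> * face_sign S v \<rho> = 1"
  by (simp add: face_sign_def power_add[symmetric])

lemma face_sign_square_left [simp]: "face_sign S v \<rho> * (face_sign S v \<rho> * a) = a"
  by (simp add: mult.assoc[symmetric])

lemma face_sign_insert:
  assumes "finite \<rho>" "u \<notin> \<rho>" "u \<noteq> v"
  shows "face_sign S v (insert u \<rho>) = (if (u, v) \<in> S then - face_sign S v \<rho> else face_sign S v \<rho>)"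
proof -
  have "{w \<in> insert u \<rho>. (w, v) \<in> S \<and> w \<noteq> v} =
      (if (u, v) \<in> S then insert u {w \<in> \<rho>. (w, v) \<in> S \<and> w \<noteq> v} else {w \<in> \<rho>. (w, v) \<in> S \<and> w \<noteq> v})"
    using assms by auto
  then show ?thesis using assms by (auto simp: face_sign_def)
qed

text \<open>Of two distinct comparable vertices exactly one precedes the other, so inserting each
  next to the other changes exactly one of the two signs. The first form serves the square of the
  boundary, the second the contracting homotopy.\<close>

lemma face_sign_swap:
  assumes "finite \<rho>" "u \<notin> \<rho>" "v \<notin> \<rho>" "u \<noteq> v" "antisym S" "(u, v) \<in> S \<or> (v, u) \<in> S"
  shows "face_sign S u \<rho> * face_sign S v (insert u \<rho>) = - (face_sign S v \<rho> * face_sign S u (insert v \<rho>))"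
    "face_sign S u (insert v \<rho>) * face_sign S v (insert u \<rho>) = - (face_sign S v \<rho> * face_sign S u \<rho>)"
  using assms by (auto simp: face_sign_insert antisym_def)

lemma finite_cofaces:
  assumes "simplex_family S K" shows "finite {v. v \<notin> \<rho> \<and> insert v \<rho> \<in> K}"
proof (rule finite_subset)
  show "{v. v \<notin> \<rho> \<and> insert v \<rho> \<in> K} \<subseteq> \<Union> K" by auto
  show "finite (\<Union> K)" using assms by (auto simp: simplex_family_def simplices_def)
qed

lemma ChainsD: "\<lbrakk>\<sigma> \<in> Chains S; u \<in> \<sigma>; v \<in> \<sigma>\<rbrakk> \<Longrightarrow> (u, v) \<in> S \<or> (v, u) \<in> S"
  by (auto simp: Chains_def)

lemma bd_bd:
  assumes K: "simplex_family S K"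
  shows "bd S K (bd S K x) = 0"
proof
  fix \<rho>
  show "bd S K (bd S K x) \<rho> = 0 \<rho>"
  proof (cases "\<rho> \<in> K")
    case True
    let ?V = "{v. v \<notin> \<rho> \<and> insert v \<rho> \<in> K}"
    let ?W = "\<lambda>v. {w. w \<notin> insert v \<rho> \<and> insert w (insert v \<rho>) \<in> K}"
    define g where "g = (\<lambda>(v, w). face_sign S v \<rho> * (face_sign S w (insert v \<rho>) * x (insert w (insert v \<rho>))))"
    let ?T = "Sigma ?V ?W"
    \<comment> \<open>The intermediate simplex lies between two members of \<open>K\<close>, hence
      is in \<open>K\<close>; so the index set is symmetric in the two inserted vertices.\<close>
    have conv: "insert v \<rho> \<in> K" if "insert w (insert v \<rho>) \<in> K" for v w
      using K True that unfolding simplex_family_def by blast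
    have "bd S K (bd S K x) \<rho> = (\<Sum>v\<in>?V. \<Sum>w\<in>?W v. g (v, w))"
      using True by (simp add: bd_def g_def sum_distrib_left)
    also have "\<dots> = sum g ?T"
      by (subst sum.Sigma) (intro ballI finite_cofaces[OF K] | simp)+
    finally have eq: "bd S K (bd S K x) \<rho> = sum g ?T" .
    \<comment> \<open>Exchanging the two vertices reverses the sign of every term, so the integer
      sum equals its own negative.\<close>
    have "sum g ?T = sum (g \<circ> prod.swap) ?T"
      using conv by (intro sum.reindex_bij_witness[of _ prod.swap prod.swap]) (auto simp: insert_commute)
    also have "\<dots> = sum (\<lambda>p. - g p) ?T"
    proof (rule sum.cong[OF refl])
      fix p assume "p \<in> ?T"
      then obtain v w where p: "p = (v, w)" "v \<notin> \<rho>" "w \<notin> \<rho>" "v \<noteq> w" "insert w (insert v \<rho>) \<in> K"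
        by auto
      have S: "antisym S" and \<sigma>: "insert w (insert v \<rho>) \<in> simplices S"
        using K p(5) by (auto simp: simplex_family_def)
      then have "finite \<rho>" "(v, w) \<in> S \<or> (w, v) \<in> S"
        using ChainsD[of "insert w (insert v \<rho>)" S v w] by (auto simp: simplices_def)
      from face_sign_swap(1)[OF this(1) p(2,3,4) S this(2)]
      show "(g \<circ> prod.swap) p = - g p"
        by (simp add: g_def p(1) insert_commute mult.assoc[symmetric])
    qed
    finally show ?thesis using eq by (simp add: sum_negf)
  qed (simp add: bd_def)
qed

lemma bd_add: "bd S K (x + y) = bd S K x + bd S K y"
  by (auto simp: bd_def fun_eq_iff sum.distrib distrib_left)

lemma bd_zero [simp]: "bd S K 0 = 0"
  by (simp add: bd_def fun_eq_iff)

lemma bd_minus: "bd S K (- x) = - bd S K x"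
  by (auto simp: bd_def fun_eq_iff sum_negf)

lemma bd_diff: "bd S K (x - y) = bd S K x - bd S K y"
  using bd_add[of S K x "- y"] by (simp add: bd_minus)

lemma bd_eqI:
  assumes "\<And>v. \<lbrakk>\<rho> \<in> K; v \<notin> \<rho>; insert v \<rho> \<in> K\<rbrakk> \<Longrightarrow> x (insert v \<rho>) = y (insert v \<rho>)"
  shows "bd S K x \<rho> = bd S K y \<rho>"
  using assms by (auto simp: bd_def intro!: sum.cong)

lemma chains_on_subgroup: "additive_subgroup (chains_on K n)"
  unfolding additive_subgroup_def
proof (intro conjI ballI)
  fix x y assume "x \<in> chains_on K n" "y \<in> chains_on K n"
  moreover have "x \<sigma> \<noteq> 0 \<or> y \<sigma> \<noteq> 0" if "(x - y) \<sigma> \<noteq> 0" for \<sigma> using that by auto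
  ultimately show "x - y \<in> chains_on K n" unfolding chains_on_def by blast
qed (simp add: chains_on_def)

lemma bd_chains_on:
  assumes "K \<subseteq> simplices S" "x \<in> chains_on K n" shows "bd S K x \<in> chains_on K (n - 1)"
proof -
  have "\<rho> \<in> K \<and> int (card \<rho>) = n" if "bd S K x \<rho> \<noteq> 0" for \<rho>
  proof -
    have \<rho>: "\<rho> \<in> K" using that by (auto simp: bd_def split: if_splits)
    obtain v where v: "v \<notin> \<rho>" "x (insert v \<rho>) \<noteq> 0"
    proof (rule ccontr)
      assume "\<not> thesis"
      then have "\<And>v. v \<notin> \<rho> \<Longrightarrow> x (insert v \<rho>) = 0" using that by blast
      then have "bd S K x \<rho> = 0" by (simp add: bd_def)
      then show False using \<open>bd S K x \<rho> \<noteq> 0\<close> by simp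
    qed
    then have "int (card (insert v \<rho>)) = n + 1" using assms(2) by (auto simp: chains_on_def)
    then show ?thesis using v \<rho> assms(1) by (auto simp: simplices_def subset_iff)
  qed
  then show ?thesis by (simp add: chains_on_def)
qed

lemma simplex_family_simplices:
  assumes "antisym S" "finite (Field X)" "simplices X \<subseteq> simplices S"
  shows "simplex_family S (simplices X)"
  unfolding simplex_family_def
proof (intro conjI ballI allI impI)
  fix \<rho> \<sigma> \<tau> assume "\<rho> \<in> simplices X" "\<sigma> \<in> simplices X" "\<rho> \<subseteq> \<tau> \<and> \<tau> \<subseteq> \<sigma>"
  then show "\<tau> \<in> simplices X"
    using simplices_subset[of \<sigma> X \<tau>] by (auto simp: simplices_def)
qed (use assms finite_simplices in auto)

lemma simplex_family_subset:
  assumes "simplex_family S K" "K' \<subseteq> K"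
    and "\<And>\<rho> \<sigma> \<tau>. \<lbrakk>\<rho> \<in> K'; \<sigma> \<in> K'; \<rho> \<subseteq> \<tau>; \<tau> \<subseteq> \<sigma>; \<tau> \<in> K\<rbrakk> \<Longrightarrow> \<tau> \<in> K'"
  shows "simplex_family S K'"
  unfolding simplex_family_def
proof (intro conjI ballI allI impI)
  fix \<rho> \<sigma> \<tau> assume *: "\<rho> \<in> K'" "\<sigma> \<in> K'" "\<rho> \<subseteq> \<tau> \<and> \<tau> \<subseteq> \<sigma>"
  then have "\<tau> \<in> K" using assms(1,2) unfolding simplex_family_def by blast
  then show "\<tau> \<in> K'" using * assms(3) by blast
qed (use assms(1,2) in \<open>auto simp: simplex_family_def dest: finite_subset\<close>)

lemma chain_has_max:
  assumes "Partial_order X" "finite \<sigma>" "\<sigma> \<noteq> {}" "\<sigma> \<in> Chains X"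
  shows "\<exists>!m. m \<in> \<sigma> \<and> (\<forall>u\<in>\<sigma>. (u, m) \<in> X)"
proof (rule ex_ex1I)
  note X = Partial_orderD[OF assms(1)]
  show "\<exists>m. m \<in> \<sigma> \<and> (\<forall>u\<in>\<sigma>. (u, m) \<in> X)"
    using assms(2-4)
  proof (induction rule: finite_ne_induct)
    case (singleton x)
    then show ?case by (auto simp: Chains_def)
  next
    case (insert x F)
    then obtain m where m: "m \<in> F" "\<forall>u\<in>F. (u, m) \<in> X" by (auto simp: Chains_def)
    have xx: "(x, x) \<in> X" "(x, m) \<in> X \<or> (m, x) \<in> X" using insert.prems m(1) by (auto simp: Chains_def)
    then show ?case
    proof (elim disjE)
      assume "(m, x) \<in> X"
      then show ?thesis using xx(1) m X(2) by (intro exI[of _ x]) blast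
    next
      assume "(x, m) \<in> X"
      then show ?thesis using m by (intro exI[of _ m]) blast
    qed
  qed
  show "m = m'" if "m \<in> \<sigma> \<and> (\<forall>u\<in>\<sigma>. (u, m) \<in> X)" "m' \<in> \<sigma> \<and> (\<forall>u\<in>\<sigma>. (u, m') \<in> X)" for m m'
    using that X(3) by blast
qed

section \<open>The acyclicity lemma\<close>

locale upper_retraction =
  fixes X S :: "'v rel" and L :: "'v set" and f :: "'v \<Rightarrow> 'v"
  assumes X: "Partial_order X" and fin: "finite (Field X)"
    and S: "antisym S" and sim: "simplices X \<subseteq> simplices S"
    and L_lower: "\<lbrakk>(u, l) \<in> X; l \<in> L\<rbrakk> \<Longrightarrow> u \<in> L"
    and f_upper: "\<lbrakk>l \<in> L; l \<in> Field X\<rbrakk> \<Longrightarrow> f l \<notin> L \<and> (l, f l) \<in> X"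
    and f_least: "\<lbrakk>l \<in> L; (l, u) \<in> X; u \<notin> L\<rbrakk> \<Longrightarrow> (f l, u) \<in> X"
begin

text \<open>The simplices of \<open>X\<close> relative to the complement of \<open>L\<close>. This
  relative complex should have no homology, because \<open>f\<close> on \<open>L\<close> and the
  identity elsewhere retract \<open>X\<close> to that complement.\<close>

definition K :: "'v set set" where "K = {\<sigma> \<in> simplices X. \<sigma> \<inter> L \<noteq> {}}"

lemma family: "simplex_family S K"
proof (rule simplex_family_subset)
  show "simplex_family S (simplices X)" by (rule simplex_family_simplices[OF S fin sim])
qed (auto simp: K_def)

text \<open>The apex that the homotopy adds or removes. For \<open>\<sigma>\<close> in
  \<open>K\<close> it lies outside \<open>L\<close>, and it depends only on
  \<open>\<sigma> \<inter> L\<close>; so inserting or deleting any vertex outside \<open>L\<close>,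
  the apex included, does not move it.\<close>

definition y :: "'v set \<Rightarrow> 'v" where
  "y \<sigma> = f (THE m. m \<in> \<sigma> \<inter> L \<and> (\<forall>u\<in>\<sigma> \<inter> L. (u, m) \<in> X))"

lemma y_cong: "\<sigma> \<inter> L = \<rho> \<inter> L \<Longrightarrow> y \<sigma> = y \<rho>"
  by (simp add: y_def)

lemma y_max:
  assumes "\<sigma> \<in> K"
  obtains m where "m \<in> \<sigma>" "m \<in> L" "m \<in> Field X" "y \<sigma> = f m" "\<And>u. \<lbrakk>u \<in> \<sigma>; u \<in> L\<rbrakk> \<Longrightarrow> (u, m) \<in> X"
proof -
  have *: "finite (\<sigma> \<inter> L)" "\<sigma> \<inter> L \<noteq> {}" "\<sigma> \<inter> L \<in> Chains X"
    using assms by (auto simp: K_def simplices_def Chains_def)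
  have "y \<sigma> = f (THE m. m \<in> \<sigma> \<inter> L \<and> (\<forall>u\<in>\<sigma> \<inter> L. (u, m) \<in> X))" by (simp add: y_def)
  with theI'[OF chain_has_max[OF X *]] show ?thesis by (intro that) (auto intro: FieldI1)
qed

lemma y_notin_L: "\<sigma> \<in> K \<Longrightarrow> y \<sigma> \<notin> L"
  by (erule y_max) (use f_upper in auto)

lemma y_le:
  assumes "\<sigma> \<in> K" "u \<in> \<sigma>" "u \<notin> L" shows "(y \<sigma>, u) \<in> X"
proof -
  obtain m where m: "m \<in> \<sigma>" "m \<in> L" "y \<sigma> = f m" by (rule y_max[OF assms(1)]) blast
  \<comment> \<open>The second alternative would put \<open>u\<close> into the lower set
    \<open>L\<close>.\<close>
  have "(m, u) \<in> X \<or> (u, m) \<in> X" using assms m by (auto simp: K_def simplices_def Chains_def)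
  then show ?thesis using L_lower f_least assms m by metis
qed

lemma le_y: "\<lbrakk>\<sigma> \<in> K; u \<in> \<sigma>; u \<in> L\<rbrakk> \<Longrightarrow> (u, y \<sigma>) \<in> X"
  by (erule y_max) (use f_upper Partial_orderD(2)[OF X] in metis)

lemma insert_y:
  assumes "\<sigma> \<in> K" shows "insert (y \<sigma>) \<sigma> \<in> K"
proof -
  have "(y \<sigma>, y \<sigma>) \<in> X"
    using assms by (elim y_max) (metis FieldI2 Partial_orderD(1)[OF X] f_upper)
  then have "insert (y \<sigma>) \<sigma> \<in> Chains X"
    using assms y_le[OF assms] le_y[OF assms] unfolding K_def simplices_def Chains_def by blast
  then show ?thesis using assms by (auto simp: K_def simplices_def)
qed

lemma y_insert [simp]: "v \<notin> L \<Longrightarrow> y (insert v \<sigma>) = y \<sigma>"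
  by (rule y_cong) auto

lemma K_D: "\<sigma> \<in> K \<Longrightarrow> finite \<sigma>" by (simp add: K_def simplices_def)

lemma K_comparable: "\<lbrakk>\<sigma> \<in> K; u \<in> \<sigma>; v \<in> \<sigma>\<rbrakk> \<Longrightarrow> (u, v) \<in> S \<or> (v, u) \<in> S"
  using sim by (auto simp: K_def simplices_def Chains_def)

lemma K_subset: "\<lbrakk>\<sigma> \<in> K; \<rho> \<subseteq> \<sigma>; \<rho> \<inter> L \<noteq> {}\<rbrakk> \<Longrightarrow> \<rho> \<in> K"
  by (auto simp: K_def simplices_def Chains_def dest: finite_subset)

text \<open>A cone with varying apex: a simplex lacking its apex goes to the simplex with the apex
  added, with the sign under which the boundary returns the original with coefficient 1; a simplex
  containing its apex goes to zero.\<close>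

definition h :: "('v set \<Rightarrow> int) \<Rightarrow> 'v set \<Rightarrow> int" where
  "h x \<sigma> = (if \<sigma> \<in> K \<and> y \<sigma> \<in> \<sigma> then face_sign S (y \<sigma>) (\<sigma> - {y \<sigma>}) * x (\<sigma> - {y \<sigma>}) else 0)"

lemma h_chains_on:
  assumes "x \<in> chains_on K n" shows "h x \<in> chains_on K (n + 1)"
proof -
  have "int (card \<sigma>) = n + 2" if "h x \<sigma> \<noteq> 0" for \<sigma>
  proof -
    have *: "\<sigma> \<in> K" "y \<sigma> \<in> \<sigma>" "x (\<sigma> - {y \<sigma>}) \<noteq> 0" using that by (auto simp: h_def split: if_splits)
    then have "int (card (\<sigma> - {y \<sigma>})) = n + 1" using assms by (auto simp: chains_on_def)
    then show ?thesis using card_Suc_Diff1[of \<sigma> "y \<sigma>"] * K_D by fastforce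
  qed
  moreover have "\<sigma> \<in> K" if "h x \<sigma> \<noteq> 0" for \<sigma> using that by (auto simp: h_def split: if_splits)
  ultimately show ?thesis by (auto simp: chains_on_def)
qed

text \<open>The homotopy identity can fail only because inserting a vertex of \<open>L\<close> may
  move the apex. Such a vertex enlarges the part in \<open>L\<close>, so where that part already has
  size at least \<open>k\<close> the offending coefficients of \<open>x\<close> are zero.\<close>

lemma homotopy_leading_term:
  assumes x: "\<And>\<sigma>. x \<sigma> \<noteq> 0 \<Longrightarrow> card (\<sigma> \<inter> L) \<le> k"
    and \<rho>: "\<rho> \<in> K" "k \<le> card (\<rho> \<inter> L)"
  shows "bd S K (h x) \<rho> + h (bd S K x) \<rho> = x \<rho>"
proof -
  let ?y = "y \<rho>"
  note fin_\<rho> = K_D[OF \<rho>(1)]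
  have yL: "?y \<notin> L" by (rule y_notin_L[OF \<rho>(1)])
  have vanish: "x (insert v \<rho> - {z}) = 0" if "v \<in> L" "v \<notin> \<rho>" "z \<notin> L" for v z
  proof -
    have "(insert v \<rho> - {z}) \<inter> L = insert v (\<rho> \<inter> L)" using that by auto
    then have "card ((insert v \<rho> - {z}) \<inter> L) = Suc (card (\<rho> \<inter> L))" using that fin_\<rho> by simp
    then show ?thesis using x[of "insert v \<rho> - {z}"] \<rho>(2) by fastforce
  qed
  have "bd S K (h x) \<rho> = (\<Sum>v | v \<notin> \<rho> \<and> insert v \<rho> \<in> K. face_sign S v \<rho> * h x (insert v \<rho>))"
    using \<rho> by (simp add: bd_def)
  also have "\<dots> = (\<Sum>v | v \<notin> \<rho> \<and> insert v \<rho> \<in> K \<and> v \<notin> L. face_sign S v \<rho> * h x (insert v \<rho>))"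
  proof (rule sum.mono_neutral_right[OF finite_cofaces[OF family]])
    have "h x (insert v \<rho>) = 0" if "v \<notin> \<rho>" "insert v \<rho> \<in> K" "v \<in> L" for v
      using vanish[OF that(3,1) y_notin_L[OF that(2)]] by (simp add: h_def)
    then show "\<forall>v\<in>{v. v \<notin> \<rho> \<and> insert v \<rho> \<in> K} - {v. v \<notin> \<rho> \<and> insert v \<rho> \<in> K \<and> v \<notin> L}.
        face_sign S v \<rho> * h x (insert v \<rho>) = 0" by auto
  qed auto
  finally have bdh: "bd S K (h x) \<rho>
    = (\<Sum>v | v \<notin> \<rho> \<and> insert v \<rho> \<in> K \<and> v \<notin> L. face_sign S v \<rho> * h x (insert v \<rho>))" .
  show ?thesis
  proof (cases "?y \<in> \<rho>")
    case False
    \<comment> \<open>If \<open>\<rho>\<close> lacks its apex, then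
      \<open>h (bd S K x) \<rho>\<close> is zero, and among the vertices outside \<open>L\<close>
      only the apex makes \<open>h x (insert v \<rho>)\<close> nonzero.\<close>
    have "bd S K (h x) \<rho> = (\<Sum>v\<in>{?y}. face_sign S v \<rho> * h x (insert v \<rho>))"
      unfolding bdh
    proof (rule sum.mono_neutral_right)
      show "finite {v. v \<notin> \<rho> \<and> insert v \<rho> \<in> K \<and> v \<notin> L}"
        using finite_cofaces[OF family] by (rule rev_finite_subset) auto
    qed (use False insert_y[OF \<rho>(1)] yL in \<open>auto simp: h_def\<close>)
    then show ?thesis using False insert_y[OF \<rho>(1)] yL by (simp add: h_def)
  next
    case True
    \<comment> \<open>If \<open>\<rho>\<close> contains its apex, the cofaces of \<open>B\<close>
      and of \<open>\<rho>\<close> by further vertices outside \<open>L\<close> correspond by adding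
      the apex. Their contributions cancel by \<open>face_sign_swap\<close>; the coface of
      \<open>B\<close> by the apex itself returns \<open>x \<rho>\<close>.\<close>
    define B where "B = \<rho> - {?y}"
    have \<rho>B: "\<rho> = insert ?y B" "?y \<notin> B" "finite B" using True fin_\<rho> by (auto simp: B_def)
    have BL: "B \<inter> L = \<rho> \<inter> L" using yL by (auto simp: B_def)
    have B: "B \<in> K" using K_subset[OF \<rho>(1), of B] BL \<rho>(1) by (auto simp: B_def K_def)
    have yB: "y B = ?y" using y_cong[OF BL] .
    let ?V = "{v. v \<notin> \<rho> \<and> insert v \<rho> \<in> K \<and> v \<notin> L}"
    have cofaces_B: "insert v B \<in> K \<longleftrightarrow> insert v \<rho> \<in> K" if "v \<notin> L" for v
    proof
      assume "insert v B \<in> K"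
      from insert_y[OF this] show "insert v \<rho> \<in> K" using that yB \<rho>B(1) by (simp add: insert_commute)
    next
      assume "insert v \<rho> \<in> K"
      then show "insert v B \<in> K" by (rule K_subset) (use BL \<rho>(1) in \<open>auto simp: B_def K_def\<close>)
    qed
    have 1: "bd S K (h x) \<rho> = (\<Sum>v\<in>?V. face_sign S v \<rho> * (face_sign S ?y (insert v B) * x (insert v B)))"
      unfolding bdh
    proof (rule sum.cong[OF refl])
      fix v assume v: "v \<in> ?V"
      then have "insert v \<rho> - {?y} = insert v B" using True by (auto simp: B_def)
      then show "face_sign S v \<rho> * h x (insert v \<rho>) = face_sign S v \<rho> * (face_sign S ?y (insert v B) * x (insert v B))"
        using v True by (simp add: h_def)
    qed
    have "bd S K x B = (\<Sum>v | v \<notin> B \<and> insert v B \<in> K. face_sign S v B * x (insert v B))"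
      using B by (simp add: bd_def)
    also have "\<dots> = (\<Sum>v\<in>insert ?y ?V. face_sign S v B * x (insert v B))"
    proof (rule sum.mono_neutral_right[OF finite_cofaces[OF family]])
      show "insert ?y ?V \<subseteq> {v. v \<notin> B \<and> insert v B \<in> K}"
        using \<rho> \<rho>B cofaces_B by auto
      show "\<forall>v\<in>{v. v \<notin> B \<and> insert v B \<in> K} - insert ?y ?V. face_sign S v B * x (insert v B) = 0"
      proof
        fix v assume v: "v \<in> {v. v \<notin> B \<and> insert v B \<in> K} - insert ?y ?V"
        then have "v \<notin> \<rho>" "v \<in> L" using cofaces_B \<rho>B(1) by auto
        moreover have "insert v B = insert v \<rho> - {?y}" using v by (auto simp: B_def)
        ultimately show "face_sign S v B * x (insert v B) = 0" using vanish yL by simp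
      qed
    qed
    also have "\<dots> = face_sign S ?y B * x \<rho> + (\<Sum>v\<in>?V. face_sign S v B * x (insert v B))"
      by (subst sum.insert) (use True \<rho>B(1) finite_cofaces[OF family, of \<rho>] in \<open>auto elim: rev_finite_subset\<close>)
    finally have 2: "h (bd S K x) \<rho> = x \<rho> + (\<Sum>v\<in>?V. face_sign S ?y B * (face_sign S v B * x (insert v B)))"
      using True \<rho>(1) by (simp add: h_def B_def[symmetric] distrib_left sum_distrib_left)
    have "(\<Sum>v\<in>?V. face_sign S v \<rho> * (face_sign S ?y (insert v B) * x (insert v B)))
        = - (\<Sum>v\<in>?V. face_sign S ?y B * (face_sign S v B * x (insert v B)))"
      unfolding sum_negf[symmetric]
    proof (rule sum.cong[OF refl])
      fix v assume v: "v \<in> ?V"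
      have "face_sign S v (insert ?y B) * face_sign S ?y (insert v B) = - (face_sign S ?y B * face_sign S v B)"
        by (rule face_sign_swap(2)) (use v S True \<rho>B K_comparable[of "insert v \<rho>" v ?y] in auto)
      then show "face_sign S v \<rho> * (face_sign S ?y (insert v B) * x (insert v B))
          = - (face_sign S ?y B * (face_sign S v B * x (insert v B)))"
        by (simp add: \<rho>B(1)[symmetric] mult.assoc[symmetric])
    qed
    then show ?thesis by (simp add: 1 2)
  qed
qed

text \<open>Induction on a bound for the size of \<open>\<sigma> \<inter> L\<close> on the support:
  replacing \<open>x\<close> by \<open>x - bd S K (h x)\<close> lowers it. At size 0 nothing is
  left, since every member of \<open>K\<close> meets \<open>L\<close>.\<close>

lemma acyclic:
  assumes "x \<in> chains_on K n" "bd S K x = 0"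
  shows "\<exists>w\<in>chains_on K (n + 1). bd S K w = x"
proof -
  have *: "\<exists>w\<in>chains_on K (n + 1). bd S K w = x"
    if "x \<in> chains_on K n" "bd S K x = 0" "\<And>\<sigma>. x \<sigma> \<noteq> 0 \<Longrightarrow> card (\<sigma> \<inter> L) \<le> k" for k x
    using that
  proof (induction k arbitrary: x)
    case 0
    have "x \<sigma> = 0" for \<sigma>
    proof (rule ccontr)
      assume "x \<sigma> \<noteq> 0"
      then have "\<sigma> \<in> K" "card (\<sigma> \<inter> L) = 0" using 0 by (auto simp: chains_on_def)
      then show False using K_D by (auto simp: K_def)
    qed
    then have "x = 0" by (simp add: fun_eq_iff)
    show ?case
    proof
      show "bd S K 0 = x" unfolding \<open>x = 0\<close> by (rule bd_zero)
    qed (rule additive_subgroupD(1)[OF chains_on_subgroup])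
  next
    case (Suc k)
    define x' where "x' = x - bd S K (h x)"
    have Ks: "K \<subseteq> simplices S" using family by (simp add: simplex_family_def)
    have hx: "h x \<in> chains_on K (n + 1)" by (rule h_chains_on[OF Suc.prems(1)])
    have x': "x' \<in> chains_on K n"
      unfolding x'_def using bd_chains_on[OF Ks hx] Suc.prems(1)
      by (intro additive_subgroupD(2)[OF chains_on_subgroup]) simp_all
    have "card (\<sigma> \<inter> L) \<le> k" if "x' \<sigma> \<noteq> 0" for \<sigma>
    proof (rule ccontr)
      assume "\<not> card (\<sigma> \<inter> L) \<le> k"
      moreover have "\<sigma> \<in> K" using x' that by (auto simp: chains_on_def)
      ultimately have "bd S K (h x) \<sigma> + h (bd S K x) \<sigma> = x \<sigma>"
        by (intro homotopy_leading_term[of x "Suc k"] Suc.prems(3)) auto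
      moreover have "h (bd S K x) \<sigma> = 0" by (simp add: Suc.prems(2) h_def)
      ultimately have "x' \<sigma> = 0" by (simp add: x'_def)
      then show False using that by simp
    qed
    moreover have "bd S K x' = 0"
      unfolding x'_def bd_diff bd_bd[OF family] Suc.prems(2) by simp
    ultimately obtain w where w: "w \<in> chains_on K (n + 1)" "bd S K w = x'"
      using Suc.IH[OF x'] by blast
    have "bd S K (w + h x) = x" unfolding bd_add w(2) x'_def by simp
    then show ?case using w(1) hx additive_subgroupD(4)[OF chains_on_subgroup] by blast
  qed
  have "card (\<sigma> \<inter> L) \<le> nat (n + 1)" if "x \<sigma> \<noteq> 0" for \<sigma>
  proof -
    have "\<sigma> \<in> K" "int (card \<sigma>) = n + 1" using that assms(1) by (auto simp: chains_on_def)
    then show ?thesis using card_mono[of \<sigma> "\<sigma> \<inter> L"] K_D by auto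
  qed
  from *[OF assms this] show ?thesis .
qed

end

section \<open>Push-forward of chains\<close>

lemma compat_Chains: "compat X Y f \<Longrightarrow> \<sigma> \<in> Chains X \<Longrightarrow> f ` \<sigma> \<in> Chains Y"
  unfolding compat_def Chains_def by blast

lemma compat_simplices: "compat X Y f \<Longrightarrow> \<sigma> \<in> simplices X \<Longrightarrow> f ` \<sigma> \<in> simplices Y"
  using compat_Chains by (auto simp: simplices_def)

text \<open>As in \<^const>\<open>induced_chain_map\<close>, simplices on which \<open>f\<close> is not injective are sent to zero.\<close>

definition push :: "('v \<Rightarrow> 'w) \<Rightarrow> 'v rel \<Rightarrow> ('v set \<Rightarrow> int) \<Rightarrow> 'w set \<Rightarrow> int" where
  "push f X x \<tau> = (\<Sum>\<sigma> | \<sigma> \<in> simplices X \<and> f ` \<sigma> = \<tau> \<and> card \<sigma> = card \<tau>. x \<sigma>)"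

lemma push_add: "push f X (x + y) = push f X x + push f X y"
  by (simp add: push_def fun_eq_iff sum.distrib)

lemma push_chains_on:
  assumes "compat X Y f" "x \<in> chains_on (simplices X) n"
  shows "push f X x \<in> chains_on (simplices Y) n"
proof -
  have "\<tau> \<in> simplices Y \<and> int (card \<tau>) = n + 1" if "push f X x \<tau> \<noteq> 0" for \<tau>
  proof -
    have "\<exists>\<sigma>. \<sigma> \<in> simplices X \<and> f ` \<sigma> = \<tau> \<and> card \<sigma> = card \<tau> \<and> x \<sigma> \<noteq> 0"
      using that unfolding push_def by (auto elim: sum.not_neutral_contains_not_neutral)
    then show ?thesis using assms compat_simplices[OF assms(1)] by (auto simp: chains_on_def)
  qed
  then show ?thesis by (simp add: chains_on_def)
qed

lemma push_push:
  assumes "compat X Y f" "finite (Field X)" "finite (Field Y)"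
  shows "push g Y (push f X x) = push (g \<circ> f) X x"
proof
  fix \<tau>
  let ?B = "{\<beta>. \<beta> \<in> simplices Y \<and> g ` \<beta> = \<tau> \<and> card \<beta> = card \<tau>}"
  let ?A = "\<lambda>\<beta>. {\<sigma>. \<sigma> \<in> simplices X \<and> f ` \<sigma> = \<beta> \<and> card \<sigma> = card \<beta>}"
  have "push g Y (push f X x) \<tau> = (\<Sum>\<beta>\<in>?B. sum x (?A \<beta>))" by (simp add: push_def)
  also have "\<dots> = sum x (\<Union>\<beta>\<in>?B. ?A \<beta>)"
    by (rule sum.UNION_disjoint[symmetric]) (auto intro: finite_subset[OF _ finite_simplices] assms)
  also have "(\<Union>\<beta>\<in>?B. ?A \<beta>) = {\<sigma>. \<sigma> \<in> simplices X \<and> (g \<circ> f) ` \<sigma> = \<tau> \<and> card \<sigma> = card \<tau>}"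
  proof -
    \<comment> \<open>If the composite keeps the number of vertices, so does the first map; hence
      the simplices that survive the composite are those that survive both steps.\<close>
    have "card (f ` \<sigma>) = card \<tau>"
      if "\<sigma> \<in> simplices X" "g ` f ` \<sigma> = \<tau>" "card \<sigma> = card \<tau>" for \<sigma>
    proof -
      have "finite \<sigma>" using that by (simp add: simplices_def)
      then have "card \<tau> \<le> card (f ` \<sigma>)" "card (f ` \<sigma>) \<le> card \<sigma>"
        using that(2) card_image_le[of "f ` \<sigma>" g] card_image_le[of \<sigma> f] by auto
      then show ?thesis using that(3) by simp
    qed
    then show ?thesis using compat_simplices[OF assms(1)] by (auto simp: image_comp)
  qed
  finally show "push g Y (push f X x) \<tau> = push (g \<circ> f) X x \<tau>" by (simp add: push_def)
qed

text \<open>Compares, for one simplex \<open>\<sigma>\<close>, the coefficients at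
  \<open>\<rho>\<close> of the boundary of the image and the image of the boundary. If
  \<open>f\<close> is injective on \<open>\<sigma>\<close>, it preserves ranks and the signs agree.
  If not, the left side is empty, and faces mapping onto \<open>\<rho>\<close> come in pairs that
  omit one of two identified vertices, with opposite signs.\<close>

lemma push_coefficient:
  assumes X: "Partial_order X" and Y: "Partial_order Y" and f: "compat X Y f"
    and \<rho>: "\<rho> \<in> simplices Y" and \<sigma>: "\<sigma> \<in> simplices X" and card: "card \<sigma> = Suc (card \<rho>)"
  shows "(\<Sum>v | v \<notin> \<rho> \<and> f ` \<sigma> = insert v \<rho>. face_sign Y v \<rho>)
    = (\<Sum>u | u \<in> \<sigma> \<and> f ` (\<sigma> - {u}) = \<rho>. face_sign X u (\<sigma> - {u}))"
proof -
  have fin: "finite \<sigma>" "finite \<rho>" using \<sigma> \<rho> by (auto simp: simplices_def)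
  have comp: "(u, w) \<in> X \<or> (w, u) \<in> X" if "u \<in> \<sigma>" "w \<in> \<sigma>" for u w
    using \<sigma> that by (auto simp: simplices_def Chains_def)
  have mono: "(f u, f w) \<in> Y" if "(u, w) \<in> X" for u w using f that by (auto simp: compat_def)
  have card_minus: "card (\<sigma> - {u}) = card \<rho>" if "u \<in> \<sigma>" for u using that fin card by simp
  have inj_minus: "inj_on f (\<sigma> - {u})" if "u \<in> \<sigma>" "f ` (\<sigma> - {u}) = \<rho>" for u
    using that card_minus[OF that(1)] fin by (intro eq_card_imp_inj_on) auto
  have no_image: "\<not> (v \<notin> \<rho> \<and> f ` \<sigma> = insert v \<rho>)" if "\<not> inj_on f \<sigma>" for v
    using that eq_card_imp_inj_on[OF fin(1), of f] card fin by fastforce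
  show ?thesis
  proof (cases "inj_on f \<sigma>")
    case inj: True
    show ?thesis
    proof (cases "\<exists>u\<in>\<sigma>. f ` (\<sigma> - {u}) = \<rho>")
      case True
      then obtain u where u: "u \<in> \<sigma>" "f ` (\<sigma> - {u}) = \<rho>" by blast
      have fu: "f u \<notin> \<rho>" using u inj by (auto simp: inj_on_def)
      have V: "{v. v \<notin> \<rho> \<and> f ` \<sigma> = insert v \<rho>} = {f u}"
        using u fu by (auto simp: image_iff)
      have U: "{u'. u' \<in> \<sigma> \<and> f ` (\<sigma> - {u'}) = \<rho>} = {u}"
        using u fu by auto
      have W: "{w \<in> \<rho>. (w, f u) \<in> Y \<and> w \<noteq> f u} = f ` {w \<in> \<sigma> - {u}. (w, u) \<in> X \<and> w \<noteq> u}"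
      proof -
        have *: "(f w, f u) \<in> Y \<longleftrightarrow> (w, u) \<in> X" if "w \<in> \<sigma>" for w
        proof
          assume "(f w, f u) \<in> Y"
          then show "(w, u) \<in> X"
            using comp[OF that u(1)] mono[of u w] Partial_orderD(3)[OF Y, of "f w" "f u"] inj that u(1)
            by (auto simp: inj_on_def)
        qed (rule mono)
        have "{w \<in> \<rho>. (w, f u) \<in> Y \<and> w \<noteq> f u} = f ` {w \<in> \<sigma> - {u}. (f w, f u) \<in> Y \<and> f w \<noteq> f u}"
          unfolding u(2)[symmetric] by auto
        also have "{w \<in> \<sigma> - {u}. (f w, f u) \<in> Y \<and> f w \<noteq> f u} = {w \<in> \<sigma> - {u}. (w, u) \<in> X \<and> w \<noteq> u}"
          using * inj_on_eq_iff[OF inj _ u(1)] by blast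
        finally show ?thesis .
      qed
      have I: "inj_on f {w \<in> \<sigma> - {u}. (w, u) \<in> X \<and> w \<noteq> u}" using inj by (rule inj_on_subset) auto
      have "face_sign Y (f u) \<rho> = face_sign X u (\<sigma> - {u})"
        unfolding face_sign_def W card_image[OF I] ..
      then show ?thesis unfolding V U by simp
    next
      case False
      have "\<not> (v \<notin> \<rho> \<and> f ` \<sigma> = insert v \<rho>)" for v
      proof
        assume v: "v \<notin> \<rho> \<and> f ` \<sigma> = insert v \<rho>"
        then have "v \<in> f ` \<sigma>" by simp
        then obtain u where u: "u \<in> \<sigma>" "f u = v" by auto
        have "f ` (\<sigma> - {u}) = f ` \<sigma> - {f u}" using inj_on_image_set_diff[OF inj, of \<sigma> "{u}"] u(1) by simp
        then have "f ` (\<sigma> - {u}) = \<rho>" using u(2) v by auto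
        then show False using \<open>\<not> (\<exists>u\<in>\<sigma>. f ` (\<sigma> - {u}) = \<rho>)\<close> u(1) by blast
      qed
      then have V: "{v. v \<notin> \<rho> \<and> f ` \<sigma> = insert v \<rho>} = {}" by simp
      have U: "{u. u \<in> \<sigma> \<and> f ` (\<sigma> - {u}) = \<rho>} = {}" using False by simp
      show ?thesis unfolding V U by simp
    qed
  next
    case False
    have lhs: "(\<Sum>v | v \<notin> \<rho> \<and> f ` \<sigma> = insert v \<rho>. face_sign Y v \<rho>) = 0"
    proof -
      have V: "{v. v \<notin> \<rho> \<and> f ` \<sigma> = insert v \<rho>} = {}" using no_image[OF False] by simp
      show ?thesis unfolding V by simp
    qed
    show ?thesis
    proof (cases "\<exists>u\<in>\<sigma>. f ` (\<sigma> - {u}) = \<rho>")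
      case True
      then obtain u where u: "u \<in> \<sigma>" "f ` (\<sigma> - {u}) = \<rho>" by blast
      obtain w where w: "w \<in> \<sigma>" "w \<noteq> u" "f w = f u"
      proof -
        obtain x1 x2 where x12: "x1 \<in> \<sigma>" "x2 \<in> \<sigma>" "x1 \<noteq> x2" "f x1 = f x2"
          using False unfolding inj_on_def by blast
        then have "x1 = u \<or> x2 = u" using inj_onD[OF inj_minus[OF u] x12(4)] by blast
        then show thesis using that x12 by metis
      qed
      obtain a b where ab: "a \<in> \<sigma>" "b \<in> \<sigma>" "a \<noteq> b" "f a = f b" "(a, b) \<in> X" "u = a \<or> u = b"
        using comp[OF u(1) w(1)] u(1) w by metis
      have im: "f ` (\<sigma> - {c}) = f ` \<sigma>" if "c \<in> \<sigma>" "c' \<in> \<sigma>" "c' \<noteq> c" "f c' = f c" for c c'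
      proof -
        have "f c \<in> f ` (\<sigma> - {c})" using imageI[of c' "\<sigma> - {c}" f] that by simp
        moreover have "f ` \<sigma> = insert (f c) (f ` (\<sigma> - {c}))" using that(1) by auto
        ultimately show ?thesis by auto
      qed
      have "f ` (\<sigma> - {a}) = f ` \<sigma>" "f ` (\<sigma> - {b}) = f ` \<sigma>" using im[of a b] im[of b a] ab by simp_all
      then have a: "f ` (\<sigma> - {a}) = \<rho>" and b: "f ` (\<sigma> - {b}) = \<rho>" using ab(6) u(2) by auto
      have "{u. u \<in> \<sigma> \<and> f ` (\<sigma> - {u}) = \<rho>} = {a, b}"
      proof -
        have "c = a \<or> c = b" if "c \<in> \<sigma>" "f ` (\<sigma> - {c}) = \<rho>" for c
          using inj_minus[OF that] ab by (auto simp: inj_on_def)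
        then show ?thesis using ab a b by auto
      qed
      moreover have "face_sign X b (\<sigma> - {b}) = - face_sign X a (\<sigma> - {a})"
      proof -
        \<comment> \<open>The identified vertices \<open>a\<close> and \<open>b\<close> are
          neighbours in \<open>\<sigma>\<close>: a vertex strictly between them would have the same
          image, against injectivity on \<open>\<sigma> - {b}\<close>. So \<open>b\<close> has one
          predecessor more than \<open>a\<close>, namely \<open>a\<close>.\<close>
        have "{w \<in> \<sigma> - {b}. (w, b) \<in> X \<and> w \<noteq> b} = insert a {w \<in> \<sigma> - {a}. (w, a) \<in> X \<and> w \<noteq> a}"
        proof (intro equalityI subsetI)
          fix c assume c: "c \<in> {w \<in> \<sigma> - {b}. (w, b) \<in> X \<and> w \<noteq> b}"
          show "c \<in> insert a {w \<in> \<sigma> - {a}. (w, a) \<in> X \<and> w \<noteq> a}"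
          proof (cases "(c, a) \<in> X")
            case False
            then have "(a, c) \<in> X" using comp c ab by blast
            then have "f c = f a" using mono[of a c] mono[of c b] c ab(4) Partial_orderD(3)[OF Y] by auto
            then show ?thesis using inj_minus[OF ab(2) b] c ab by (auto simp: inj_on_def)
          qed (use c in auto)
        next
          fix c assume "c \<in> insert a {w \<in> \<sigma> - {a}. (w, a) \<in> X \<and> w \<noteq> a}"
          then show "c \<in> {w \<in> \<sigma> - {b}. (w, b) \<in> X \<and> w \<noteq> b}"
            using ab Partial_orderD(2,3)[OF X] by blast
        qed
        then show ?thesis using fin by (simp add: face_sign_def)
      qed
      ultimately show ?thesis using lhs ab(3) by simp
    next
      case False
      then have U: "{u. u \<in> \<sigma> \<and> f ` (\<sigma> - {u}) = \<rho>} = {}" by simp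
      show ?thesis unfolding lhs U by simp
    qed
  qed
qed

text \<open>Both sides expand over the simplices of \<open>X\<close> with one vertex more than
  \<open>\<rho>\<close>, where \<open>push_coefficient\<close> compares them one by one.\<close>

lemma bd_push:
  assumes X: "Partial_order X" and Y: "Partial_order Y" and f: "compat X Y f"
    and fin: "finite (Field X)" "finite (Field Y)"
  shows "bd Y (simplices Y) (push f X x) = push f X (bd X (simplices X) x)"
proof
  fix \<rho>
  show "bd Y (simplices Y) (push f X x) \<rho> = push f X (bd X (simplices X) x) \<rho>"
  proof (cases "\<rho> \<in> simplices Y")
    case \<rho>: True
    let ?S = "{\<sigma> \<in> simplices X. card \<sigma> = Suc (card \<rho>)}"
    have finS: "finite ?S" using finite_simplices[OF fin(1)] by auto
    have famX: "simplex_family X (simplices X)" and famY: "simplex_family Y (simplices Y)"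
      using simplex_family_simplices X Y fin by (auto simp: partial_order_on_def)
    have fin\<rho>: "finite \<rho>" "\<rho> \<noteq> {}" using \<rho> by (auto simp: simplices_def)
    let ?V = "{v. v \<notin> \<rho> \<and> insert v \<rho> \<in> simplices Y}"
    have finV: "finite ?V" by (rule finite_cofaces[OF famY])
    have "bd Y (simplices Y) (push f X x) \<rho> = (\<Sum>v\<in>?V. \<Sum>\<sigma>\<in>?S. if f ` \<sigma> = insert v \<rho> then face_sign Y v \<rho> * x \<sigma> else 0)"
    proof -
      have "push f X x (insert v \<rho>) = (\<Sum>\<sigma>\<in>?S. if f ` \<sigma> = insert v \<rho> then x \<sigma> else 0)" if "v \<in> ?V" for v
      proof -
        have "{\<sigma>. \<sigma> \<in> simplices X \<and> f ` \<sigma> = insert v \<rho> \<and> card \<sigma> = card (insert v \<rho>)} = {\<sigma> \<in> ?S. f ` \<sigma> = insert v \<rho>}"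
          using that fin\<rho> by auto
        then show ?thesis unfolding push_def by (simp only: sum.inter_filter[OF finS])
      qed
      then have "face_sign Y v \<rho> * push f X x (insert v \<rho>)
          = (\<Sum>\<sigma>\<in>?S. if f ` \<sigma> = insert v \<rho> then face_sign Y v \<rho> * x \<sigma> else 0)" if "v \<in> ?V" for v
        using that by (simp only: sum_distrib_left if_distrib mult_zero_right cong: if_cong)
      then show ?thesis using \<rho> by (simp add: bd_def)
    qed
    also have "\<dots> = (\<Sum>\<sigma>\<in>?S. \<Sum>v\<in>?V. if f ` \<sigma> = insert v \<rho> then face_sign Y v \<rho> * x \<sigma> else 0)"
      by (rule sum.swap)
    also have "\<dots> = (\<Sum>\<sigma>\<in>?S. (\<Sum>v | v \<notin> \<rho> \<and> f ` \<sigma> = insert v \<rho>. face_sign Y v \<rho>) * x \<sigma>)"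
    proof (rule sum.cong[OF refl])
      fix \<sigma> assume "\<sigma> \<in> ?S"
      then have "{v. v \<notin> \<rho> \<and> f ` \<sigma> = insert v \<rho>} = {v \<in> ?V. f ` \<sigma> = insert v \<rho>}"
        using compat_simplices[OF f, of \<sigma>] by auto
      then show "(\<Sum>v\<in>?V. if f ` \<sigma> = insert v \<rho> then face_sign Y v \<rho> * x \<sigma> else 0)
          = (\<Sum>v | v \<notin> \<rho> \<and> f ` \<sigma> = insert v \<rho>. face_sign Y v \<rho>) * x \<sigma>"
        by (simp only: sum.inter_filter[OF finV, symmetric] sum_distrib_right)
    qed
    also have "\<dots> = (\<Sum>\<sigma>\<in>?S. (\<Sum>u | u \<in> \<sigma> \<and> f ` (\<sigma> - {u}) = \<rho>. face_sign X u (\<sigma> - {u})) * x \<sigma>)"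
      using push_coefficient[OF X Y f \<rho>] by (intro sum.cong) auto
    also have "\<dots> = (\<Sum>(\<sigma>, u)\<in>Sigma ?S (\<lambda>\<sigma>. {u. u \<in> \<sigma> \<and> f ` (\<sigma> - {u}) = \<rho>}). face_sign X u (\<sigma> - {u}) * x \<sigma>)"
      unfolding sum_distrib_right by (rule sum.Sigma[OF finS]) (auto simp: simplices_def)
    \<comment> \<open>A simplex with a vertex to delete is the same as a face with a vertex to
      insert.\<close>
    also have "\<dots> = (\<Sum>(\<alpha>, u)\<in>Sigma {\<alpha>. \<alpha> \<in> simplices X \<and> f ` \<alpha> = \<rho> \<and> card \<alpha> = card \<rho>}
        (\<lambda>\<alpha>. {u. u \<notin> \<alpha> \<and> insert u \<alpha> \<in> simplices X}). face_sign X u \<alpha> * x (insert u \<alpha>))"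
    proof -
      have 1: "\<sigma> - {u} \<in> simplices X \<and> card (\<sigma> - {u}) = card \<rho>"
        if "\<sigma> \<in> simplices X" "card \<sigma> = Suc (card \<rho>)" "u \<in> \<sigma>" "f ` (\<sigma> - {u}) = \<rho>" for \<sigma> u
        using that fin\<rho> simplices_subset[OF that(1), of "\<sigma> - {u}"] by (auto simp: simplices_def)
      have 2: "card (insert u \<alpha>) = Suc (card \<alpha>)" if "\<alpha> \<in> simplices X" "u \<notin> \<alpha>" for \<alpha> u
        using that by (simp add: simplices_def)
      show ?thesis
        by (rule sum.reindex_bij_witness[of _ "\<lambda>(\<alpha>, u). (insert u \<alpha>, u)" "\<lambda>(\<sigma>, u). (\<sigma> - {u}, u)"])
          (use 1 2 in \<open>auto simp: insert_absorb\<close>)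
    qed
    also have "\<dots> = push f X (bd X (simplices X) x) \<rho>"
      unfolding push_def
      by (subst sum.Sigma[symmetric])
        (use finite_simplices[OF fin(1)] finite_cofaces[OF famX] in \<open>auto simp: bd_def\<close>)
    finally show ?thesis .
  next
    case False
    then show ?thesis using compat_simplices[OF f] by (auto simp: bd_def push_def intro!: sum.neutral)
  qed
qed

section \<open>The boundary with coefficients in a functor\<close>

text \<open>An infinite set has \<open>card\<close> 0, so cardinality \<open>n + 1\<close> with
  \<open>0 \<le> n\<close> already forces a finite nonempty chain; conversely nonemptiness forces
  \<open>0 \<le> n\<close>.\<close>

lemma Ch_iff: "\<sigma> \<in> Ch n X \<longleftrightarrow> \<sigma> \<in> simplices X \<and> int (card \<sigma>) = n + 1"
proof
  assume *: "\<sigma> \<in> Ch n X"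
  then have "finite \<sigma>" "\<sigma> \<noteq> {}" by (auto simp: Ch_def intro: card_ge_0_finite)
  with * show "\<sigma> \<in> simplices X \<and> int (card \<sigma>) = n + 1" by (auto simp: Ch_def simplices_def)
next
  assume *: "\<sigma> \<in> simplices X \<and> int (card \<sigma>) = n + 1"
  then have "card \<sigma> > 0" by (simp add: simplices_def card_gt_0_iff)
  with * show "\<sigma> \<in> Ch n X" by (simp add: Ch_def simplices_def)
qed

lemma finite_Ch: "finite (Field X) \<Longrightarrow> finite (Ch n X)"
  by (rule finite_subset[OF _ finite_simplices]) (auto simp: Ch_iff)

abbreviation rank_in :: "'v rel \<Rightarrow> 'v set \<Rightarrow> 'v \<Rightarrow> nat" where
  "rank_in X \<sigma> v \<equiv> card {u \<in> \<sigma>. (u, v) \<in> X \<and> u \<noteq> v}"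

context
  fixes X :: "'v rel" and \<sigma> :: "'v set"
  assumes X: "Partial_order X" and \<sigma>: "\<sigma> \<in> simplices X"
begin

text \<open>On a chain the rank is strictly increasing, hence injective, and stays below
  \<open>card \<sigma>\<close>; equal cardinalities do the rest. This gives the definite description
  in \<open>vertex\<close> its meaning.\<close>

lemma rank_in_bij: "bij_betw (rank_in X \<sigma>) \<sigma> {..<card \<sigma>}"
proof -
  note finite_poset_Partial_order = Partial_orderD[OF X]
  have fin: "finite \<sigma>" using \<sigma> by (simp add: simplices_def)
  have comp: "(u, w) \<in> X \<or> (w, u) \<in> X" if "u \<in> \<sigma>" "w \<in> \<sigma>" for u w
    using \<sigma> that by (auto simp: simplices_def Chains_def)
  have less: "rank_in X \<sigma> u < rank_in X \<sigma> v" if "u \<in> \<sigma>" "(u, v) \<in> X" "u \<noteq> v" for u v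
  proof (rule psubset_card_mono)
    show "{w \<in> \<sigma>. (w, u) \<in> X \<and> w \<noteq> u} \<subset> {w \<in> \<sigma>. (w, v) \<in> X \<and> w \<noteq> v}"
      using that finite_poset_Partial_order(2,3) by blast
  qed (use fin in auto)
  have "inj_on (rank_in X \<sigma>) \<sigma>"
  proof (rule inj_onI, rule ccontr)
    fix u v assume "u \<in> \<sigma>" "v \<in> \<sigma>" "rank_in X \<sigma> u = rank_in X \<sigma> v" "u \<noteq> v"
    then show False using comp[of u v] less[of u v] less[of v u] by auto
  qed
  moreover have "rank_in X \<sigma> ` \<sigma> \<subseteq> {..<card \<sigma>}"
    using fin by (auto intro!: psubset_card_mono)
  ultimately show ?thesis
    using card_subset_eq[of "{..<card \<sigma>}" "rank_in X \<sigma> ` \<sigma>"] by (simp add: bij_betw_def card_image)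
qed

lemma vertex_rank_in: "v \<in> \<sigma> \<Longrightarrow> vertex X \<sigma> (rank_in X \<sigma> v) = v"
  unfolding vertex_def using rank_in_bij by (intro the_equality) (auto simp: bij_betw_def dest: inj_onD)

lemma vertex_in:
  assumes "i < card \<sigma>"
  shows "vertex X \<sigma> i \<in> \<sigma>" "rank_in X \<sigma> (vertex X \<sigma> i) = i"
proof -
  have "i \<in> rank_in X \<sigma> ` \<sigma>" unfolding bij_betw_imp_surj_on[OF rank_in_bij] using assms by simp
  then obtain v where v: "v \<in> \<sigma>" "i = rank_in X \<sigma> v" by (rule imageE)
  have "vertex X \<sigma> i = v" unfolding v(2) by (rule vertex_rank_in[OF v(1)])
  then show "vertex X \<sigma> i \<in> \<sigma>" "rank_in X \<sigma> (vertex X \<sigma> i) = i" by (simp_all only: v(1) v(2)[symmetric])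
qed

lemma vertex_0: "vertex X \<sigma> 0 \<in> \<sigma>" "\<And>u. u \<in> \<sigma> \<Longrightarrow> (vertex X \<sigma> 0, u) \<in> X"
proof -
  have fin: "finite \<sigma>" "card \<sigma> > 0" using \<sigma> by (auto simp: simplices_def card_gt_0_iff)
  show v: "vertex X \<sigma> 0 \<in> \<sigma>" using vertex_in fin by blast
  fix u assume u: "u \<in> \<sigma>"
  have "{w \<in> \<sigma>. (w, vertex X \<sigma> 0) \<in> X \<and> w \<noteq> vertex X \<sigma> 0} = {}"
    using vertex_in(2)[OF fin(2)] fin(1) by simp
  then have "(u, vertex X \<sigma> 0) \<notin> X \<or> u = vertex X \<sigma> 0" using u by blast
  moreover have "(vertex X \<sigma> 0, u) \<in> X \<or> (u, vertex X \<sigma> 0) \<in> X"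
    using \<sigma> u v by (auto simp: simplices_def Chains_def)
  ultimately show "(vertex X \<sigma> 0, u) \<in> X" by auto
qed

lemma vertex_0_unique:
  assumes "m \<in> \<sigma>" "\<And>u. u \<in> \<sigma> \<Longrightarrow> (m, u) \<in> X" shows "vertex X \<sigma> 0 = m"
  using vertex_0 assms Partial_orderD(3)[OF X] by blast

lemma vertex_0_Field: "vertex X \<sigma> 0 \<in> Field X"
  using vertex_0 by (auto intro: FieldI1)

end

section \<open>Chain groups with coefficients, evaluated coordinate by coordinate\<close>

lemma comm_group_sum_group:
  assumes "\<And>i. i \<in> I \<Longrightarrow> comm_group (G i)" shows "comm_group (sum_group I G)"
proof (rule group.group_comm_groupI)
  have G: "group (G i)" if "i \<in> I" for i using assms[OF that] by (simp add: comm_group_def)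
  then show "group (sum_group I G)" by simp
  fix x y assume "x \<in> carrier (sum_group I G)" "y \<in> carrier (sum_group I G)"
  then show "x \<otimes>\<^bsub>sum_group I G\<^esub> y = y \<otimes>\<^bsub>sum_group I G\<^esub> x"
    using G assms by (auto simp: carrier_sum_group PiE_iff comm_group_def comm_monoid.m_comm intro!: restrict_ext)
qed

lemma carrier_sum_group_finite:
  assumes "finite I" "\<And>i. i \<in> I \<Longrightarrow> group (G i)"
  shows "carrier (sum_group I G) = (\<Pi>\<^sub>E i\<in>I. carrier (G i))"
  using assms by (auto simp: carrier_sum_group)

lemma finprod_sum_group_apply:
  assumes "\<And>i. i \<in> I \<Longrightarrow> comm_group (G i)" "f \<in> A \<rightarrow> carrier (sum_group I G)" "i \<in> I"
  shows "finprod (sum_group I G) f A i = finprod (G i) (\<lambda>a. f a i) A"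
proof -
  interpret S: comm_group "sum_group I G" by (rule comm_group_sum_group) fact
  interpret Gi: comm_group "G i" by (rule assms) fact
  have G: "group (G i)" if "i \<in> I" for i using assms(1)[OF that] by (simp add: comm_group_def)
  have comp: "f a i \<in> carrier (G i)" if "f a \<in> carrier (sum_group I G)" for a
    using that assms(3) by (auto simp: carrier_sum_group[OF G])
  show ?thesis
    using assms(2)
  proof (induction A rule: infinite_finite_induct)
    case (insert a A)
    have "(\<lambda>a. f a i) \<in> A \<rightarrow> carrier (G i)" "f a i \<in> carrier (G i)" using insert.prems comp by auto
    then show ?case
      using insert assms(3) by (simp add: S.finprod_insert Gi.finprod_insert)
  qed (use assms(3) in simp_all)
qed

locale coefficient_functor =
  fixes X :: "'v rel" and F :: "'v \<Rightarrow> 'c monoid" and \<psi> :: "'v \<Rightarrow> 'v \<Rightarrow> 'c \<Rightarrow> 'c"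
  assumes X: "Partial_order X" and fin: "finite (Field X)"
    and F: "p \<in> Field X \<Longrightarrow> comm_group (F p)"
    and \<psi>: "(p, q) \<in> X \<Longrightarrow> \<psi> p q \<in> hom (F p) (F q)"
begin

lemma F_simplex: "\<sigma> \<in> simplices X \<Longrightarrow> comm_group (F (vertex X \<sigma> 0))"
  using F vertex_0_Field[OF X] by blast

lemma F_Ch: "\<sigma> \<in> Ch n X \<Longrightarrow> comm_group (F (vertex X \<sigma> 0))"
  using F_simplex by (simp add: Ch_iff)

lemma comm_group_chain_group: "comm_group (chain_group n X F)"
  unfolding chain_group_def by (rule comm_group_sum_group[OF F_Ch])

lemma carrier_chain_group: "carrier (chain_group n X F) = (\<Pi>\<^sub>E \<sigma>\<in>Ch n X. carrier (F (vertex X \<sigma> 0)))"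
  unfolding chain_group_def
  by (rule carrier_sum_group_finite[OF finite_Ch[OF fin]]) (use F_Ch in \<open>auto simp: comm_group_def\<close>)

text \<open>The contribution of the coface \<open>insert v \<rho>\<close> at \<open>\<rho>\<close>.
  If \<open>v\<close> is the new minimum, the coefficient must be moved by \<open>\<psi>\<close> and
  the sign is +1; otherwise the minimum, and with it the coefficient group, stays the same.\<close>

definition face_term :: "('v set \<Rightarrow> 'c) \<Rightarrow> 'v set \<Rightarrow> 'v \<Rightarrow> 'c" where
  "face_term c \<rho> v = (if (v, vertex X \<rho> 0) \<in> X then \<psi> v (vertex X \<rho> 0) (c (insert v \<rho>))
     else c (insert v \<rho>) [^]\<^bsub>F (vertex X \<rho> 0)\<^esub> face_sign X v \<rho>)"

lemma vertex_insert:
  assumes "\<rho> \<in> simplices X" "insert v \<rho> \<in> simplices X" "v \<notin> \<rho>"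
  shows "vertex X (insert v \<rho>) 0 = (if (v, vertex X \<rho> 0) \<in> X then v else vertex X \<rho> 0)"
proof (rule vertex_0_unique[OF X assms(2)])
  let ?m = "vertex X \<rho> 0"
  note m = vertex_0[OF X assms(1)]
  have v: "(v, v) \<in> X" "(v, ?m) \<in> X \<or> (?m, v) \<in> X"
    using assms(2) m(1) by (auto simp: simplices_def Chains_def)
  show "(if (v, ?m) \<in> X then v else ?m, u) \<in> X" if "u \<in> insert v \<rho>" for u
  proof (cases "u = v")
    case True
    then show ?thesis using v by (cases "(v, ?m) \<in> X") simp_all
  next
    case False
    then have "(?m, u) \<in> X" using m(2) that by simp
    then show ?thesis using Partial_orderD(2)[OF X, of v ?m u] by (cases "(v, ?m) \<in> X") simp_all
  qed
qed (use vertex_0[OF X assms(1)] in auto)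

lemma face_term_closed:
  assumes c: "c \<in> carrier (chain_group n X F)"
    and \<rho>: "\<rho> \<in> simplices X" "insert v \<rho> \<in> Ch n X" "v \<notin> \<rho>"
  shows "face_term c \<rho> v \<in> carrier (F (vertex X \<rho> 0))"
proof -
  have "c (insert v \<rho>) \<in> carrier (F (vertex X (insert v \<rho>) 0))"
    using c \<rho>(2) by (auto simp: carrier_chain_group)
  moreover have "group (F (vertex X \<rho> 0))" using F_simplex[OF \<rho>(1)] by (simp add: comm_group_def)
  moreover have "insert v \<rho> \<in> simplices X" using \<rho>(2) by (simp add: Ch_iff)
  ultimately show ?thesis
    using vertex_insert[OF \<rho>(1) _ \<rho>(3)] hom_in_carrier[OF \<psi>[of v "vertex X \<rho> 0"]]
    by (simp add: face_term_def group.int_pow_closed split: if_splits)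
qed

text \<open>Trades the indexing by position in the definition of the boundary for an indexing by the
  deleted vertex, one coordinate at a time.\<close>

lemma simplex_boundary_apply:
  assumes n: "1 \<le> n" and \<sigma>: "\<sigma> \<in> Ch n X" and g: "c \<sigma> \<in> carrier (F (vertex X \<sigma> 0))"
  shows "simplex_boundary n X F \<psi> (c \<sigma>) \<sigma> \<in> carrier (chain_group (n - 1) X F)"
    and "\<rho> \<in> Ch (n - 1) X \<Longrightarrow> v \<notin> \<rho> \<Longrightarrow> \<sigma> = insert v \<rho> \<Longrightarrow>
      simplex_boundary n X F \<psi> (c \<sigma>) \<sigma> \<rho> = face_term c \<rho> v"
    and "\<rho> \<in> Ch (n - 1) X \<Longrightarrow> (\<And>v. v \<notin> \<rho> \<Longrightarrow> \<sigma> \<noteq> insert v \<rho>) \<Longrightarrow>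
      simplex_boundary n X F \<psi> (c \<sigma>) \<sigma> \<rho> = \<one>\<^bsub>F (vertex X \<rho> 0)\<^esub>"
proof -
  let ?G = "chain_group (n - 1) X F" and ?g = "c \<sigma>"
  interpret G: comm_group ?G by (rule comm_group_chain_group)
  have \<sigma>s: "\<sigma> \<in> simplices X" and card: "int (card \<sigma>) = n + 1" using \<sigma> by (auto simp: Ch_iff)
  have fin\<sigma>: "finite \<sigma>" using \<sigma>s by (simp add: simplices_def)
  have card': "card \<sigma> = Suc (nat n)" using card n by linarith
  define w where "w = vertex X \<sigma>"
  have w: "w i \<in> \<sigma>" "rank_in X \<sigma> (w i) = i" if "i \<le> nat n" for i
    unfolding w_def using vertex_in[OF X \<sigma>s, of i] that card' by auto
  have w_rank: "w (rank_in X \<sigma> v) = v" if "v \<in> \<sigma>" for v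
    unfolding w_def by (rule vertex_rank_in[OF X \<sigma>s that])
  have w0_le: "(w 0, u) \<in> X" if "u \<in> \<sigma>" for u
    unfolding w_def by (rule vertex_0(2)[OF X \<sigma>s that])
  have w_inj: "w i = w j \<longleftrightarrow> i = j" if "i \<le> nat n" "j \<le> nat n" for i j
  proof
    assume "w i = w j"
    then have "rank_in X \<sigma> (w i) = rank_in X \<sigma> (w j)" by (rule arg_cong)
    then show "i = j" unfolding w(2)[OF that(1)] w(2)[OF that(2)] .
  qed simp
  have face_in: "\<sigma> - {v} \<in> simplices X" if "v \<in> \<sigma>" for v
  proof (rule simplices_subset[OF \<sigma>s])
    have "card (\<sigma> - {v}) = nat n" using that card' fin\<sigma> by simp
    then have "card (\<sigma> - {v}) \<noteq> 0" using n by simp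
    then show "\<sigma> - {v} \<noteq> {}" by (rule contrapos_nn) (simp only: card.empty)
  qed auto
  have face_min: "vertex X (\<sigma> - {w i}) 0 = w 0" if "1 \<le> i" "i \<le> nat n" for i
  proof (rule vertex_0_unique[OF X face_in])
    show "w 0 \<in> \<sigma> - {w i}" using w(1)[of 0] w_inj[of 0 i] that by auto
  qed (use w0_le w that in auto)
  have face_min0: "vertex X (\<sigma> - {w 0}) 0 = w 1"
  proof (rule vertex_0_unique[OF X face_in])
    have 1: "1 \<le> nat n" using n by simp
    show "w 1 \<in> \<sigma> - {w 0}" using w(1)[OF 1] w_inj[of 0 1] 1 by auto
    \<comment> \<open>Rank 1 means that exactly one vertex lies below \<open>w 1\<close>; as
      \<open>w 0\<close> is one, no vertex of the face does.\<close>
    have "w 0 \<in> {u \<in> \<sigma>. (u, w 1) \<in> X \<and> u \<noteq> w 1}"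
      using w0_le[OF w(1)[OF 1]] w(1)[of 0] w_inj[of 0 1] 1 by simp
    moreover obtain a where a: "{u \<in> \<sigma>. (u, w 1) \<in> X \<and> u \<noteq> w 1} = {a}"
      by (rule card_1_singletonE[OF w(2)[OF 1]])
    ultimately have "w 0 = a" by (simp only: singleton_iff)
    with a have *: "{u \<in> \<sigma>. (u, w 1) \<in> X \<and> u \<noteq> w 1} = {w 0}" by (simp only:)
    show "(w 1, u) \<in> X" if u: "u \<in> \<sigma> - {w 0}" for u
    proof -
      have "(w 1, u) \<in> X \<or> (u, w 1) \<in> X" using u w(1)[OF 1] \<sigma>s by (auto simp: simplices_def Chains_def)
      moreover have "u \<notin> {u \<in> \<sigma>. (u, w 1) \<in> X \<and> u \<noteq> w 1}" unfolding * using u by simp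
      ultimately show ?thesis using u by (cases "u = w 1") simp_all
    qed
  qed (use w in auto)
  have grp: "group (F (w 0))" using F_simplex[OF \<sigma>s] by (simp add: w_def comm_group_def)
  have g': "?g \<in> carrier (F (w 0))" using g by (simp add: w_def)
  have sc_closed: "simplex_chain (n - 1) X F h \<tau> \<in> carrier ?G" if "h \<in> carrier (F (vertex X \<tau> 0))" for h \<tau>
  proof -
    have "\<one>\<^bsub>F (vertex X \<rho> 0)\<^esub> \<in> carrier (F (vertex X \<rho> 0))" if "\<rho> \<in> Ch (n - 1) X" for \<rho>
      using F_Ch[OF that] by (simp add: comm_group_def group.is_monoid monoid.one_closed)
    then show ?thesis using that by (auto simp: simplex_chain_def carrier_chain_group)
  qed
  define s0 where "s0 = simplex_chain (n - 1) X F (\<psi> (w 0) (w 1) ?g) (\<sigma> - {w 0})"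
  define s where "s i = simplex_chain (n - 1) X F (?g [^]\<^bsub>F (w 0)\<^esub> ((- 1) ^ i :: int)) (\<sigma> - {w i})" for i
  have 1: "1 \<le> nat n" using n by simp
  have s0: "s0 \<in> carrier ?G"
    unfolding s0_def using \<psi>[OF w0_le[OF w(1)[OF 1]]] g' by (intro sc_closed) (simp add: face_min0 hom_in_carrier)
  have s: "s i \<in> carrier ?G" if "i \<in> {1..nat n}" for i
    unfolding s_def using that grp g' by (intro sc_closed) (simp add: face_min group.int_pow_closed)
  have eq: "simplex_boundary n X F \<psi> ?g \<sigma> = s0 \<otimes>\<^bsub>?G\<^esub> finprod ?G s {1..nat n}"
    unfolding simplex_boundary_def s0_def s_def[abs_def] w_def ..
  show "simplex_boundary n X F \<psi> ?g \<sigma> \<in> carrier ?G"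
    unfolding eq using s0 s by (intro G.m_closed G.finprod_closed) auto
  have boundary_at: "simplex_boundary n X F \<psi> ?g \<sigma> \<rho>
      = s0 \<rho> \<otimes>\<^bsub>F (vertex X \<rho> 0)\<^esub> finprod (F (vertex X \<rho> 0)) (\<lambda>i. s i \<rho>) {1..nat n}"
    if "\<rho> \<in> Ch (n - 1) X" for \<rho>
  proof -
    have "finprod ?G s {1..nat n} \<rho> = finprod (F (vertex X \<rho> 0)) (\<lambda>i. s i \<rho>) {1..nat n}"
      using finprod_sum_group_apply[OF F_Ch _ that, where A = "{1..nat n}" and f = s] s
      by (simp add: chain_group_def)
    then show ?thesis unfolding eq using that by (simp add: chain_group_def)
  qed
  show "simplex_boundary n X F \<psi> (c \<sigma>) \<sigma> \<rho> = \<one>\<^bsub>F (vertex X \<rho> 0)\<^esub>"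
    if \<rho>: "\<rho> \<in> Ch (n - 1) X" "\<And>v. v \<notin> \<rho> \<Longrightarrow> \<sigma> \<noteq> insert v \<rho>"
  proof -
    interpret R: comm_group "F (vertex X \<rho> 0)" by (rule F_Ch[OF \<rho>(1)])
    have "\<rho> \<noteq> \<sigma> - {w i}" if "i \<le> nat n" for i using \<rho>(2)[of "w i"] w(1)[OF that] by auto
    then have s1: "s0 \<rho> = \<one>\<^bsub>F (vertex X \<rho> 0)\<^esub>"
      "\<And>i. i \<in> {1..nat n} \<Longrightarrow> s i \<rho> = \<one>\<^bsub>F (vertex X \<rho> 0)\<^esub>"
      using \<rho>(1) by (auto simp: s0_def s_def simplex_chain_def)
    have "finprod (F (vertex X \<rho> 0)) (\<lambda>i. s i \<rho>) {1..nat n} = \<one>\<^bsub>F (vertex X \<rho> 0)\<^esub>"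
      by (rule R.finprod_one_eqI[OF s1(2)])
    then show ?thesis unfolding boundary_at[OF \<rho>(1)] s1(1) by simp
  qed
  show "simplex_boundary n X F \<psi> (c \<sigma>) \<sigma> \<rho> = face_term c \<rho> v"
    if \<rho>: "\<rho> \<in> Ch (n - 1) X" and v: "v \<notin> \<rho>" "\<sigma> = insert v \<rho>"
  proof -
    interpret R: comm_group "F (vertex X \<rho> 0)" by (rule F_Ch[OF \<rho>])
    define i where "i = rank_in X \<sigma> v"
    have vs: "v \<in> \<sigma>" "\<rho> = \<sigma> - {v}" using v by auto
    have wi: "w i = v" unfolding i_def by (rule w_rank[OF vs(1)])
    have i: "i \<le> nat n" using bij_betwE[OF rank_in_bij[OF X \<sigma>s]] vs(1) card' by (auto simp: i_def)
    have \<rho>_eq: "\<rho> = \<sigma> - {w j} \<longleftrightarrow> j = i" if "j \<le> nat n" for j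
      using vs wi w(1)[OF that] w_inj[OF that i] by auto
    have sgn: "face_sign X v \<rho> = (- 1) ^ i"
      unfolding face_sign_def i_def using v(1) by (intro arg_cong[of _ _ "\<lambda>A. (- 1) ^ card A"]) (auto simp: v(2))
    have s_eq: "s j \<rho> = (if j = i then ?g [^]\<^bsub>F (w 0)\<^esub> ((- 1) ^ i :: int) else \<one>\<^bsub>F (vertex X \<rho> 0)\<^esub>)"
      if "j \<in> {1..nat n}" for j
      using that \<rho>_eq[of j] \<rho> by (simp add: s_def simplex_chain_def)
    \<comment> \<open>Ties the case distinction in \<open>face_term\<close> to the separate factor
      for position 0 in the definition.\<close>
    have v_le: "(v, vertex X \<rho> 0) \<in> X \<longleftrightarrow> i = 0"
    proof
      assume "(v, vertex X \<rho> 0) \<in> X"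
      then have "vertex X \<sigma> 0 = v"
        using vertex_insert[of \<rho> v] v \<rho> \<sigma>s by (simp add: Ch_iff)
      then show "i = 0" using w_inj[OF i, of 0] wi by (simp add: w_def)
    next
      assume "i = 0"
      then show "(v, vertex X \<rho> 0) \<in> X" using w0_le wi vertex_0(1)[OF X, of \<rho>] \<rho> v by (auto simp: Ch_iff)
    qed
    show ?thesis
    proof (cases "i = 0")
      case True
      then have "s0 \<rho> = \<psi> (w 0) (w 1) ?g" using \<rho>_eq[of 0] \<rho> by (simp add: s0_def simplex_chain_def)
      moreover have "finprod (F (vertex X \<rho> 0)) (\<lambda>j. s j \<rho>) {1..nat n} = \<one>\<^bsub>F (vertex X \<rho> 0)\<^esub>"
        using s_eq True by (intro R.finprod_one_eqI) auto
      moreover have "vertex X \<rho> 0 = w 1" using face_min0 \<rho>_eq[of 0] True by simp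
      moreover have "\<psi> (w 0) (w 1) ?g \<in> carrier (F (w 1))"
        using \<psi>[OF w0_le[OF w(1)[OF 1]]] g' by (simp add: hom_in_carrier)
      ultimately show ?thesis
        using boundary_at[OF \<rho>] R.r_one v_le True wi v(2) by (simp add: face_term_def)
    next
      case False
      then have m: "vertex X \<rho> 0 = w 0" using face_min[of i] i vs(2) wi by simp
      have "s0 \<rho> = \<one>\<^bsub>F (vertex X \<rho> 0)\<^esub>" using False \<rho>_eq[of 0] \<rho> by (simp add: s0_def simplex_chain_def)
      moreover have gp: "?g [^]\<^bsub>F (w 0)\<^esub> ((- 1) ^ i :: int) \<in> carrier (F (vertex X \<rho> 0))"
        unfolding m by (rule group.int_pow_closed[OF grp g'])
      moreover have "finprod (F (vertex X \<rho> 0)) (\<lambda>j. s j \<rho>) {1..nat n}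
          = finprod (F (vertex X \<rho> 0)) (\<lambda>j. if i = j then ?g [^]\<^bsub>F (w 0)\<^esub> ((- 1) ^ i :: int) else \<one>\<^bsub>F (vertex X \<rho> 0)\<^esub>) {1..nat n}"
        using s_eq gp by (intro R.finprod_cong') auto
      moreover have "\<dots> = ?g [^]\<^bsub>F (w 0)\<^esub> ((- 1) ^ i :: int)"
        using gp False i by (intro R.finprod_singleton) auto
      ultimately show ?thesis
        using boundary_at[OF \<rho>] v_le False m v(2) R.l_one[OF gp] by (simp add: face_term_def sgn)
    qed
  qed
qed

text \<open>The definition runs over the simplices in the support of \<open>c\<close>; this form
  runs over the cofaces of each face, as \<open>bd\<close> does. Cofaces outside the support may be
  added because their face terms are trivial.\<close>

lemma chain_boundary_formula:
  assumes c: "c \<in> carrier (chain_group n X F)"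
  shows "chain_boundary n X F \<psi> c = (\<lambda>\<rho>\<in>Ch (n - 1) X.
    \<Otimes>\<^bsub>F (vertex X \<rho> 0)\<^esub>v\<in>{v. v \<notin> \<rho> \<and> insert v \<rho> \<in> simplices X}. face_term c \<rho> v)"
proof (cases "n < 1")
  case True
  then have "Ch (n - 1) X = {}" by (auto simp: Ch_def)
  then show ?thesis using True by (simp add: chain_boundary_def chain_group_def restrict_def)
next
  case False
  then have n: "1 \<le> n" by simp
  let ?G = "chain_group (n - 1) X F"
  let ?A = "{\<sigma> \<in> Ch n X. c \<sigma> \<noteq> \<one>\<^bsub>F (vertex X \<sigma> 0)\<^esub>}"
  let ?b = "\<lambda>\<sigma>. simplex_boundary n X F \<psi> (c \<sigma>) \<sigma>"
  interpret G: comm_group ?G by (rule comm_group_chain_group)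
  have c': "c \<sigma> \<in> carrier (F (vertex X \<sigma> 0))" if "\<sigma> \<in> Ch n X" for \<sigma>
    using c that by (auto simp: carrier_chain_group)
  have b: "?b \<in> ?A \<rightarrow> carrier ?G"
  proof
    fix \<sigma> assume "\<sigma> \<in> ?A"
    then have \<sigma>: "\<sigma> \<in> Ch n X" by simp
    show "?b \<sigma> \<in> carrier ?G" by (rule simplex_boundary_apply(1)[where c = c, OF n \<sigma> c'[OF \<sigma>]])
  qed
  have eq: "chain_boundary n X F \<psi> c = finprod ?G ?b ?A" using n by (simp add: chain_boundary_def)
  have ext: "finprod ?G ?b ?A \<in> extensional (Ch (n - 1) X)"
    using G.finprod_closed[OF b] by (auto simp: carrier_chain_group PiE_def)
  show ?thesis
  proof (rule extensionalityI[of _ "Ch (n - 1) X"])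
    show "chain_boundary n X F \<psi> c \<in> extensional (Ch (n - 1) X)" unfolding eq by (rule ext)
    fix \<rho> assume \<rho>: "\<rho> \<in> Ch (n - 1) X"
    let ?R = "F (vertex X \<rho> 0)" and ?V = "{v. v \<notin> \<rho> \<and> insert v \<rho> \<in> simplices X}"
    interpret R: comm_group ?R by (rule F_Ch[OF \<rho>])
    have \<rho>s: "\<rho> \<in> simplices X" and fin\<rho>: "finite \<rho>" and card\<rho>: "int (card \<rho>) = n"
      using \<rho> by (auto simp: Ch_iff simplices_def)
    have V: "insert v \<rho> \<in> Ch n X" if "v \<in> ?V" for v
      using that fin\<rho> card\<rho> by (simp add: Ch_iff)
    have ft: "face_term c \<rho> v \<in> carrier ?R" if "v \<in> ?V" for v
      using face_term_closed[OF c \<rho>s V[OF that]] that by simp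
    let ?I = "(\<lambda>v. insert v \<rho>) ` ?V"
    have finV: "finite ?V"
      by (rule finite_cofaces[OF simplex_family_simplices]) (use X fin in \<open>auto simp: partial_order_on_def\<close>)
    have b\<rho>: "?b \<sigma> \<rho> \<in> carrier ?R" if "\<sigma> \<in> Ch n X" for \<sigma>
      using simplex_boundary_apply(1)[where c = c, OF n that c'[OF that]] \<rho> by (auto simp: carrier_chain_group)
    have b_out: "?b \<sigma> \<rho> = \<one>\<^bsub>?R\<^esub>" if "\<sigma> \<in> Ch n X" "\<sigma> \<notin> ?I" for \<sigma>
    proof (rule simplex_boundary_apply(3)[where c = c, OF n that(1) c'[OF that(1)] \<rho>])
      fix v assume "v \<notin> \<rho>"
      then show "\<sigma> \<noteq> insert v \<rho>" using that by (auto simp: Ch_iff)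
    qed
    have b_in: "?b (insert v \<rho>) \<rho> = face_term c \<rho> v" if "v \<in> ?V" for v
      using simplex_boundary_apply(2)[where c = c, OF n V[OF that] c'[OF V[OF that]] \<rho>, of v] that by simp
    have b_one: "?b \<sigma> \<rho> = \<one>\<^bsub>?R\<^esub>" if "\<sigma> \<in> ?I" "\<sigma> \<notin> ?A" for \<sigma>
    proof -
      obtain v where v: "v \<in> ?V" "\<sigma> = insert v \<rho>" using \<open>\<sigma> \<in> ?I\<close> by blast
      then have 1: "c \<sigma> = \<one>\<^bsub>F (vertex X \<sigma> 0)\<^esub>" using V that(2) by blast
      have \<sigma>s: "\<sigma> \<in> simplices X" using v by simp
      have "face_term c \<rho> v = \<one>\<^bsub>?R\<^esub>"
      proof (cases "(v, vertex X \<rho> 0) \<in> X")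
        case True
        have "group (F v)" using F[of v] True by (auto simp: comm_group_def intro: FieldI1)
        then have "\<psi> v (vertex X \<rho> 0) \<one>\<^bsub>F v\<^esub> = \<one>\<^bsub>?R\<^esub>" by (rule hom_one[OF \<psi>[OF True] _ R.is_group])
        then show ?thesis using True 1 vertex_insert[OF \<rho>s, of v] v by (simp add: face_term_def)
      next
        case False
        then show ?thesis using 1 vertex_insert[OF \<rho>s, of v] v by (simp add: face_term_def)
      qed
      then show ?thesis using b_in[OF v(1)] v(2) by simp
    qed
    have "chain_boundary n X F \<psi> c \<rho> = (\<Otimes>\<^bsub>?R\<^esub>\<sigma>\<in>?A. ?b \<sigma> \<rho>)"
      unfolding eq using finprod_sum_group_apply[OF F_Ch _ \<rho>, where f = ?b and A = ?A] b
      by (simp add: chain_group_def)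
    also have "\<dots> = (\<Otimes>\<^bsub>?R\<^esub>\<sigma>\<in>?I. ?b \<sigma> \<rho>)"
      by (rule R.finprod_mono_neutral_cong)
        (use finV finite_Ch[OF fin] b\<rho> b_out b_one V in auto)
    also have "\<dots> = (\<Otimes>\<^bsub>?R\<^esub>v\<in>?V. ?b (insert v \<rho>) \<rho>)"
      by (rule R.finprod_reindex) (use b\<rho> V in \<open>auto simp: inj_on_def\<close>)
    also have "\<dots> = (\<Otimes>\<^bsub>?R\<^esub>v\<in>?V. face_term c \<rho> v)"
      by (rule R.finprod_cong') (use b_in ft in auto)
    finally show "chain_boundary n X F \<psi> c \<rho>
        = (\<lambda>\<rho>\<in>Ch (n - 1) X. \<Otimes>\<^bsub>F (vertex X \<rho> 0)\<^esub>v\<in>{v. v \<notin> \<rho> \<and> insert v \<rho> \<in> simplices X}. face_term c \<rho> v) \<rho>"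
      using \<rho> by simp
  qed simp
qed

end

section \<open>Integral homology of a finite poset\<close>

lemma face_sign_eq_1:
  assumes "Partial_order X" "\<rho> \<in> simplices X" "(v, vertex X \<rho> 0) \<in> X"
  shows "face_sign X v \<rho> = 1"
proof -
  have "(u, v) \<notin> X \<or> u = v" if "u \<in> \<rho>" for u
  proof -
    have "(v, u) \<in> X"
      by (rule Partial_orderD(2)[OF assms(1,3)]) (rule vertex_0(2)[OF assms(1,2) that])
    then show ?thesis using Partial_orderD(3)[OF assms(1), of u v] by blast
  qed
  then have "{u \<in> \<rho>. (u, v) \<in> X \<and> u \<noteq> v} = {}" by blast
  then show ?thesis unfolding face_sign_def by (simp only: card.empty power_0)
qed

lemma finprod_integer_group: "finprod integer_group f A = sum f A"
proof -
  interpret comm_group integer_group by (rule abelian_integer_group)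
  show ?thesis by (induction A rule: infinite_finite_induct) simp_all
qed

definition cycles :: "int \<Rightarrow> 'v rel \<Rightarrow> ('v set \<Rightarrow> int) set" where
  "cycles n X = {x \<in> chains_on (simplices X) n. bd X (simplices X) x = 0}"

text \<open>Elements of \<open>chain_group\<close> are undefined off \<open>Ch n X\<close>, members
  of \<open>chains_on\<close> are zero there; \<open>restrict\<close> is the bijection between the
  two conventions. Applied to \<open>cycles\<close>, this is the quotient map to homology.\<close>

definition homology_class :: "int \<Rightarrow> 'v rel \<Rightarrow> ('v set \<Rightarrow> int) \<Rightarrow> ('v set \<Rightarrow> int) set" where
  "homology_class n X x =
     (chain_boundary (n + 1) X const_Z const_Z_map ` carrier (chain_group (n + 1) X const_Z))
       #>\<^bsub>chain_group n X const_Z\<^esub> restrict x (Ch n X)"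

lemma chains_on_simplices_iff: "x \<in> chains_on (simplices X) n \<longleftrightarrow> (\<forall>\<sigma>. \<sigma> \<notin> Ch n X \<longrightarrow> x \<sigma> = 0)"
  by (auto simp: chains_on_def Ch_iff)

lemma cycles_subgroup: "additive_subgroup (cycles n X)"
  using additive_subgroupD[OF chains_on_subgroup[of "simplices X" n]]
  unfolding additive_subgroup_def cycles_def by (simp add: bd_diff)

context
  fixes X :: "'v rel"
  assumes X: "finite_poset X"
begin

lemma finite_poset_Partial_order: "Partial_order X" and finite_poset_finite_Field: "finite (Field X)"
  using X by (auto simp: finite_poset_def)

interpretation Z: coefficient_functor X const_Z const_Z_map
  by (rule coefficient_functor.intro) (use finite_poset_Partial_order finite_poset_finite_Field abelian_integer_group in \<open>auto simp: hom_def\<close>)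

lemma family_simplices: "simplex_family X (simplices X)"
  by (rule simplex_family_simplices) (use finite_poset_Partial_order finite_poset_finite_Field in \<open>auto simp: partial_order_on_def\<close>)

text \<open>For constant coefficients both branches of \<open>face_term\<close> are the signed
  coefficient, because a vertex below the minimum of \<open>\<rho>\<close> has sign +1.\<close>

lemma chain_boundary_integral:
  assumes x: "x \<in> chains_on (simplices X) n"
  shows "chain_boundary n X const_Z const_Z_map (restrict x (Ch n X))
    = restrict (bd X (simplices X) x) (Ch (n - 1) X)"
proof -
  have "restrict x (Ch n X) \<in> carrier (chain_group n X const_Z)"
    by (simp add: Z.carrier_chain_group)
  from Z.chain_boundary_formula[OF this]
  have "chain_boundary n X const_Z const_Z_map (restrict x (Ch n X)) = (\<lambda>\<rho>\<in>Ch (n - 1) X.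
      \<Sum>v\<in>{v. v \<notin> \<rho> \<and> insert v \<rho> \<in> simplices X}. Z.face_term (restrict x (Ch n X)) \<rho> v)"
    by (simp only: finprod_integer_group)
  also have "\<dots> = restrict (bd X (simplices X) x) (Ch (n - 1) X)"
  proof (rule restrict_ext)
    fix \<rho> assume \<rho>: "\<rho> \<in> Ch (n - 1) X"
    then have \<rho>s: "\<rho> \<in> simplices X" "finite \<rho>" by (auto simp: Ch_iff simplices_def)
    have "Z.face_term (restrict x (Ch n X)) \<rho> v = face_sign X v \<rho> * x (insert v \<rho>)"
      if "v \<in> {v. v \<notin> \<rho> \<and> insert v \<rho> \<in> simplices X}" for v
    proof -
      have "insert v \<rho> \<in> Ch n X" using that \<rho> \<rho>s by (simp add: Ch_iff)
      then show ?thesis using face_sign_eq_1[OF finite_poset_Partial_order \<rho>s(1)] by (simp add: Z.face_term_def)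
    qed
    then show "(\<Sum>v\<in>{v. v \<notin> \<rho> \<and> insert v \<rho> \<in> simplices X}. Z.face_term (restrict x (Ch n X)) \<rho> v)
        = bd X (simplices X) x \<rho>"
      using \<rho>s by (simp add: bd_def)
  qed
  finally show ?thesis .
qed

lemma carrier_chain_group_integral:
  "carrier (chain_group n X const_Z) = (\<lambda>x. restrict x (Ch n X)) ` chains_on (simplices X) n"
proof -
  have "c \<in> (\<lambda>x. restrict x (Ch n X)) ` chains_on (simplices X) n" if "c \<in> extensional (Ch n X)" for c
  proof (rule image_eqI)
    let ?x = "\<lambda>\<sigma>. if \<sigma> \<in> Ch n X then c \<sigma> else (0::int)"
    show "c = restrict ?x (Ch n X)" using that by (auto simp: extensional_def restrict_def)
    show "?x \<in> chains_on (simplices X) n" by (simp add: chains_on_simplices_iff)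
  qed
  then show ?thesis by (auto simp: Z.carrier_chain_group PiE_def)
qed

lemma restrict_chain_add:
  "restrict (x + y) (Ch n X) = restrict x (Ch n X) \<otimes>\<^bsub>chain_group n X const_Z\<^esub> restrict y (Ch n X)"
  by (auto simp: chain_group_def)

lemma restrict_chain_eq_one_iff:
  assumes "x \<in> chains_on (simplices X) n"
  shows "restrict x (Ch n X) = \<one>\<^bsub>chain_group n X const_Z\<^esub> \<longleftrightarrow> x = 0"
proof
  assume eq: "restrict x (Ch n X) = \<one>\<^bsub>chain_group n X const_Z\<^esub>"
  have "x \<sigma> = 0" for \<sigma>
    using assms fun_cong[OF eq, of \<sigma>] by (cases "\<sigma> \<in> Ch n X") (simp_all add: chain_group_def chains_on_simplices_iff)
  then show "x = 0" by (simp add: fun_eq_iff)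
qed (auto simp: chain_group_def)

lemma restrict_chain_hom:
  "(\<lambda>x. restrict x (Ch n X)) \<in> hom (additive_group (chains_on (simplices X) n)) (chain_group n X const_Z)"
  by (rule homI) (use carrier_chain_group_integral restrict_chain_add in auto)

lemma restrict_chain_inj:
  assumes "x \<in> chains_on (simplices X) n" "y \<in> chains_on (simplices X) n"
    "restrict x (Ch n X) = restrict y (Ch n X)"
  shows "x = y"
proof
  fix \<sigma> show "x \<sigma> = y \<sigma>"
  proof (cases "\<sigma> \<in> Ch n X")
    case True
    then show ?thesis using fun_cong[OF assms(3), of \<sigma>] by simp
  qed (use assms in \<open>simp add: chains_on_simplices_iff\<close>)
qed

lemma bd_simplices_closed: "x \<in> chains_on (simplices X) n \<Longrightarrow> bd X (simplices X) x \<in> chains_on (simplices X) (n - 1)"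
  by (rule bd_chains_on) auto

lemma chain_boundary_hom:
  "chain_boundary n X const_Z const_Z_map \<in> hom (chain_group n X const_Z) (chain_group (n - 1) X const_Z)"
proof (rule homI)
  fix c assume "c \<in> carrier (chain_group n X const_Z)"
  then obtain x where "x \<in> chains_on (simplices X) n" "c = restrict x (Ch n X)"
    by (auto simp: carrier_chain_group_integral)
  then show "chain_boundary n X const_Z const_Z_map c \<in> carrier (chain_group (n - 1) X const_Z)"
    using bd_simplices_closed by (simp add: chain_boundary_integral carrier_chain_group_integral)
next
  fix b c assume "b \<in> carrier (chain_group n X const_Z)" "c \<in> carrier (chain_group n X const_Z)"
  then obtain x y where xy: "x \<in> chains_on (simplices X) n" "b = restrict x (Ch n X)"
    "y \<in> chains_on (simplices X) n" "c = restrict y (Ch n X)"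
    by (auto simp: carrier_chain_group_integral)
  have "chain_boundary n X const_Z const_Z_map (restrict (x + y) (Ch n X))
      = restrict (bd X (simplices X) x + bd X (simplices X) y) (Ch (n - 1) X)"
    using chain_boundary_integral[OF additive_subgroupD(4)[OF chains_on_subgroup xy(1,3)]] by (simp only: bd_add)
  then show "chain_boundary n X const_Z const_Z_map (b \<otimes>\<^bsub>chain_group n X const_Z\<^esub> c)
      = chain_boundary n X const_Z const_Z_map b \<otimes>\<^bsub>chain_group (n - 1) X const_Z\<^esub> chain_boundary n X const_Z const_Z_map c"
    using xy by (simp only: restrict_chain_add chain_boundary_integral)
qed

lemma chain_boundary_squared:
  "\<forall>a\<in>carrier (chain_group (n + 1) X const_Z).
    chain_boundary n X const_Z const_Z_map (chain_boundary (n + 1) X const_Z const_Z_map a)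
      = \<one>\<^bsub>chain_group (n - 1) X const_Z\<^esub>"
proof
  fix a assume "a \<in> carrier (chain_group (n + 1) X const_Z)"
  then obtain x where x: "x \<in> chains_on (simplices X) (n + 1)" "a = restrict x (Ch (n + 1) X)"
    by (auto simp: carrier_chain_group_integral)
  have bx: "bd X (simplices X) x \<in> chains_on (simplices X) n" using bd_simplices_closed[OF x(1)] by simp
  show "chain_boundary n X const_Z const_Z_map (chain_boundary (n + 1) X const_Z const_Z_map a)
      = \<one>\<^bsub>chain_group (n - 1) X const_Z\<^esub>"
    using x(2) chain_boundary_integral[OF x(1)] chain_boundary_integral[OF bx]
    by (auto simp: bd_bd[OF family_simplices] chain_group_def)
qed

lemma integral_homology_facts:
  shows "group (chain_group (n + 1) X const_Z)" "comm_group (chain_group n X const_Z)"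
    "group (chain_group (n - 1) X const_Z)"
    "chain_boundary (n + 1) X const_Z const_Z_map \<in> hom (chain_group (n + 1) X const_Z) (chain_group n X const_Z)"
    "chain_boundary n X const_Z const_Z_map \<in> hom (chain_group n X const_Z) (chain_group (n - 1) X const_Z)"
  using Z.comm_group_chain_group chain_boundary_hom[of "n + 1"] chain_boundary_hom[of n]
  by (auto simp: comm_group_def)

lemmas homology_facts = integral_homology_facts chain_boundary_squared

lemma comm_group_integral_homology: "comm_group (integral_homology n X)"
  unfolding integral_homology_def poset_homology_def by (rule comm_group_homology_at[where f = "chain_boundary (n + 1) X const_Z const_Z_map" 
      and g = "chain_boundary n X const_Z const_Z_map", OF homology_facts])

lemma kernel_chain_boundary:
  "kernel (chain_group n X const_Z) (chain_group (n - 1) X const_Z) (chain_boundary n X const_Z const_Z_map)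
    = (\<lambda>x. restrict x (Ch n X)) ` cycles n X"
proof -
  have "chain_boundary n X const_Z const_Z_map (restrict x (Ch n X)) = \<one>\<^bsub>chain_group (n - 1) X const_Z\<^esub>
      \<longleftrightarrow> bd X (simplices X) x = 0" if "x \<in> chains_on (simplices X) n" for x
    using chain_boundary_integral[OF that] restrict_chain_eq_one_iff[OF bd_simplices_closed[OF that]] by simp
  then show ?thesis by (auto simp: kernel_def carrier_chain_group_integral cycles_def)
qed

lemma homology_class_hom: "homology_class n X \<in> hom (additive_group (cycles n X)) (integral_homology n X)"
proof -
  have "(\<lambda>x. restrict x (Ch n X)) \<in> hom (additive_group (cycles n X)) ((chain_group n X const_Z)
      \<lparr>carrier := kernel (chain_group n X const_Z) (chain_group (n - 1) X const_Z) (chain_boundary n X const_Z const_Z_map)\<rparr>)"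
    by (rule hom_additive_group_restrict[OF restrict_chain_hom]) (auto simp: cycles_def kernel_chain_boundary)
  from hom_compose[OF this homology_at_class_hom[where f = "chain_boundary (n + 1) X const_Z const_Z_map" 
      and g = "chain_boundary n X const_Z const_Z_map", OF homology_facts]] show ?thesis
    unfolding integral_homology_def poset_homology_def homology_class_def[abs_def] comp_def .
qed

lemma carrier_integral_homology: "carrier (integral_homology n X) = homology_class n X ` cycles n X"
  unfolding integral_homology_def poset_homology_def carrier_homology_at[where f = "chain_boundary (n + 1) X const_Z const_Z_map" 
      and g = "chain_boundary n X const_Z const_Z_map", OF homology_facts]
    kernel_chain_boundary homology_class_def[abs_def] image_image ..

lemma homology_class_eq_one_iff:
  assumes "x \<in> cycles n X"
  shows "homology_class n X x = \<one>\<^bsub>integral_homology n X\<^esub>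
    \<longleftrightarrow> x \<in> bd X (simplices X) ` chains_on (simplices X) (n + 1)"
proof -
  have x: "restrict x (Ch n X) \<in> kernel (chain_group n X const_Z) (chain_group (n - 1) X const_Z)
      (chain_boundary n X const_Z const_Z_map)"
    unfolding kernel_chain_boundary using assms by (rule imageI)
  have "homology_class n X x = \<one>\<^bsub>integral_homology n X\<^esub> \<longleftrightarrow>
      restrict x (Ch n X) \<in> chain_boundary (n + 1) X const_Z const_Z_map ` carrier (chain_group (n + 1) X const_Z)"
    unfolding integral_homology_def poset_homology_def homology_class_def
    by (rule homology_at_class_eq_one_iff[where f = "chain_boundary (n + 1) X const_Z const_Z_map" 
      and g = "chain_boundary n X const_Z const_Z_map", OF homology_facts x])
  also have "\<dots> \<longleftrightarrow> (\<exists>w\<in>chains_on (simplices X) (n + 1). restrict x (Ch n X) = restrict (bd X (simplices X) w) (Ch n X))"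
    using chain_boundary_integral[of _ "n + 1"]
    by (simp add: carrier_chain_group_integral image_image image_iff cong: bex_cong)
  also have "\<dots> \<longleftrightarrow> x \<in> bd X (simplices X) ` chains_on (simplices X) (n + 1)"
    using restrict_chain_inj[of x n] assms bd_simplices_closed[of _ "n + 1"] by (auto simp: cycles_def)
  finally show ?thesis .
qed

lemma homology_class_add:
  assumes "x \<in> cycles n X" "y \<in> cycles n X"
  shows "homology_class n X (x + y) = homology_class n X x \<otimes>\<^bsub>integral_homology n X\<^esub> homology_class n X y"
  using hom_mult[OF homology_class_hom, of x n y] assms by simp

lemma homology_class_closed: "x \<in> cycles n X \<Longrightarrow> homology_class n X x \<in> carrier (integral_homology n X)"
  by (simp add: carrier_integral_homology)

lemma homology_class_boundary_cong:
  assumes x: "x \<in> cycles n X" and y: "y \<in> cycles n X"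
  shows "homology_class n X x = homology_class n X y \<longleftrightarrow> x - y \<in> bd X (simplices X) ` chains_on (simplices X) (n + 1)"
proof -
  interpret H: comm_group "integral_homology n X" by (rule comm_group_integral_homology)
  have xy: "x - y \<in> cycles n X" by (rule additive_subgroupD(2)[OF cycles_subgroup x y])
  have "homology_class n X x = homology_class n X (x - y) \<otimes>\<^bsub>integral_homology n X\<^esub> homology_class n X y"
    using homology_class_add[OF xy y] by simp
  then show ?thesis
    using homology_class_eq_one_iff[OF xy] homology_class_closed[OF xy] homology_class_closed[OF y]
    by simp
qed

end

section \<open>Induced maps on integral homology\<close>

lemma push_cycles:
  assumes "finite_poset X" "finite_poset Y" "compat X Y f" "x \<in> cycles n X"
  shows "push f X x \<in> cycles n Y"
proof -
  have "push f X 0 = 0" by (simp add: push_def fun_eq_iff)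
  then show ?thesis
    using assms push_chains_on[OF assms(3)] by (auto simp: cycles_def bd_push finite_poset_def)
qed

lemma induced_chain_map_restrict:
  "induced_chain_map n X Y f (restrict x (Ch n X)) = restrict (push f X x) (Ch n Y)"
  unfolding induced_chain_map_def
proof (rule restrict_ext)
  fix \<tau> assume \<tau>: "\<tau> \<in> Ch n Y"
  have "{\<sigma>. \<sigma> \<in> Ch n X \<and> f ` \<sigma> = \<tau>} = {\<sigma>. \<sigma> \<in> simplices X \<and> f ` \<sigma> = \<tau> \<and> card \<sigma> = card \<tau>}"
    using \<tau> by (auto simp: Ch_iff)
  moreover have "(\<Sum>\<sigma> | \<sigma> \<in> Ch n X \<and> f ` \<sigma> = \<tau>. restrict x (Ch n X) \<sigma>) = (\<Sum>\<sigma> | \<sigma> \<in> Ch n X \<and> f ` \<sigma> = \<tau>. x \<sigma>)"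
    by (rule sum.cong) auto
  ultimately show "(\<Sum>\<sigma> | \<sigma> \<in> Ch n X \<and> f ` \<sigma> = \<tau>. restrict x (Ch n X) \<sigma>) = push f X x \<tau>"
    by (simp only: push_def)
qed

text \<open>Two representatives differ by a boundary, which \<open>push\<close> sends to a boundary;
  so the union in the definition consists of copies of one coset, over a nonempty index set.\<close>

lemma induced_homology_map_class:
  assumes X: "finite_poset X" and Y: "finite_poset Y" and f: "compat X Y f" and x: "x \<in> cycles n X"
  shows "induced_homology_map n X Y f (homology_class n X x) = homology_class n Y (push f X x)"
proof -
  have "{} \<noteq> homology_class n X x \<and> (\<forall>c\<in>homology_class n X x.
      (chain_boundary (n + 1) Y const_Z const_Z_map ` carrier (chain_group (n + 1) Y const_Z))
        #>\<^bsub>chain_group n Y const_Z\<^esub> induced_chain_map n X Y f c = homology_class n Y (push f X x))"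
  proof
    have "0 \<in> chains_on (simplices X) (n + 1)" by (rule additive_subgroupD(1)[OF chains_on_subgroup])
    then have "carrier (chain_group (n + 1) X const_Z) \<noteq> {}" by (auto simp: carrier_chain_group_integral[OF X])
    then show "{} \<noteq> homology_class n X x" by (auto simp: homology_class_def r_coset_def)
    show "\<forall>c\<in>homology_class n X x.
      (chain_boundary (n + 1) Y const_Z const_Z_map ` carrier (chain_group (n + 1) Y const_Z))
        #>\<^bsub>chain_group n Y const_Z\<^esub> induced_chain_map n X Y f c = homology_class n Y (push f X x)"
    proof
      fix c assume "c \<in> homology_class n X x"
      then obtain w where w: "w \<in> chains_on (simplices X) (n + 1)"
        "c = chain_boundary (n + 1) X const_Z const_Z_map (restrict w (Ch (n + 1) X))
          \<otimes>\<^bsub>chain_group n X const_Z\<^esub> restrict x (Ch n X)"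
        by (auto simp: homology_class_def r_coset_def carrier_chain_group_integral[OF X])
      have bw: "bd X (simplices X) w \<in> cycles n X"
        using bd_simplices_closed[OF X w(1)] by (simp add: cycles_def bd_bd[OF family_simplices[OF X]])
      have "c = restrict (bd X (simplices X) w + x) (Ch n X)"
        using w(2) chain_boundary_integral[OF X w(1)] by (simp add: restrict_chain_add[OF X])
      then have "(chain_boundary (n + 1) Y const_Z const_Z_map ` carrier (chain_group (n + 1) Y const_Z))
          #>\<^bsub>chain_group n Y const_Z\<^esub> induced_chain_map n X Y f c
          = homology_class n Y (push f X (bd X (simplices X) w + x))"
        by (simp only: induced_chain_map_restrict homology_class_def)
      also have "\<dots> = homology_class n Y (push f X x)"
      proof -
        have "push f X (bd X (simplices X) w + x) - push f X x = bd Y (simplices Y) (push f X w)"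
          using X Y f by (simp add: push_add bd_push finite_poset_def)
        moreover have "push f X w \<in> chains_on (simplices Y) (n + 1)" by (rule push_chains_on[OF f w(1)])
        ultimately show ?thesis
          using additive_subgroupD(4)[OF cycles_subgroup bw x]
          by (subst homology_class_boundary_cong[OF Y]) (auto intro: push_cycles[OF X Y f] x)
      qed
      finally show "(chain_boundary (n + 1) Y const_Z const_Z_map ` carrier (chain_group (n + 1) Y const_Z))
          #>\<^bsub>chain_group n Y const_Z\<^esub> induced_chain_map n X Y f c = homology_class n Y (push f X x)" .
    qed
  qed
  then show ?thesis unfolding induced_homology_map_def by blast
qed

lemma induced_homology_map_hom:
  assumes "finite_poset X" "finite_poset Y" "compat X Y f"
  shows "induced_homology_map n X Y f \<in> hom (integral_homology n X) (integral_homology n Y)"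
proof (rule homI)
  fix a assume "a \<in> carrier (integral_homology n X)"
  then obtain x where "x \<in> cycles n X" "a = homology_class n X x"
    by (auto simp: carrier_integral_homology[OF assms(1)])
  then show "induced_homology_map n X Y f a \<in> carrier (integral_homology n Y)"
    by (simp add: induced_homology_map_class[OF assms] homology_class_closed[OF assms(2)] push_cycles[OF assms])
next
  fix a b assume "a \<in> carrier (integral_homology n X)" "b \<in> carrier (integral_homology n X)"
  then obtain x y where "x \<in> cycles n X" "a = homology_class n X x" "y \<in> cycles n X" "b = homology_class n X y"
    by (auto simp: carrier_integral_homology[OF assms(1)])
  then show "induced_homology_map n X Y f (a \<otimes>\<^bsub>integral_homology n X\<^esub> b)
      = induced_homology_map n X Y f a \<otimes>\<^bsub>integral_homology n Y\<^esub> induced_homology_map n X Y f b"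
    by (simp add: induced_homology_map_class[OF assms] homology_class_add[OF assms(1), symmetric]
        homology_class_add[OF assms(2), symmetric] push_cycles[OF assms] push_add
        additive_subgroupD(4)[OF cycles_subgroup])
qed

section \<open>Diagrams of finite posets\<close>

text \<open>One chain may be viewed in two posets; only the images of the simplices in its support
  matter. Used to compare retractions of nested lower sets.\<close>

lemma push_restrict:
  assumes "\<And>\<sigma>. x \<sigma> \<noteq> 0 \<Longrightarrow> \<sigma> \<in> simplices X \<and> \<sigma> \<in> simplices Y \<and> f ` \<sigma> = g ` \<sigma>"
    and "finite (Field X)" "finite (Field Y)"
  shows "push f X x = push g Y x"
proof
  fix \<tau>
  let ?I = "{\<sigma>. \<sigma> \<in> simplices X \<and> \<sigma> \<in> simplices Y \<and> f ` \<sigma> = g ` \<sigma> \<and> f ` \<sigma> = \<tau> \<and> card \<sigma> = card \<tau>}"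
  have "push f X x \<tau> = sum x ?I"
    unfolding push_def using assms(1)
    by (intro sum.mono_neutral_right) (auto intro: finite_subset[OF _ finite_simplices[OF assms(2)]])
  moreover have "push g Y x \<tau> = sum x ?I"
    unfolding push_def using assms(1)
    by (intro sum.mono_neutral_right) (auto intro: finite_subset[OF _ finite_simplices[OF assms(3)]])
  ultimately show "push f X x \<tau> = push g Y x \<tau>" by simp
qed

lemma push_of_identity:
  assumes x: "x \<in> chains_on (simplices X) n" and f: "\<And>v. v \<in> Field X \<Longrightarrow> f v = v" and fin: "finite (Field X)"
  shows "push f X x = x"
proof
  fix \<tau>
  have img: "f ` \<sigma> = \<sigma>" if "\<sigma> \<in> simplices X" for \<sigma>
  proof -
    have "v \<in> Field X" if "v \<in> \<sigma>" for v
      using \<open>\<sigma> \<in> simplices X\<close> that by (auto simp: simplices_def Chains_def intro: FieldI1)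
    then show ?thesis using f by simp
  qed
  have "{\<sigma>. \<sigma> \<in> simplices X \<and> f ` \<sigma> = \<tau> \<and> card \<sigma> = card \<tau>} = (if \<tau> \<in> simplices X then {\<tau>} else {})"
    using img by auto
  then show "push f X x \<tau> = x \<tau>"
    unfolding push_def using x by (auto simp: chains_on_def)
qed

lemma push_scale: "push f X (\<lambda>\<sigma>. k * x \<sigma>) = (\<lambda>\<tau>. k * push f X x \<tau>)"
  by (simp add: push_def sum_distrib_left fun_eq_iff)

lemma push_zero: "push f X 0 = 0"
  by (simp add: push_def fun_eq_iff)

lemma push_sum: "push f X (\<Sum>t\<in>T. g t) = (\<Sum>t\<in>T. push f X (g t))"
  by (induction T rule: infinite_finite_induct) (simp_all only: sum.infinite sum.empty sum.insert push_add push_zero not_False_eq_True)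

lemma push_minus: "push f X (- x) = - push f X x"
  using push_add[of f X x "- x"] by (simp add: push_zero eq_neg_iff_add_eq_0 add.commute)

lemma push_diff: "push f X (x - y) = push f X x - push f X y"
  using push_add[of f X x "- y"] by (simp add: push_minus)

lemma bd_scale: "bd S K (\<lambda>\<sigma>. k * x \<sigma>) = (\<lambda>\<rho>. k * bd S K x \<rho>)"
  by (auto simp: bd_def fun_eq_iff sum_distrib_left intro!: sum.cong)

lemma chains_on_scale: "x \<in> chains_on K n \<Longrightarrow> (\<lambda>\<sigma>. k * x \<sigma>) \<in> chains_on K n"
  by (simp add: chains_on_def)

lemma additive_subgroup_sum:
  assumes "additive_subgroup A" "\<And>t. t \<in> T \<Longrightarrow> g t \<in> A"
  shows "(\<Sum>t\<in>T. g t) \<in> A"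
  using assms(2)
  by (induction T rule: infinite_finite_induct) (auto intro: additive_subgroupD[OF assms(1)])

lemma homology_class_zero:
  assumes X: "finite_poset X" shows "homology_class n X 0 = \<one>\<^bsub>integral_homology n X\<^esub>"
  using hom_one[OF homology_class_hom[OF X, of n]] comm_group_additive_group[OF cycles_subgroup]
    comm_group_integral_homology[OF X] by (auto simp: comm_group_def)

lemma homology_class_sum:
  assumes X: "finite_poset X" and g: "\<And>t. t \<in> T \<Longrightarrow> g t \<in> cycles n X"
  shows "homology_class n X (\<Sum>t\<in>T. g t) = (\<Otimes>\<^bsub>integral_homology n X\<^esub>t\<in>T. homology_class n X (g t))"
proof -
  interpret H: comm_group "integral_homology n X" by (rule comm_group_integral_homology[OF X])
  show ?thesis
    using g
  proof (induction T rule: infinite_finite_induct)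
    case (insert t T)
    have "(\<lambda>t. homology_class n X (g t)) \<in> T \<rightarrow> carrier (integral_homology n X)"
      "homology_class n X (g t) \<in> carrier (integral_homology n X)"
      using insert.prems by (auto intro: homology_class_closed[OF X])
    moreover have "homology_class n X (g t + sum g T)
        = homology_class n X (g t) \<otimes>\<^bsub>integral_homology n X\<^esub> homology_class n X (sum g T)"
      using insert.prems by (intro homology_class_add[OF X] additive_subgroup_sum[OF cycles_subgroup]) auto
    ultimately show ?case
      using insert by (simp only: sum.insert[OF insert.hyps]) simp
  qed (simp_all add: homology_class_zero[OF X])
qed

lemma homology_class_sign:
  assumes X: "finite_poset X" and x: "x \<in> cycles n X" and k: "k = 1 \<or> k = - 1"
  shows "homology_class n X (\<lambda>\<sigma>. k * x \<sigma>) = homology_class n X x [^]\<^bsub>integral_homology n X\<^esub> (k :: int)"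
proof -
  interpret H: comm_group "integral_homology n X" by (rule comm_group_integral_homology[OF X])
  have c: "homology_class n X x \<in> carrier (integral_homology n X)" by (rule homology_class_closed[OF X x])
  show ?thesis
  proof (cases "k = 1")
    case True
    then show ?thesis using c by (simp add: H.int_pow_1)
  next
    case False
    then have k: "k = - 1" using k by simp
    have mx: "- x \<in> cycles n X" by (rule additive_subgroupD(3)[OF cycles_subgroup x])
    have "homology_class n X (- x) \<otimes>\<^bsub>integral_homology n X\<^esub> homology_class n X x
        = homology_class n X (- x + x)"
      by (rule homology_class_add[OF X mx x, symmetric])
    also have "\<dots> = \<one>\<^bsub>integral_homology n X\<^esub>"
      using homology_class_zero[OF X] by simp
    finally have "inv\<^bsub>integral_homology n X\<^esub> homology_class n X x = homology_class n X (- x)"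
      using H.inv_equality c homology_class_closed[OF X mx] by blast
    moreover have "(\<lambda>\<sigma>. k * x \<sigma>) = - x" by (simp add: k fun_eq_iff)
    ultimately show ?thesis using c by (simp add: k H.int_pow_neg H.int_pow_1)
  qed
qed

lemma face_sign_cases: "face_sign S v \<rho> = 1 \<or> face_sign S v \<rho> = - 1"
  unfolding face_sign_def using neg_one_even_power neg_one_odd_power by blast

section \<open>Lower sets of the homotopy colimit and their retractions to fibres\<close>

locale finite_poset_diagram = finite_poset_functor P D \<phi>
  for P :: "'a rel" and D :: "'a \<Rightarrow> 'b rel" and \<phi> :: "'a \<Rightarrow> 'a \<Rightarrow> 'b \<Rightarrow> 'b" +
  assumes P: "finite_poset P"
begin

abbreviation Z :: "('a \<times> 'b) rel" where "Z \<equiv> hocolim P D \<phi>"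

lemma PO_P: "Partial_order P" and fin_P: "finite (Field P)"
  using P by (auto simp: finite_poset_def)

lemmas P_refl = Partial_orderD(1)[OF PO_P]
  and P_trans = Partial_orderD(2)[OF PO_P]
  and P_antisym = Partial_orderD(3)[OF PO_P]

lemma finite_poset_Z: "finite_poset Z"
  by (rule finite_poset_hocolim(2)[OF P finite_poset_functor_axioms])

lemma PO_Z: "Partial_order Z" and fin_Z: "finite (Field Z)"
  using finite_poset_Z by (auto simp: finite_poset_def)

lemma Field_Z: "Field Z = Sigma (Field P) (\<lambda>p. Field (D p))"
  by (rule finite_poset_hocolim(1)[OF P finite_poset_functor_axioms])

lemma PO_D: "p \<in> Field P \<Longrightarrow> Partial_order (D p)" and fin_D: "p \<in> Field P \<Longrightarrow> finite (Field (D p))"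
  using finite_poset_obj by (auto simp: finite_poset_def)

lemma Z_iff: "(z, z') \<in> Z \<longleftrightarrow> (fst z, fst z') \<in> P \<and> snd z \<in> Field (D (fst z)) \<and> snd z' \<in> Field (D (fst z')) \<and>
    (\<phi> (fst z) (fst z') (snd z), snd z') \<in> D (fst z')"
  by (auto simp: hocolim_def split: prod.splits)

lemma \<phi>_Field: "(p, q) \<in> P \<Longrightarrow> x \<in> Field (D p) \<Longrightarrow> \<phi> p q x \<in> Field (D q)"
  using order_preserving[of p q] PO_D[of p] Partial_orderD(1)[of "D p" x] FieldI1[of p q P]
  by (auto simp: compat_def intro: FieldI1)

text \<open>The part of the homotopy colimit over the elements of \<open>P\<close> up to
  \<open>m\<close>. Bounding the larger endpoint suffices, since first components are
  monotone.\<close>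

definition below :: "'a \<Rightarrow> ('a \<times> 'b) rel" where
  "below m = {(z, z') \<in> Z. (fst z', m) \<in> P}"

definition retract :: "'a \<Rightarrow> 'a \<times> 'b \<Rightarrow> 'b" where
  "retract m z = \<phi> (fst z) m (snd z)"

lemma below_iff: "(z, z') \<in> below m \<longleftrightarrow> (z, z') \<in> Z \<and> (fst z', m) \<in> P"
  by (auto simp: below_def)

lemma below_fst: "(z, z') \<in> below m \<Longrightarrow> (fst z, m) \<in> P"
  using P_trans[of "fst z" "fst z'" m] by (simp add: below_iff Z_iff)

lemma Field_below: "Field (below m) = {z \<in> Field Z. (fst z, m) \<in> P}"
proof (intro equalityI subsetI)
  fix z assume "z \<in> Field (below m)"
  then have "\<exists>z'. (z, z') \<in> below m \<or> (z', z) \<in> below m" by (auto simp: Field_def)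
  then obtain z' where "(z, z') \<in> below m \<or> (z', z) \<in> below m" ..
  then have "z \<in> Field Z" "(fst z, m) \<in> P"
    using below_fst[of z z' m] by (auto simp only: below_iff intro: FieldI1 FieldI2)
  then show "z \<in> {z \<in> Field Z. (fst z, m) \<in> P}" by simp
next
  fix z assume "z \<in> {z \<in> Field Z. (fst z, m) \<in> P}"
  then have "(z, z) \<in> below m" using Partial_orderD(1)[OF PO_Z] by (simp add: below_iff)
  then show "z \<in> Field (below m)" by (rule FieldI1)
qed

lemma finite_poset_below: "finite_poset (below m)"
proof -
  have "refl_on (Field (below m)) (below m)"
    unfolding Field_below using Partial_orderD(1)[OF PO_Z] by (auto simp: refl_on_def below_iff)
  moreover have "trans (below m)"
    by (rule transI) (auto simp: below_iff intro: Partial_orderD(2)[OF PO_Z])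
  moreover have "antisym (below m)"
  proof (rule antisymI)
    fix z z' assume "(z, z') \<in> below m" "(z', z) \<in> below m"
    then show "z = z'" using Partial_orderD(3)[OF PO_Z, of z z'] by (simp only: below_iff)
  qed
  moreover have "below m \<subseteq> Field (below m) \<times> Field (below m)" by (auto intro: FieldI1 FieldI2)
  moreover have "finite (Field (below m))" using fin_Z by (simp add: Field_below)
  ultimately show ?thesis by (simp add: finite_poset_def partial_order_on_def preorder_on_def)
qed

lemma PO_below: "Partial_order (below m)" and fin_below: "finite (Field (below m))"
  using finite_poset_below by (auto simp: finite_poset_def)

lemma simplices_below_iff: "s \<in> simplices (below m) \<longleftrightarrow> s \<in> simplices Z \<and> (\<forall>z\<in>s. (fst z, m) \<in> P)"
proof
  assume "s \<in> simplices (below m)"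
  then have s: "finite s" "s \<noteq> {}" "\<And>u v. u \<in> s \<Longrightarrow> v \<in> s \<Longrightarrow> (u, v) \<in> below m \<or> (v, u) \<in> below m"
    by (auto simp: simplices_def Chains_def)
  have "(z, z) \<in> below m" if "z \<in> s" for z using s(3)[OF that that] by simp
  then show "s \<in> simplices Z \<and> (\<forall>z\<in>s. (fst z, m) \<in> P)"
    using s by (auto simp: simplices_def Chains_def below_iff)
qed (auto simp: simplices_def Chains_def below_iff)

lemma compat_retract: "m \<in> Field P \<Longrightarrow> compat (below m) (D m) (retract m)"
  unfolding compat_def
proof (intro allI impI)
  fix z z' assume "(z, z') \<in> below m"
  then have *: "(fst z, fst z') \<in> P" "(fst z', m) \<in> P" "snd z \<in> Field (D (fst z))"
    "(\<phi> (fst z) (fst z') (snd z), snd z') \<in> D (fst z')" by (auto simp: below_iff Z_iff)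
  have "(\<phi> (fst z') m (\<phi> (fst z) (fst z') (snd z)), \<phi> (fst z') m (snd z')) \<in> D m"
    using order_preserving[OF *(2)] *(4) by (auto simp: compat_def)
  then show "(retract m z, retract m z') \<in> D m"
    using map_comp[OF *(1-3)] by (simp add: retract_def)
qed

lemma compat_Pair: "m \<in> Field P \<Longrightarrow> compat (D m) (below m) (Pair m)"
  by (auto simp: compat_def below_iff Z_iff P_refl map_id intro: FieldI1 FieldI2) (metis FieldI1 map_id)

lemma retract_Pair: "m \<in> Field P \<Longrightarrow> v \<in> Field (D m) \<Longrightarrow> (retract m \<circ> Pair m) v = v"
  by (simp add: retract_def map_id)

lemma retract_retract:
  assumes "(t, m) \<in> P" "z \<in> Field (below t)" shows "\<phi> t m (retract t z) = retract m z"
  using assms map_comp[of "fst z" t m "snd z"] by (auto simp: Field_below Field_Z retract_def)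

text \<open>\<open>retract m\<close> is left inverse to the inclusion of the fibre already on
  chains, hence surjective on homology; injectivity is where acyclicity enters.\<close>

lemma push_retract_Pair:
  assumes m: "m \<in> Field P" and c: "c \<in> chains_on (simplices (D m)) n"
  shows "push (retract m) (below m) (push (Pair m) (D m) c) = c"
  using push_push[OF compat_Pair[OF m] fin_D[OF m] fin_below, of "retract m" c]
    push_of_identity[OF c retract_Pair[OF m] fin_D[OF m]] by simp

text \<open>\<open>L\<close> is the part strictly below \<open>m\<close> and its complement the
  fibre over \<open>m\<close>. By the order of the homotopy colimit, a fibre element is above
  \<open>z\<close> iff its second component is above \<open>retract m z\<close>.\<close>

lemma upper_retraction_below:
  assumes m: "m \<in> Field P"
  shows "upper_retraction (below m) (below m) {z. fst z \<noteq> m} (\<lambda>z. (m, retract m z))"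
proof
  show "Partial_order (below m)" "finite (Field (below m))" by (rule PO_below fin_below)+
  show "antisym (below m)" using PO_below by (simp add: partial_order_on_def)
  show "u \<in> {z. fst z \<noteq> m}" if "(u, l) \<in> below m" "l \<in> {z. fst z \<noteq> m}" for u l
    using that P_antisym[of m "fst l"] by (auto simp: below_iff Z_iff)
  show "(m, retract m l) \<notin> {z. fst z \<noteq> m} \<and> (l, (m, retract m l)) \<in> below m"
    if "l \<in> {z. fst z \<noteq> m}" "l \<in> Field (below m)" for l
  proof -
    have "(fst l, m) \<in> P" "snd l \<in> Field (D (fst l))" using that by (auto simp: Field_below Field_Z)
    then have "retract m l \<in> Field (D m)" unfolding retract_def by (rule \<phi>_Field)
    then show ?thesis
      using \<open>(fst l, m) \<in> P\<close> \<open>snd l \<in> _\<close> Partial_orderD(1)[OF PO_D[OF m]] P_refl[OF m]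
      by (simp add: below_iff Z_iff retract_def)
  qed
  show "((m, retract m l), u) \<in> below m"
    if "l \<in> {z. fst z \<noteq> m}" "(l, u) \<in> below m" "u \<notin> {z. fst z \<noteq> m}" for l u
  proof -
    have *: "fst u = m" "(fst l, m) \<in> P" "snd l \<in> Field (D (fst l))" "snd u \<in> Field (D m)"
      "(retract m l, snd u) \<in> D m" using that by (auto simp: below_iff Z_iff retract_def)
    have "retract m l \<in> Field (D m)" unfolding retract_def by (rule \<phi>_Field[OF *(2,3)])
    then show ?thesis using * P_refl[OF m] map_id[OF m] by (simp add: below_iff Z_iff)
  qed
qed simp

lemma supported_on_fibre:
  assumes m: "m \<in> Field P" and y: "y \<in> chains_on (simplices (below m)) n"
    and fib: "\<And>\<sigma> z. y \<sigma> \<noteq> 0 \<Longrightarrow> z \<in> \<sigma> \<Longrightarrow> fst z = m"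
  shows "\<exists>c\<in>chains_on (simplices (D m)) n. y = push (Pair m) (D m) c"
proof
  define c where "c s = (if s \<in> simplices (D m) then y (Pair m ` s) else 0)" for s
  have inj: "inj (Pair m)" by (simp add: inj_on_def)
  have card: "card (Pair m ` s) = card s" for s :: "'b set" by (rule card_image[OF inj_on_subset[OF inj]]) simp
  show "c \<in> chains_on (simplices (D m)) n"
    unfolding chains_on_def
  proof (intro CollectI allI impI)
    fix s assume "c s \<noteq> 0"
    then have "s \<in> simplices (D m)" "y (Pair m ` s) \<noteq> 0" by (auto simp: c_def split: if_splits)
    then show "s \<in> simplices (D m) \<and> int (card s) = n + 1" using y card by (auto simp: chains_on_def)
  qed
  show "y = push (Pair m) (D m) c"
  proof
    fix \<sigma>
    show "y \<sigma> = push (Pair m) (D m) c \<sigma>"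
    proof (cases "\<exists>s\<in>simplices (D m). \<sigma> = Pair m ` s")
      case True
      then obtain s where s: "s \<in> simplices (D m)" "\<sigma> = Pair m ` s" by blast
      have "{s'. s' \<in> simplices (D m) \<and> Pair m ` s' = \<sigma> \<and> card s' = card \<sigma>} = {s}"
        unfolding s(2) inj_image_eq_iff[OF inj] card using s(1) by auto
      then show ?thesis using s by (simp add: push_def c_def)
    next
      case False
      have "y \<sigma> = 0"
      proof (rule ccontr)
        assume y0: "y \<sigma> \<noteq> 0"
        then have \<sigma>: "\<sigma> \<in> simplices (below m)" using y by (auto simp: chains_on_def)
        have fst: "fst z = m" if "z \<in> \<sigma>" for z using fib[OF y0 that] .
        have "\<sigma> = Pair m ` (snd ` \<sigma>)" using fst by (force simp: image_iff)
        moreover have "snd ` \<sigma> \<in> simplices (D m)"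
        proof -
          have "retract m z = snd z" if "z \<in> \<sigma>" for z
          proof -
            have "z \<in> Field (below m)" using \<sigma> that by (auto simp: simplices_def Chains_def intro: FieldI1)
            then show ?thesis using fst[OF that] map_id[OF m] by (auto simp: Field_below Field_Z retract_def)
          qed
          then have "retract m ` \<sigma> = snd ` \<sigma>" by (rule image_cong[OF refl])
          then show ?thesis using compat_simplices[OF compat_retract[OF m] \<sigma>] by simp
        qed
        ultimately show False using False by blast
      qed
      moreover have E: "{s'. s' \<in> simplices (D m) \<and> Pair m ` s' = \<sigma> \<and> card s' = card \<sigma>} = {}"
        using False by blast
      ultimately show ?thesis unfolding push_def E by simp
    qed
  qed
qed

text \<open>By acyclicity \<open>y\<close> can be changed by a boundary so that it lives on the
  fibre over \<open>m\<close>. There retraction and inclusion are mutually inverse, so a bounding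
  chain for the retraction gives one for the rest of \<open>y\<close>.\<close>

lemma retract_injective_on_homology:
  assumes m: "m \<in> Field P" and y: "y \<in> cycles n (below m)"
    and b: "push (retract m) (below m) y \<in> bd (D m) (simplices (D m)) ` chains_on (simplices (D m)) (n + 1)"
  shows "y \<in> bd (below m) (simplices (below m)) ` chains_on (simplices (below m)) (n + 1)"
proof -
  let ?X = "below m" and ?S = "simplices (below m)"
  interpret U: upper_retraction ?X ?X "{z. fst z \<noteq> m}" "\<lambda>z. (m, retract m z)"
    by (rule upper_retraction_below[OF m])
  have y': "y \<in> chains_on ?S n" "bd ?X ?S y = 0" using y by (auto simp: cycles_def)
  have KS: "\<rho> \<in> U.K \<Longrightarrow> insert v \<rho> \<in> U.K \<longleftrightarrow> insert v \<rho> \<in> ?S" for \<rho> v by (auto simp: U.K_def)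
  have bdK: "bd ?X U.K x \<rho> = bd ?X ?S x \<rho>" if "\<rho> \<in> U.K" for x \<rho>
    using that KS[OF that] by (simp add: bd_def) (simp add: U.K_def)
  \<comment> \<open>The part of \<open>y\<close> on simplices that leave the fibre. It is a relative
    cycle, because all cofaces of such simplices leave the fibre too.\<close>
  define yL where "yL \<sigma> = (if \<sigma> \<in> U.K then y \<sigma> else 0)" for \<sigma>
  have yL: "yL \<in> chains_on U.K n" using y'(1) by (auto simp: chains_on_def yL_def)
  have "bd ?X U.K yL = 0"
  proof
    fix \<rho>
    show "bd ?X U.K yL \<rho> = 0 \<rho>"
    proof (cases "\<rho> \<in> U.K")
      case True
      have "bd ?X U.K yL \<rho> = bd ?X U.K y \<rho>" by (rule bd_eqI) (simp add: yL_def)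
      then show ?thesis using bdK[OF True, of y] y'(2) by simp
    qed (simp add: bd_def)
  qed
  then obtain w where w: "w \<in> chains_on U.K (n + 1)" "bd ?X U.K w = yL" using U.acyclic[OF yL] by blast
  have wS: "w \<in> chains_on ?S (n + 1)" using w(1) by (auto simp: chains_on_def U.K_def)
  define y1 where "y1 = y - bd ?X ?S w"
  have bwS: "bd ?X ?S w \<in> chains_on ?S n" using bd_simplices_closed[OF finite_poset_below wS] by simp
  have y1: "y1 \<in> chains_on ?S n"
    unfolding y1_def by (rule additive_subgroupD(2)[OF chains_on_subgroup y'(1) bwS])
  have fib: "fst z = m" if "y1 \<sigma> \<noteq> 0" "z \<in> \<sigma>" for \<sigma> z
  proof (rule ccontr)
    assume "fst z \<noteq> m"
    moreover have "\<sigma> \<in> ?S" using y1 that(1) by (auto simp: chains_on_def)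
    ultimately have K: "\<sigma> \<in> U.K" using that(2) by (auto simp: U.K_def)
    have "bd ?X ?S w \<sigma> = y \<sigma>" using bdK[OF K, of w] w(2) K by (simp add: yL_def)
    then show False using that(1) by (simp add: y1_def)
  qed
  have "\<exists>c\<in>chains_on (simplices (D m)) n. y1 = push (Pair m) (D m) c"
    by (rule supported_on_fibre[OF m y1]) (rule fib)
  then obtain c where c: "c \<in> chains_on (simplices (D m)) n" "y1 = push (Pair m) (D m) c" by blast
  obtain c' where c': "c' \<in> chains_on (simplices (D m)) (n + 1)"
    "push (retract m) ?X y = bd (D m) (simplices (D m)) c'" using b by blast
  \<comment> \<open>Retracting \<open>y1\<close>, which is \<open>y\<close> minus the boundary of
    \<open>w\<close>, exhibits \<open>c\<close> as the boundary of this chain.\<close>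
  let ?e = "c' - push (retract m) ?X w"
  have e: "?e \<in> chains_on (simplices (D m)) (n + 1)"
    by (rule additive_subgroupD(2)[OF chains_on_subgroup c'(1) push_chains_on[OF compat_retract[OF m] wS]])
  have "c = push (retract m) ?X y1"
    unfolding c(2) by (rule push_retract_Pair[OF m c(1), symmetric])
  also have "\<dots> = bd (D m) (simplices (D m)) ?e"
    unfolding y1_def push_diff bd_diff c'(2) bd_push[OF PO_below PO_D[OF m] compat_retract[OF m] fin_below fin_D[OF m]] ..
  finally have "y1 = bd ?X ?S (push (Pair m) (D m) ?e)"
    unfolding c(2) bd_push[OF PO_D[OF m] PO_below compat_Pair[OF m] fin_D[OF m] fin_below] by simp
  then have "y = bd ?X ?S (push (Pair m) (D m) ?e + w)"
    unfolding bd_add y1_def by (simp add: algebra_simps)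
  moreover have "push (Pair m) (D m) ?e + w \<in> chains_on ?S (n + 1)"
    by (rule additive_subgroupD(4)[OF chains_on_subgroup push_chains_on[OF compat_Pair[OF m] e] wS])
  ultimately show ?thesis by blast
qed

end

section \<open>The mapping cylinder of the projection to \<open>P\<close>\<close>

lemma insert_Plus: "insert (Inl z) (s <+> \<tau>) = insert z s <+> \<tau>" "insert (Inr t) (s <+> \<tau>) = s <+> insert t \<tau>"
  by auto

lemma Plus_vimage: "(Inl -` \<sigma>) <+> (Inr -` \<sigma>) = \<sigma>"
proof (rule Set.set_eqI)
  fix u show "u \<in> (Inl -` \<sigma>) <+> (Inr -` \<sigma>) \<longleftrightarrow> u \<in> \<sigma>" by (cases u) auto
qed

lemma vimage_Plus [simp]: "Inl -` (s <+> \<tau>) = s" "Inr -` (s <+> \<tau>) = \<tau>"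
  by auto

context finite_poset_diagram
begin

definition M :: "(('a \<times> 'b) + 'a) rel" where
  "M = {(u, v). case u of
      Inl z \<Rightarrow> (case v of Inl z' \<Rightarrow> (z, z') \<in> Z | Inr t \<Rightarrow> z \<in> Field Z \<and> (fst z, t) \<in> P)
    | Inr t \<Rightarrow> (case v of Inl z \<Rightarrow> False | Inr t' \<Rightarrow> (t, t') \<in> P)}"

text \<open>
  Signs are computed as if \<open>P\<close> came first, so that deleting elements of \<open>P\<close> produces exactly the
  signs of \<^const>\<open>chain_boundary\<close> on \<open>P\<close>.
\<close>

definition S :: "(('a \<times> 'b) + 'a) rel" where
  "S = {(u, v). case u of
      Inl z \<Rightarrow> (case v of Inl z' \<Rightarrow> (z, z') \<in> Z | Inr t \<Rightarrow> False)
    | Inr t \<Rightarrow> (case v of Inl z \<Rightarrow> True | Inr t' \<Rightarrow> (t, t') \<in> P)}"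

lemma M_simps [simp]:
  "(Inl z, Inl z') \<in> M \<longleftrightarrow> (z, z') \<in> Z" "(Inl z, Inr t) \<in> M \<longleftrightarrow> z \<in> Field Z \<and> (fst z, t) \<in> P"
  "(Inr t, Inl z) \<notin> M" "(Inr t, Inr t') \<in> M \<longleftrightarrow> (t, t') \<in> P"
  by (simp_all add: M_def)

lemma S_simps [simp]:
  "(Inl z, Inl z') \<in> S \<longleftrightarrow> (z, z') \<in> Z" "(Inl z, Inr t) \<notin> S"
  "(Inr t, Inl z) \<in> S" "(Inr t, Inr t') \<in> S \<longleftrightarrow> (t, t') \<in> P"
  by (simp_all add: S_def)

lemma Z_fst: "(z, z') \<in> Z \<Longrightarrow> (fst z, fst z') \<in> P"
  by (simp add: Z_iff)

lemma Field_M: "Field M = Field Z <+> Field P"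
proof (intro equalityI subsetI)
  fix u assume "u \<in> Field M"
  then obtain v where "(u, v) \<in> M \<or> (v, u) \<in> M" by (auto simp: Field_def)
  then show "u \<in> Field Z <+> Field P"
    by (cases u; cases v) (auto intro: FieldI1 FieldI2)
next
  fix u assume "u \<in> Field Z <+> Field P"
  then have "(u, u) \<in> M" using Partial_orderD(1)[OF PO_Z] P_refl by auto
  then show "u \<in> Field M" by (rule FieldI1)
qed

lemma PO_M: "Partial_order M"
proof -
  have "refl_on (Field M) M"
    unfolding Field_M using Partial_orderD(1)[OF PO_Z] P_refl by (auto simp: refl_on_def)
  moreover have "trans M"
  proof (rule transI)
    fix u v w assume uv: "(u, v) \<in> M" and vw: "(v, w) \<in> M"
    show "(u, w) \<in> M"
    proof (cases u)
      case u: (Inl z)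
      show ?thesis
      proof (cases v)
        case v: (Inl z')
        have zz: "(z, z') \<in> Z" using uv u v by simp
        show ?thesis
        proof (cases w)
          case (Inl z'')
          then show ?thesis using vw u v Partial_orderD(2)[OF PO_Z zz] by simp
        next
          case (Inr t)
          then show ?thesis using vw u v P_trans[OF Z_fst[OF zz]] FieldI1[OF zz] by simp
        qed
      next
        case v: (Inr t)
        then show ?thesis using uv vw u P_trans[of "fst z" t] by (cases w) simp_all
      qed
    next
      case u: (Inr t)
      then show ?thesis using uv vw P_trans[of t] by (cases v; cases w) simp_all
    qed
  qed
  moreover have "antisym M"
  proof (rule antisymI)
    fix u v assume "(u, v) \<in> M" "(v, u) \<in> M"
    then show "u = v" using Partial_orderD(3)[OF PO_Z] P_antisym by (cases u; cases v) simp_all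
  qed
  moreover have "M \<subseteq> Field M \<times> Field M" by (auto intro: FieldI1 FieldI2)
  ultimately show ?thesis by (simp add: partial_order_on_def preorder_on_def)
qed

lemma antisym_S: "antisym S"
proof (rule antisymI)
  fix u v assume "(u, v) \<in> S" "(v, u) \<in> S"
  then show "u = v" using Partial_orderD(3)[OF PO_Z] P_antisym by (cases u; cases v) simp_all
qed

lemma simplices_M_S: "simplices M \<subseteq> simplices S"
proof -
  have "(u, v) \<in> S \<or> (v, u) \<in> S" if "(u, v) \<in> M \<or> (v, u) \<in> M" for u v
    using that by (cases u; cases v) auto
  then show ?thesis unfolding simplices_def Chains_def by blast
qed

text \<open>\<open>U.K\<close> consists of the simplices of the cylinder relative to
  \<open>P\<close>; the least element of \<open>P\<close> above \<open>Inl z\<close> is the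
  projection of \<open>z\<close>.\<close>

sublocale U: upper_retraction M S "range Inl" "\<lambda>u. Inr (fst (projl u))"
proof
  show "Partial_order M" by (rule PO_M)
  show "finite (Field M)" using fin_Z fin_P by (simp add: Field_M)
  show "antisym S" by (rule antisym_S)
  show "simplices M \<subseteq> simplices S" by (rule simplices_M_S)
  show "u \<in> range Inl" if "(u, l) \<in> M" "l \<in> range Inl" for u l
    using that by (cases u) auto
  show "Inr (fst (projl l)) \<notin> range Inl \<and> (l, Inr (fst (projl l))) \<in> M"
    if "l \<in> range Inl" "l \<in> Field M" for l
    using that P_refl by (auto simp: Field_M Field_Z)
  show "(Inr (fst (projl l)), u) \<in> M" if "l \<in> range Inl" "(l, u) \<in> M" "u \<notin> range Inl" for l u
    using that by (cases u) auto
qed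

lemma Plus_simplices_M_iff: "s <+> \<tau> \<in> simplices M \<longleftrightarrow> finite s \<and> finite \<tau> \<and> (s \<noteq> {} \<or> \<tau> \<noteq> {}) \<and>
    s \<in> Chains Z \<and> \<tau> \<in> Chains P \<and> (\<forall>z\<in>s. \<forall>t\<in>\<tau>. (fst z, t) \<in> P)"
proof
  assume *: "s <+> \<tau> \<in> simplices M"
  then have comp: "(u, v) \<in> M \<or> (v, u) \<in> M" if "u \<in> s <+> \<tau>" "v \<in> s <+> \<tau>" for u v
    using that by (auto simp: simplices_def Chains_def)
  have "(z, z') \<in> Z \<or> (z', z) \<in> Z" if "z \<in> s" "z' \<in> s" for z z'
    using comp[OF InlI[OF that(1)] InlI[OF that(2)]] by simp
  moreover have "(t, t') \<in> P \<or> (t', t) \<in> P" if "t \<in> \<tau>" "t' \<in> \<tau>" for t t'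
    using comp[OF InrI[OF that(1)] InrI[OF that(2)]] by simp
  moreover have "(fst z, t) \<in> P" if "z \<in> s" "t \<in> \<tau>" for z t
    using comp[OF InlI[OF that(1)] InrI[OF that(2)]] by simp
  ultimately show "finite s \<and> finite \<tau> \<and> (s \<noteq> {} \<or> \<tau> \<noteq> {}) \<and>
      s \<in> Chains Z \<and> \<tau> \<in> Chains P \<and> (\<forall>z\<in>s. \<forall>t\<in>\<tau>. (fst z, t) \<in> P)"
    using * by (auto simp: simplices_def Chains_def)
next
  assume *: "finite s \<and> finite \<tau> \<and> (s \<noteq> {} \<or> \<tau> \<noteq> {}) \<and>
      s \<in> Chains Z \<and> \<tau> \<in> Chains P \<and> (\<forall>z\<in>s. \<forall>t\<in>\<tau>. (fst z, t) \<in> P)"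
  then have zz: "\<And>z z'. z \<in> s \<Longrightarrow> z' \<in> s \<Longrightarrow> (z, z') \<in> Z \<or> (z', z) \<in> Z"
    and tt: "\<And>t t'. t \<in> \<tau> \<Longrightarrow> t' \<in> \<tau> \<Longrightarrow> (t, t') \<in> P \<or> (t', t) \<in> P"
    and zt: "\<And>z t. z \<in> s \<Longrightarrow> t \<in> \<tau> \<Longrightarrow> (fst z, t) \<in> P"
    by (simp_all add: Chains_def)
  have zF: "z \<in> Field Z" if "z \<in> s" for z
    using zz[OF that that] by (auto intro: FieldI1)
  have "(u, v) \<in> M \<or> (v, u) \<in> M" if "u \<in> s <+> \<tau>" "v \<in> s <+> \<tau>" for u v
    using that by (elim PlusE) (simp_all add: zz tt zt zF)
  then have "s <+> \<tau> \<in> Chains M" by (simp add: Chains_def)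
  then show "s <+> \<tau> \<in> simplices M" using * by (auto simp: simplices_def)
qed

section \<open>The chains meeting both parts, as a double complex\<close>

definition KB :: "(('a \<times> 'b) + 'a) set set" where
  "KB = {\<sigma> \<in> U.K. \<sigma> \<inter> range Inr \<noteq> {}}"

abbreviation del ("\<partial>") where "\<partial> \<equiv> bd S KB"

abbreviation bot_of :: "'a set \<Rightarrow> 'a" where "bot_of \<tau> \<equiv> vertex P \<tau> 0"

lemma bot_of_Field: "\<tau> \<in> simplices P \<Longrightarrow> bot_of \<tau> \<in> Field P"
  by (rule vertex_0_Field[OF PO_P])

lemma KB_subset: "KB \<subseteq> U.K" by (auto simp: KB_def)

lemma family_KB: "simplex_family S KB"
  by (rule simplex_family_subset[OF U.family KB_subset]) (auto simp: KB_def)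

lemma KB_simplices: "KB \<subseteq> simplices S"
  using family_KB by (simp add: simplex_family_def)

lemma Plus_K_iff: "s <+> \<tau> \<in> U.K \<longleftrightarrow> s <+> \<tau> \<in> simplices M \<and> s \<noteq> {}"
  by (auto simp: U.K_def)

text \<open>Lying below all of \<open>\<tau>\<close> is lying below its minimum. Over a fixed
  \<open>\<tau>\<close> the fibre direction is thus the ordinary complex of the poset
  \<open>below (bot_of \<tau>)\<close>.\<close>

lemma Plus_KB_iff: "s <+> \<tau> \<in> KB \<longleftrightarrow> \<tau> \<in> simplices P \<and> s \<in> simplices (below (bot_of \<tau>))"
proof
  assume "s <+> \<tau> \<in> KB"
  then have *: "s <+> \<tau> \<in> simplices M" "s \<noteq> {}" "\<tau> \<noteq> {}" by (auto simp: KB_def Plus_K_iff)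
  then have \<tau>: "\<tau> \<in> simplices P" unfolding Plus_simplices_M_iff by (simp add: simplices_def)
  moreover have "s \<in> simplices Z" "\<forall>z\<in>s. (fst z, bot_of \<tau>) \<in> P"
    using * vertex_0(1)[OF PO_P \<tau>] unfolding Plus_simplices_M_iff by (auto simp: simplices_def)
  ultimately show "\<tau> \<in> simplices P \<and> s \<in> simplices (below (bot_of \<tau>))"
    by (simp add: simplices_below_iff)
next
  assume "\<tau> \<in> simplices P \<and> s \<in> simplices (below (bot_of \<tau>))"
  then have \<tau>: "\<tau> \<in> simplices P" and s: "s \<in> simplices Z" "\<And>z. z \<in> s \<Longrightarrow> (fst z, bot_of \<tau>) \<in> P"
    by (auto simp: simplices_below_iff)
  have "(fst z, t) \<in> P" if "z \<in> s" "t \<in> \<tau>" for z t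
    using P_trans[OF s(2)[OF that(1)] vertex_0(2)[OF PO_P \<tau> that(2)]] .
  then have "s <+> \<tau> \<in> simplices M"
    unfolding Plus_simplices_M_iff using s(1) \<tau> by (auto simp: simplices_def)
  moreover have "s \<noteq> {}" "\<tau> \<noteq> {}" using s(1) \<tau> by (auto simp: simplices_def)
  ultimately show "s <+> \<tau> \<in> KB" by (auto simp: KB_def Plus_K_iff)
qed

lemma Plus_empty_K_iff: "s <+> {} \<in> U.K \<longleftrightarrow> s \<in> simplices Z"
proof -
  have "{} \<in> Chains P" by (simp add: Chains_def)
  then show ?thesis unfolding Plus_K_iff Plus_simplices_M_iff by (auto simp: simplices_def)
qed

lemma face_sign_Inl:
  assumes "finite s" "finite \<tau>"
  shows "face_sign S (Inl z) (s <+> \<tau>) = (- 1) ^ card \<tau> * face_sign Z z s"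
proof -
  have eq: "{u \<in> s <+> \<tau>. (u, Inl z) \<in> S \<and> u \<noteq> Inl z} = {u \<in> s. (u, z) \<in> Z \<and> u \<noteq> z} <+> \<tau>" by auto
  show ?thesis
    unfolding face_sign_def eq using assms by (simp add: card_Plus power_add mult.commute)
qed

lemma face_sign_Inr: "face_sign S (Inr t) (s <+> \<tau>) = face_sign P t \<tau>"
proof -
  have eq: "{u \<in> s <+> \<tau>. (u, Inr t) \<in> S \<and> u \<noteq> Inr t} = Inr ` {u \<in> \<tau>. (u, t) \<in> P \<and> u \<noteq> t}" by auto
  show ?thesis unfolding face_sign_def eq by (simp add: card_image)
qed

text \<open>The total differential of a double complex: the fibre direction carries the sign
  \<open>(- 1) ^ card \<tau>\<close> because \<open>P\<close> comes first in \<open>S\<close>, and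
  the direction of \<open>P\<close> has the signs of \<open>P\<close> itself.\<close>

lemma bd_Plus:
  assumes K: "simplex_family S K" "s <+> \<tau> \<in> K"
  shows "bd S K x (s <+> \<tau>) =
    (\<Sum>z | z \<notin> s \<and> insert z s <+> \<tau> \<in> K. (- 1) ^ card \<tau> * face_sign Z z s * x (insert z s <+> \<tau>)) +
    (\<Sum>t | t \<notin> \<tau> \<and> s <+> insert t \<tau> \<in> K. face_sign P t \<tau> * x (s <+> insert t \<tau>))"
proof -
  let ?g = "\<lambda>v. face_sign S v (s <+> \<tau>) * x (insert v (s <+> \<tau>))"
  have "s <+> \<tau> \<in> simplices S" using K by (auto simp: simplex_family_def)
  then have fin: "finite s" "finite \<tau>" by (auto simp: simplices_def)
  let ?A = "{z. z \<notin> s \<and> insert z s <+> \<tau> \<in> K}" and ?B = "{t. t \<notin> \<tau> \<and> s <+> insert t \<tau> \<in> K}"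
  have split: "{v. v \<notin> s <+> \<tau> \<and> insert v (s <+> \<tau>) \<in> K} = Inl ` ?A \<union> Inr ` ?B"
  proof (rule Set.set_eqI)
    fix v show "v \<in> {v. v \<notin> s <+> \<tau> \<and> insert v (s <+> \<tau>) \<in> K} \<longleftrightarrow> v \<in> Inl ` ?A \<union> Inr ` ?B"
      by (cases v) (auto simp: insert_Plus)
  qed
  have "finite (Inl ` ?A \<union> Inr ` ?B)" unfolding split[symmetric] by (rule finite_cofaces[OF K(1)])
  then have "bd S K x (s <+> \<tau>) = sum ?g (Inl ` ?A) + sum ?g (Inr ` ?B)"
    using K(2) unfolding bd_def split by (auto intro!: sum.union_disjoint)
  also have "sum ?g (Inl ` ?A) = (\<Sum>z\<in>?A. (- 1) ^ card \<tau> * face_sign Z z s * x (insert z s <+> \<tau>))"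
    by (subst sum.reindex) (simp_all add: insert_Plus face_sign_Inl[OF fin])
  also have "sum ?g (Inr ` ?B) = (\<Sum>t\<in>?B. face_sign P t \<tau> * x (s <+> insert t \<tau>))"
    by (subst sum.reindex) (simp_all add: insert_Plus face_sign_Inr)
  finally show ?thesis .
qed

definition slice :: "((('a \<times> 'b) + 'a) set \<Rightarrow> int) \<Rightarrow> 'a set \<Rightarrow> ('a \<times> 'b) set \<Rightarrow> int" where
  "slice x \<tau> s = x (s <+> \<tau>)"

lemma slice_add: "slice (x + y) \<tau> = slice x \<tau> + slice y \<tau>"
  by (simp add: slice_def fun_eq_iff)

lemma slice_diff: "slice (x - y) \<tau> = slice x \<tau> - slice y \<tau>"
  by (simp add: slice_def fun_eq_iff)

lemma cofaces_P: "finite {t. t \<notin> \<tau> \<and> insert t \<tau> \<in> simplices P}"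
  by (rule finite_cofaces[OF family_simplices[OF P]])

lemma slice_chains_on:
  assumes "x \<in> chains_on KB n" "\<tau> \<in> simplices P"
  shows "slice x \<tau> \<in> chains_on (simplices (below (bot_of \<tau>))) (n - int (card \<tau>))"
  unfolding chains_on_def
proof (intro CollectI allI impI)
  fix s assume "slice x \<tau> s \<noteq> 0"
  then have "s <+> \<tau> \<in> KB" "int (card (s <+> \<tau>)) = n + 1" using assms(1) by (auto simp: chains_on_def slice_def)
  moreover from this have "finite s" "finite \<tau>" using KB_simplices by (auto simp: simplices_def)
  ultimately show "s \<in> simplices (below (bot_of \<tau>)) \<and> int (card s) = n - int (card \<tau>) + 1"
    by (simp add: Plus_KB_iff card_Plus)
qed

lemma bot_of_insert_le:
  assumes "\<tau> \<in> simplices P" "insert t \<tau> \<in> simplices P" shows "(bot_of (insert t \<tau>), bot_of \<tau>) \<in> P"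
  by (rule vertex_0(2)[OF PO_P assms(2)]) (use vertex_0(1)[OF PO_P assms(1)] in simp)

lemma simplices_below_mono: "(m, m') \<in> P \<Longrightarrow> s \<in> simplices (below m) \<Longrightarrow> s \<in> simplices (below m')"
  unfolding simplices_below_iff using P_trans[of _ m m'] by blast

lemma slice_del:
  assumes x: "x \<in> chains_on KB n" and \<tau>: "\<tau> \<in> simplices P"
  shows "slice (\<partial> x) \<tau> =
    (\<lambda>s. (- 1) ^ card \<tau> * bd (below (bot_of \<tau>)) (simplices (below (bot_of \<tau>))) (slice x \<tau>) s) +
    (\<Sum>t | t \<notin> \<tau> \<and> insert t \<tau> \<in> simplices P. (\<lambda>s. face_sign P t \<tau> * slice x (insert t \<tau>) s))"
proof
  fix s
  let ?m = "bot_of \<tau>" and ?T = "{t. t \<notin> \<tau> \<and> insert t \<tau> \<in> simplices P}"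
  have sum_apply: "(\<Sum>t\<in>?T. (\<lambda>s. face_sign P t \<tau> * slice x (insert t \<tau>) s)) s
      = (\<Sum>t\<in>?T. face_sign P t \<tau> * x (s <+> insert t \<tau>))"
  proof -
    have "(\<Sum>t\<in>T. g t) s = (\<Sum>t\<in>T. g t s)" for T and g :: "'a \<Rightarrow> ('a \<times> 'b) set \<Rightarrow> int"
      by (induction T rule: infinite_finite_induct) simp_all
    then show ?thesis by (simp add: slice_def)
  qed
  have x0: "x (s <+> insert t \<tau>) = 0" if "t \<in> ?T" "s <+> insert t \<tau> \<notin> KB" for t
    using x that by (auto simp: chains_on_def)
  show "slice (\<partial> x) \<tau> s = ((\<lambda>s. (- 1) ^ card \<tau> * bd (below ?m) (simplices (below ?m)) (slice x \<tau>) s)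
      + (\<Sum>t\<in>?T. (\<lambda>s. face_sign P t \<tau> * slice x (insert t \<tau>) s))) s"
  proof (cases "s \<in> simplices (below ?m)")
    case True
    then have K: "s <+> \<tau> \<in> KB" using \<tau> by (simp add: Plus_KB_iff)
    have 1: "(\<Sum>z | z \<notin> s \<and> insert z s <+> \<tau> \<in> KB. (- 1) ^ card \<tau> * face_sign Z z s * x (insert z s <+> \<tau>))
        = (- 1) ^ card \<tau> * bd (below ?m) (simplices (below ?m)) (slice x \<tau>) s"
    proof -
      have "face_sign Z z s = face_sign (below ?m) z s" if "insert z s \<in> simplices (below ?m)" for z
      proof -
        have "(fst z, ?m) \<in> P" using that by (simp add: simplices_below_iff)
        then show ?thesis by (simp add: face_sign_def below_iff)
      qed
      then show ?thesis
        using True \<tau> by (auto simp: bd_def sum_distrib_left Plus_KB_iff slice_def mult.assoc intro!: sum.cong)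
    qed
    \<comment> \<open>Adding \<open>t\<close> may lower the minimum, so \<open>s\<close> need not
      lie below the new one; the terms thereby added to the index set are zero.\<close>
    have 2: "(\<Sum>t | t \<notin> \<tau> \<and> s <+> insert t \<tau> \<in> KB. face_sign P t \<tau> * x (s <+> insert t \<tau>))
        = (\<Sum>t\<in>?T. face_sign P t \<tau> * x (s <+> insert t \<tau>))"
      by (rule sum.mono_neutral_left[OF cofaces_P]) (use x0 in \<open>auto simp: Plus_KB_iff\<close>)
    show ?thesis
      unfolding slice_def[of "\<partial> x"] bd_Plus[OF family_KB K] 1 2 by (simp add: sum_apply)
  next
    case False
    have "s <+> \<tau> \<notin> KB" using False by (simp add: Plus_KB_iff)
    moreover have "x (s <+> insert t \<tau>) = 0" if "t \<in> ?T" for t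
    proof (rule x0[OF that])
      \<comment> \<open>The minimum of \<open>insert t \<tau>\<close> is at most that of
        \<open>\<tau>\<close>, so \<open>s\<close> does not lie below it either.\<close>
      show "s <+> insert t \<tau> \<notin> KB"
        using False simplices_below_mono[OF bot_of_insert_le[OF \<tau>, of t]] that by (auto simp: Plus_KB_iff)
    qed
    ultimately show ?thesis using False by (simp add: sum_apply) (simp add: slice_def bd_def)
  qed
qed

text \<open>Degree \<open>n\<close> holds the chains with \<open>n + 2\<close> vertices, to absorb
  the shift of the connecting map. If exactly \<open>p + 1\<close> of them lie in \<open>P\<close>,
  the fibre part has dimension \<open>n - p\<close>, the second index of the page.\<close>

definition F :: "int \<Rightarrow> int \<Rightarrow> ((('a \<times> 'b) + 'a) set \<Rightarrow> int) set" where
  "F p n = {x \<in> chains_on KB (n + 1). \<forall>\<sigma>. x \<sigma> \<noteq> 0 \<longrightarrow> int (card (Inr -` \<sigma>)) \<le> p + 1}"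

lemma KB_card:
  assumes "\<sigma> \<in> KB"
  shows "card \<sigma> = card (Inl -` \<sigma>) + card (Inr -` \<sigma>)" "1 \<le> card (Inl -` \<sigma>)" "1 \<le> card (Inr -` \<sigma>)" "finite \<sigma>"
proof -
  let ?s = "Inl -` \<sigma>" and ?\<tau> = "Inr -` \<sigma>"
  have \<sigma>: "?s <+> ?\<tau> \<in> KB" using assms by (simp add: Plus_vimage)
  then have "?s \<in> simplices (below (bot_of ?\<tau>))" "?\<tau> \<in> simplices P" by (simp_all only: Plus_KB_iff)
  then have fin: "finite ?s" "finite ?\<tau>" "?s \<noteq> {}" "?\<tau> \<noteq> {}" unfolding simplices_def by simp_all
  then show "1 \<le> card ?s" "1 \<le> card ?\<tau>" by (simp_all add: Suc_le_eq card_gt_0_iff)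
  have "card (?s <+> ?\<tau>) = card ?s + card ?\<tau>" by (rule card_Plus[OF fin(1,2)])
  then show "card \<sigma> = card ?s + card ?\<tau>" by (simp only: Plus_vimage)
  show "finite \<sigma>" using fin(1,2) finite_Plus[of ?s ?\<tau>] by (simp only: Plus_vimage)
qed

lemma F_eq_chains_on:
  assumes "n \<le> p" shows "F p n = chains_on KB (n + 1)"
proof -
  have "int (card (Inr -` \<sigma>)) \<le> p + 1" if "x \<in> chains_on KB (n + 1)" "x \<sigma> \<noteq> 0" for x \<sigma>
  proof -
    have "\<sigma> \<in> KB" "int (card \<sigma>) = n + 2" using that by (auto simp: chains_on_def)
    \<comment> \<open>At least one of the \<open>n + 2\<close> vertices lies in \<open>Z\<close>,
      which leaves at most \<open>n + 1\<close> for \<open>P\<close>.\<close>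
    then show ?thesis using KB_card(1,2)[of \<sigma>] \<open>n \<le> p\<close> by linarith
  qed
  then show ?thesis unfolding F_def by blast
qed

sublocale FC: filtered_complex F \<partial>
proof
  fix p n :: int
  show "additive_subgroup (F p n)"
    unfolding additive_subgroup_def
  proof (intro conjI ballI)
    show "0 \<in> F p n" using additive_subgroupD(1)[OF chains_on_subgroup] by (simp add: F_def)
    fix x y assume x: "x \<in> F p n" and y: "y \<in> F p n"
    have "x \<sigma> \<noteq> 0 \<or> y \<sigma> \<noteq> 0" if "(x - y) \<sigma> \<noteq> 0" for \<sigma> using that by auto
    then show "x - y \<in> F p n"
      using x y additive_subgroupD(2)[OF chains_on_subgroup] unfolding F_def by blast
  qed
  show "F (p - 1) n \<subseteq> F p n" by (auto simp: F_def)
  show "\<partial> (x + y) = \<partial> x + \<partial> y" for x y by (rule bd_add)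
  show "\<partial> (\<partial> x) = 0" for x by (rule bd_bd[OF family_KB])
  show "\<partial> x \<in> F p (n - 1)" if x: "x \<in> F p n" for x
    unfolding F_def
  proof (intro CollectI conjI allI impI)
    show "\<partial> x \<in> chains_on KB (n - 1 + 1)"
      using bd_chains_on[OF KB_simplices, of x "n + 1"] x by (simp add: F_def)
    fix \<rho> assume \<rho>: "\<partial> x \<rho> \<noteq> 0"
    then have "\<rho> \<in> KB" by (auto simp: bd_def split: if_splits)
    obtain v where v: "x (insert v \<rho>) \<noteq> 0"
    proof (rule ccontr)
      assume "\<not> thesis"
      then have "\<And>v. x (insert v \<rho>) = 0" using that by blast
      then have "\<partial> x \<rho> = 0" by (simp add: bd_def)
      then show False using \<rho> by simp
    qed
    then have "int (card (Inr -` insert v \<rho>)) \<le> p + 1" "insert v \<rho> \<in> KB"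
      using x by (auto simp: F_def chains_on_def)
    moreover have "card (Inr -` \<rho>) \<le> card (Inr -` insert v \<rho>)"
      using KB_card(4)[OF \<open>insert v \<rho> \<in> KB\<close>] by (intro card_mono finite_vimageI) auto
    ultimately show "int (card (Inr -` \<rho>)) \<le> p + 1" by linarith
  qed
  show "F p n = {0}" if "p < 0"
  proof -
    have "x = 0" if x: "x \<in> F p n" for x
    proof
      fix \<sigma>
      show "x \<sigma> = 0 \<sigma>"
      proof (rule ccontr)
        assume "x \<sigma> \<noteq> 0 \<sigma>"
        then have "\<sigma> \<in> KB" "int (card (Inr -` \<sigma>)) \<le> p + 1" using x by (auto simp: F_def chains_on_def)
        then show False using KB_card(3)[of \<sigma>] \<open>p < 0\<close> by linarith
      qed
    qed
    moreover have "0 \<in> F p n" using additive_subgroupD(1)[OF chains_on_subgroup] by (simp add: F_def)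
    ultimately show ?thesis by blast
  qed
  show "F p n = F n n" if "n \<le> p" using F_eq_chains_on that by simp
qed

end

section \<open>The limit term\<close>

context finite_poset_diagram
begin

definition base :: "(('a \<times> 'b) set \<Rightarrow> int) \<Rightarrow> (('a \<times> 'b) + 'a) set \<Rightarrow> int" where
  "base y \<sigma> = (if Inr -` \<sigma> = {} then y (Inl -` \<sigma>) else 0)"

definition top_part :: "((('a \<times> 'b) + 'a) set \<Rightarrow> int) \<Rightarrow> (('a \<times> 'b) + 'a) set \<Rightarrow> int" where
  "top_part u \<sigma> = (if Inr -` \<sigma> = {} then 0 else u \<sigma>)"

text \<open>The connecting map of the short exact sequence with \<open>base\<close> as inclusion of
  the chains of \<open>Z\<close>, the chains on \<open>U.K\<close> in the middle and
  \<open>top_part\<close> as projection to the chains on \<open>KB\<close>. The middle complex being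
  acyclic, it induces an isomorphism on homology that lowers the degree by one.\<close>

definition connecting :: "((('a \<times> 'b) + 'a) set \<Rightarrow> int) \<Rightarrow> ('a \<times> 'b) set \<Rightarrow> int" where
  "connecting x = slice (bd S U.K x) {}"

lemma Plus_empty_eq: "Inr -` \<sigma> = {} \<Longrightarrow> \<sigma> = (Inl -` \<sigma>) <+> {}"
  using Plus_vimage[of \<sigma>] by simp

lemma base_add: "base (x + y) = base x + base y"
  by (simp add: base_def fun_eq_iff)

lemma base_zero: "base 0 = 0"
  by (simp add: base_def fun_eq_iff)

lemma connecting_add: "connecting (x + y) = connecting x + connecting y"
  unfolding connecting_def bd_add slice_add ..

lemma KB_Inr: "\<sigma> \<in> KB \<Longrightarrow> Inr -` \<sigma> \<noteq> {}"
  by (auto simp: KB_def)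

lemma K_iff_KB: "Inr -` \<sigma> \<noteq> {} \<Longrightarrow> \<sigma> \<in> U.K \<longleftrightarrow> \<sigma> \<in> KB"
  by (auto simp: KB_def)

lemma K_Inl: "Inr -` \<sigma> = {} \<Longrightarrow> \<sigma> \<in> U.K \<longleftrightarrow> Inl -` \<sigma> \<in> simplices Z"
  by (subst Plus_empty_eq) (simp_all only: Plus_empty_K_iff)

lemma chains_on_KB_zero: "x \<in> chains_on KB k \<Longrightarrow> Inr -` \<sigma> = {} \<Longrightarrow> x \<sigma> = 0"
  using KB_Inr by (auto simp: chains_on_def)

lemma card_Inl: "Inr -` \<sigma> = {} \<Longrightarrow> card (Inl -` \<sigma>) = card \<sigma>"
proof -
  assume "Inr -` \<sigma> = {}"
  then have "\<sigma> = Inl ` (Inl -` \<sigma>)" using Plus_empty_eq[of \<sigma>] by (simp add: Plus_def)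
  then show ?thesis by (metis card_image inj_Inl inj_on_subset subset_UNIV)
qed

lemma base_chains_on: "y \<in> chains_on (simplices Z) k \<Longrightarrow> base y \<in> chains_on U.K k"
  by (auto simp: chains_on_def base_def K_Inl card_Inl split: if_splits)

lemma top_part_chains_on: "u \<in> chains_on U.K k \<Longrightarrow> top_part u \<in> chains_on KB k"
  unfolding chains_on_def top_part_def
proof (intro CollectI allI impI)
  fix \<sigma>
  assume "u \<in> {x. \<forall>\<sigma>. x \<sigma> \<noteq> 0 \<longrightarrow> \<sigma> \<in> U.K \<and> int (card \<sigma>) = k + 1}"
    and "(if Inr -` \<sigma> = {} then 0 else u \<sigma>) \<noteq> 0"
  then have "Inr -` \<sigma> \<noteq> {}" "\<sigma> \<in> U.K" "int (card \<sigma>) = k + 1" by (auto split: if_splits)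
  then show "\<sigma> \<in> KB \<and> int (card \<sigma>) = k + 1" using K_iff_KB by simp
qed

lemma slice_empty_chains_on:
  assumes "u \<in> chains_on U.K k" shows "slice u {} \<in> chains_on (simplices Z) k"
proof -
  have "card (s <+> {}) = card s" for s :: "('a \<times> 'b) set"
    by (rule card_Inl[of "s <+> {}", unfolded vimage_Plus, OF refl, symmetric])
  note card = this
  have *: "\<sigma> \<in> U.K \<and> int (card \<sigma>) = k + 1" if "u \<sigma> \<noteq> 0" for \<sigma>
    using assms that by (simp add: chains_on_def)
  have "s \<in> simplices Z \<and> int (card s) = k + 1" if "slice u {} s \<noteq> 0" for s
    using *[OF that[unfolded slice_def]] by (simp only: Plus_empty_K_iff card)
  then show ?thesis by (simp add: chains_on_def)
qed

lemma decompose: "u = top_part u + base (slice u {})"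
proof
  fix \<sigma> show "u \<sigma> = (top_part u + base (slice u {})) \<sigma>"
    using Plus_empty_eq[of \<sigma>] by (simp add: top_part_def base_def slice_def)
qed

lemma decompose_unique:
  assumes "x \<in> chains_on KB k" "x' \<in> chains_on KB k'" "x + base y = x' + base y'"
  shows "x = x'" "y = y'"
proof -
  have eq: "x \<sigma> + base y \<sigma> = x' \<sigma> + base y' \<sigma>" for \<sigma> using fun_cong[OF assms(3), of \<sigma>] by simp
  show "x = x'"
  proof
    fix \<sigma> show "x \<sigma> = x' \<sigma>"
      using eq[of \<sigma>] chains_on_KB_zero[OF assms(1), of \<sigma>] chains_on_KB_zero[OF assms(2), of \<sigma>]
      by (cases "Inr -` \<sigma> = {}") (simp_all add: base_def)
  qed
  show "y = y'"
  proof
    fix s show "y s = y' s"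
      using eq[of "s <+> {}"] chains_on_KB_zero[OF assms(1), of "s <+> {}"]
        chains_on_KB_zero[OF assms(2), of "s <+> {}"] by (simp add: base_def)
  qed
qed

lemma bd_top:
  assumes "x \<in> chains_on KB k"
  shows "bd S U.K x = \<partial> x + base (connecting x)"
proof
  fix \<rho>
  show "bd S U.K x \<rho> = (\<partial> x + base (connecting x)) \<rho>"
  proof (cases "Inr -` \<rho> = {}")
    case True
    then have "\<partial> x \<rho> = 0" using KB_Inr by (auto simp: bd_def)
    then show ?thesis using True Plus_empty_eq[OF True] by (simp add: base_def connecting_def slice_def)
  next
    case False
    have "insert v \<rho> \<in> U.K \<longleftrightarrow> insert v \<rho> \<in> KB" for v by (rule K_iff_KB) (use False in auto)
    then have "bd S U.K x \<rho> = \<partial> x \<rho>" using K_iff_KB[OF False] by (simp add: bd_def)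
    then show ?thesis using False by (simp add: base_def)
  qed
qed

lemma bd_base: "bd S U.K (base y) = base (bd Z (simplices Z) y)"
proof
  fix \<rho>
  show "bd S U.K (base y) \<rho> = base (bd Z (simplices Z) y) \<rho>"
  proof (cases "Inr -` \<rho> = {}")
    case True
    define s where "s = Inl -` \<rho>"
    have \<rho>: "\<rho> = s <+> {}" using Plus_empty_eq[OF True] by (simp add: s_def)
    show ?thesis
    proof (cases "s \<in> simplices Z")
      case s: True
      then have K: "s <+> {} \<in> U.K" by (simp add: Plus_empty_K_iff)
      show ?thesis
        unfolding \<rho> bd_Plus[OF U.family K] using s by (simp add: base_def bd_def Plus_empty_K_iff)
    next
      case False
      then show ?thesis unfolding \<rho> by (simp add: base_def bd_def Plus_empty_K_iff)
    qed
  next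
    case False
    have "base y (insert v \<rho>) = 0" for v using False by (simp add: base_def) blast
    then show ?thesis using False by (simp add: bd_def base_def)
  qed
qed

lemma K_simplices: "U.K \<subseteq> simplices S"
  using U.family by (simp add: simplex_family_def)

lemma connecting_chains_on: "x \<in> chains_on KB k \<Longrightarrow> connecting x \<in> chains_on (simplices Z) (k - 1)"
  unfolding connecting_def
  by (rule slice_empty_chains_on, rule bd_chains_on[OF K_simplices])
    (use KB_subset in \<open>auto simp: chains_on_def\<close>)

text \<open>The boundary on \<open>U.K\<close> squares to zero; the part of this equation inside
  \<open>Z\<close> says that the connecting map anticommutes with the boundaries.\<close>

lemma connecting_del:
  assumes x: "x \<in> chains_on KB k"
  shows "connecting (\<partial> x) + bd Z (simplices Z) (connecting x) = 0"
proof -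
  have "0 = bd S U.K (bd S U.K x)" by (rule bd_bd[OF U.family, symmetric])
  also have "\<dots> = \<partial> (\<partial> x) + base (connecting (\<partial> x)) + base (bd Z (simplices Z) (connecting x))"
    unfolding bd_top[OF x] bd_add bd_top[OF bd_chains_on[OF KB_simplices x]] bd_base ..
  also have "\<dots> = 0 + base (connecting (\<partial> x) + bd Z (simplices Z) (connecting x))"
    unfolding bd_bd[OF family_KB] base_add by (simp add: add.assoc)
  finally have "0 + base 0 = 0 + base (connecting (\<partial> x) + bd Z (simplices Z) (connecting x))"
    by (simp add: base_zero)
  from decompose_unique(2)[OF additive_subgroupD(1)[OF chains_on_subgroup] additive_subgroupD(1)[OF chains_on_subgroup] this]
  show ?thesis by simp
qed

lemma bd_decomposed:
  assumes u: "u \<in> chains_on U.K k"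
  shows "bd S U.K u = \<partial> (top_part u) + base (connecting (top_part u) + bd Z (simplices Z) (slice u {}))"
proof -
  have "bd S U.K u = bd S U.K (top_part u) + bd S U.K (base (slice u {}))"
    by (subst (1) decompose) (rule bd_add)
  then show ?thesis
    unfolding bd_top[OF top_part_chains_on[OF u]] bd_base base_add by (simp add: add.assoc)
qed

definition \<eta> :: "int \<Rightarrow> ((('a \<times> 'b) + 'a) set \<Rightarrow> int) \<Rightarrow> (('a \<times> 'b) set \<Rightarrow> int) set" where
  "\<eta> n x = homology_class n Z (connecting x)"

lemma connecting_cycle:
  assumes "x \<in> F n n" "\<partial> x = 0" shows "connecting x \<in> cycles n Z"
proof -
  have x: "x \<in> chains_on KB (n + 1)" using assms(1) by (simp add: F_eq_chains_on)
  have "connecting (0 :: (('a \<times> 'b) + 'a) set \<Rightarrow> int) = 0"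
    unfolding connecting_def bd_zero by (simp add: slice_def fun_eq_iff)
  then have "bd Z (simplices Z) (connecting x) = 0"
    using connecting_del[OF x] unfolding assms(2) by (simp only: add_0_left)
  then show ?thesis using connecting_chains_on[OF x] by (simp add: cycles_def)
qed

lemma \<eta>_hom: "\<eta> n \<in> hom (additive_group {x \<in> F n n. \<partial> x = 0}) (integral_homology n Z)"
proof (rule homI)
  show "\<eta> n x \<in> carrier (integral_homology n Z)" if "x \<in> carrier (additive_group {x \<in> F n n. \<partial> x = 0})" for x
    unfolding \<eta>_def by (rule homology_class_closed[OF finite_poset_Z connecting_cycle]) (use that in auto)
  fix x y assume "x \<in> carrier (additive_group {x \<in> F n n. \<partial> x = 0})" "y \<in> carrier (additive_group {x \<in> F n n. \<partial> x = 0})"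
  then have "connecting x \<in> cycles n Z" "connecting y \<in> cycles n Z" using connecting_cycle by auto
  then show "\<eta> n (x \<otimes>\<^bsub>additive_group {x \<in> F n n. \<partial> x = 0}\<^esub> y) = \<eta> n x \<otimes>\<^bsub>integral_homology n Z\<^esub> \<eta> n y"
    unfolding \<eta>_def additive_group_simps connecting_add by (rule homology_class_add[OF finite_poset_Z])
qed

text \<open>A cycle \<open>y\<close> of \<open>Z\<close> is a cycle of the acyclic complex on
  \<open>U.K\<close>, so it bounds some \<open>u\<close>. The part of \<open>u\<close> in
  \<open>KB\<close> is a cycle whose connecting image differs from \<open>y\<close> by the boundary
  of the part of \<open>u\<close> in \<open>Z\<close>.\<close>

lemma \<eta>_surj: "\<eta> n ` {x \<in> F n n. \<partial> x = 0} = carrier (integral_homology n Z)"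
proof (intro equalityI subsetI)
  fix c assume "c \<in> \<eta> n ` {x \<in> F n n. \<partial> x = 0}"
  then show "c \<in> carrier (integral_homology n Z)"
    using homology_class_closed[OF finite_poset_Z connecting_cycle] by (auto simp: \<eta>_def)
next
  fix c assume "c \<in> carrier (integral_homology n Z)"
  then obtain y where y: "y \<in> cycles n Z" "c = homology_class n Z y"
    by (auto simp: carrier_integral_homology[OF finite_poset_Z])
  have "bd S U.K (base y) = 0" using y(1) by (simp add: bd_base cycles_def base_zero)
  moreover have "base y \<in> chains_on U.K n" using base_chains_on y(1) by (simp add: cycles_def)
  ultimately obtain u where u: "u \<in> chains_on U.K (n + 1)" "bd S U.K u = base y" using U.acyclic by blast
  let ?x = "top_part u" and ?w = "slice u {}"
  have x: "?x \<in> chains_on KB (n + 1)" by (rule top_part_chains_on[OF u(1)])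
  have "\<partial> ?x + base (connecting ?x + bd Z (simplices Z) ?w) = 0 + base y"
    using bd_decomposed[OF u(1)] u(2) by simp
  note dec = decompose_unique[OF bd_chains_on[OF KB_simplices x] additive_subgroupD(1)[OF chains_on_subgroup] this]
  have xF: "?x \<in> F n n" using x by (simp add: F_eq_chains_on)
  have w: "?w \<in> chains_on (simplices Z) (n + 1)" by (rule slice_empty_chains_on[OF u(1)])
  have "y - connecting ?x = bd Z (simplices Z) ?w" using dec(2) by (simp add: diff_eq_eq add.commute)
  then have "homology_class n Z y = homology_class n Z (connecting ?x)"
    using homology_class_boundary_cong[OF finite_poset_Z y(1) connecting_cycle[OF xF dec(1)]] w by blast
  then show "c \<in> \<eta> n ` {x \<in> F n n. \<partial> x = 0}" using xF dec(1) y(2) by (auto simp: \<eta>_def)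
qed

lemma \<eta>_ker:
  assumes x: "x \<in> F n n" "\<partial> x = 0"
  shows "\<eta> n x = \<one>\<^bsub>integral_homology n Z\<^esub> \<longleftrightarrow> x \<in> \<partial> ` F (n + 1) (n + 1)"
proof -
  have xK: "x \<in> chains_on KB (n + 1)" using x(1) by (simp add: F_eq_chains_on)
  have F1: "F (n + 1) (n + 1) = chains_on KB (n + 1 + 1)" by (rule F_eq_chains_on) simp
  have "\<eta> n x = \<one>\<^bsub>integral_homology n Z\<^esub> \<longleftrightarrow> connecting x \<in> bd Z (simplices Z) ` chains_on (simplices Z) (n + 1)"
    unfolding \<eta>_def by (rule homology_class_eq_one_iff[OF finite_poset_Z connecting_cycle[OF x]])
  also have "\<dots> \<longleftrightarrow> x \<in> \<partial> ` F (n + 1) (n + 1)"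
  proof
    assume "connecting x \<in> bd Z (simplices Z) ` chains_on (simplices Z) (n + 1)"
    then obtain w where w: "w \<in> chains_on (simplices Z) (n + 1)" "connecting x = bd Z (simplices Z) w" by blast
    \<comment> \<open>Subtracting \<open>w\<close> kills the part of the boundary inside
      \<open>Z\<close>, so this is a cycle on \<open>U.K\<close> and bounds; the \<open>KB\<close>
      part of a bounding chain then bounds \<open>x\<close>.\<close>
    let ?v = "x - base w"
    have "bd S U.K ?v = 0"
      unfolding bd_diff bd_top[OF xK] bd_base x(2) w(2) by simp
    moreover have "?v \<in> chains_on U.K (n + 1)"
    proof (rule additive_subgroupD(2)[OF chains_on_subgroup _ base_chains_on[OF w(1)]])
      show "x \<in> chains_on U.K (n + 1)" using xK KB_subset by (auto simp: chains_on_def)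
    qed
    ultimately obtain u where u: "u \<in> chains_on U.K (n + 1 + 1)" "bd S U.K u = ?v" using U.acyclic by blast
    let ?x = "top_part u"
    have x': "?x \<in> chains_on KB (n + 1 + 1)" by (rule top_part_chains_on[OF u(1)])
    have "x + base 0 = bd S U.K u + base w" by (simp add: u(2) base_zero)
    also have "\<dots> = \<partial> ?x + base (connecting ?x + bd Z (simplices Z) (slice u {}) + w)"
      unfolding bd_decomposed[OF u(1)] base_add by (simp only: add.assoc)
    finally have "x = \<partial> ?x" by (rule decompose_unique(1)[OF xK bd_chains_on[OF KB_simplices x']])
    then show "x \<in> \<partial> ` F (n + 1) (n + 1)" unfolding F1 using x' by blast
  next
    assume "x \<in> \<partial> ` F (n + 1) (n + 1)"
    then obtain u where u: "u \<in> chains_on KB (n + 1 + 1)" "x = \<partial> u" unfolding F1 by blast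
    have "connecting x = bd Z (simplices Z) (- connecting u)"
      using connecting_del[OF u(1)] u(2) by (simp only: bd_minus eq_neg_iff_add_eq_0)
    moreover have "- connecting u \<in> chains_on (simplices Z) (n + 1)"
      using connecting_chains_on[OF u(1)] by (intro additive_subgroupD(3)[OF chains_on_subgroup]) (simp add: add.commute)
    ultimately show "connecting x \<in> bd Z (simplices Z) ` chains_on (simplices Z) (n + 1)" by blast
  qed
  finally show ?thesis .
qed

lemma converges_to_hocolim: "converges_to FC.page (\<lambda>n. integral_homology n Z)"
  by (rule FC.converges_to_page[OF comm_group_integral_homology[OF finite_poset_Z] \<eta>_hom \<eta>_surj \<eta>_ker])

end

section \<open>The second page\<close>

context finite_poset_diagram
begin

sublocale H: coefficient_functor P "\<lambda>x. integral_homology q (D x)"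
  "\<lambda>x y. induced_homology_map q (D x) (D y) (\<phi> x y)" for q
proof (rule coefficient_functor.intro)
  show "Partial_order P" "finite (Field P)" by (rule PO_P fin_P)+
  show "comm_group (integral_homology q (D p))" if "p \<in> Field P" for p
    by (rule comm_group_integral_homology[OF finite_poset_obj[OF that]])
  show "induced_homology_map q (D p) (D p') (\<phi> p p') \<in> hom (integral_homology q (D p)) (integral_homology q (D p'))"
    if "(p, p') \<in> P" for p p'
    using that by (intro induced_homology_map_hom finite_poset_obj order_preserving) (auto intro: FieldI1 FieldI2)
qed

abbreviation E1 :: "int \<Rightarrow> int \<Rightarrow> ('a set \<Rightarrow> ('b set \<Rightarrow> int) set) monoid" where
  "E1 p q \<equiv> chain_group p P (\<lambda>x. integral_homology q (D x))"

abbreviation E1_boundary ::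
  "int \<Rightarrow> int \<Rightarrow> ('a set \<Rightarrow> ('b set \<Rightarrow> int) set) \<Rightarrow> ('a set \<Rightarrow> ('b set \<Rightarrow> int) set)" where
  "E1_boundary p q \<equiv> chain_boundary p P (\<lambda>x. integral_homology q (D x))
     (\<lambda>x y. induced_homology_map q (D x) (D y) (\<phi> x y))"

text \<open>The chain over \<open>\<tau>\<close>, retracted to the fibre at the minimum of
  \<open>\<tau>\<close>, where the coefficients of \<open>chain_group\<close> live.\<close>

definition fibre_part :: "((('a \<times> 'b) + 'a) set \<Rightarrow> int) \<Rightarrow> 'a set \<Rightarrow> 'b set \<Rightarrow> int" where
  "fibre_part x \<tau> = push (retract (bot_of \<tau>)) (below (bot_of \<tau>)) (slice x \<tau>)"

definition \<zeta> :: "int \<Rightarrow> int \<Rightarrow> ((('a \<times> 'b) + 'a) set \<Rightarrow> int) \<Rightarrow> 'a set \<Rightarrow> ('b set \<Rightarrow> int) set" where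
  "\<zeta> p q x = (\<lambda>\<tau>\<in>Ch p P. homology_class q (D (bot_of \<tau>)) (fibre_part x \<tau>))"

lemma Ch_P:
  assumes "\<tau> \<in> Ch p P"
  shows "\<tau> \<in> simplices P" "int (card \<tau>) = p + 1" "finite \<tau>" "bot_of \<tau> \<in> Field P" "finite_poset (D (bot_of \<tau>))"
  using assms bot_of_Field finite_poset_obj by (auto simp: Ch_iff simplices_def)

lemma fibre_part_add: "fibre_part (x + y) \<tau> = fibre_part x \<tau> + fibre_part y \<tau>"
  unfolding fibre_part_def slice_add push_add ..

lemma slice_F_zero:
  assumes "x \<in> F p n" "p + 1 < int (card \<tau>)" shows "slice x \<tau> = 0"
proof
  fix s
  have "int (card (Inr -` (s <+> \<tau>))) \<le> p + 1" if "x (s <+> \<tau>) \<noteq> 0"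
    using assms(1) that unfolding F_def by blast
  then have "x (s <+> \<tau>) = 0" using assms(2) by (simp only: vimage_Plus) linarith
  then show "slice x \<tau> s = 0 s" by (simp only: slice_def zero_fun_apply)
qed

lemma slice_F:
  assumes "x \<in> F p n" "\<tau> \<in> simplices P" "int (card \<tau>) = n + 1 - q"
  shows "slice x \<tau> \<in> chains_on (simplices (below (bot_of \<tau>))) q"
  using slice_chains_on[of x "n + 1" \<tau>] assms by (simp add: F_def)

text \<open>For \<open>\<tau>\<close> of the top dimension \<open>p\<close> the terms in the
  direction of \<open>P\<close> involve slices over \<open>p + 2\<close> vertices, which vanish in
  \<open>F p\<close>. So only the fibre differential acts on the graded piece.\<close>

lemma slice_del_top:
  assumes x: "x \<in> F p n" and \<tau>: "\<tau> \<in> Ch p P"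
  shows "slice (\<partial> x) \<tau> =
    (\<lambda>s. (- 1) ^ card \<tau> * bd (below (bot_of \<tau>)) (simplices (below (bot_of \<tau>))) (slice x \<tau>) s)"
proof -
  have xK: "x \<in> chains_on KB (n + 1)" using x by (simp add: F_def)
  have "slice x (insert t \<tau>) = 0" if "t \<notin> \<tau>" for t
    by (rule slice_F_zero[OF x]) (use Ch_P[OF \<tau>] that in simp)
  then have "(\<Sum>t | t \<notin> \<tau> \<and> insert t \<tau> \<in> simplices P. (\<lambda>s. face_sign P t \<tau> * slice x (insert t \<tau>) s)) = 0"
    by (intro sum.neutral ballI) (simp add: fun_eq_iff)
  then show ?thesis unfolding slice_del[OF xK Ch_P(1)[OF \<tau>]] by simp
qed

lemma slice_cycle:
  assumes x: "x \<in> FC.Z 1 p (p + q)" and \<tau>: "\<tau> \<in> Ch p P"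
  shows "slice x \<tau> \<in> cycles q (below (bot_of \<tau>))"
proof -
  have xF: "x \<in> F p (p + q)" and dx: "\<partial> x \<in> F (p - 1) (p + q - 1)" using x by (auto simp: FC.Z_def)
  have "slice (\<partial> x) \<tau> = 0" by (rule slice_F_zero[OF dx]) (use Ch_P(2)[OF \<tau>] in simp)
  then have *: "(- 1) ^ card \<tau> * bd (below (bot_of \<tau>)) (simplices (below (bot_of \<tau>))) (slice x \<tau>) s = 0" for s
    unfolding slice_del_top[OF xF \<tau>] by (simp only: fun_eq_iff zero_fun_apply)
  have "bd (below (bot_of \<tau>)) (simplices (below (bot_of \<tau>))) (slice x \<tau>) = 0"
  proof
    fix s show "bd (below (bot_of \<tau>)) (simplices (below (bot_of \<tau>))) (slice x \<tau>) s = 0 s"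
      using *[of s] by simp
  qed
  then show ?thesis using slice_F[OF xF Ch_P(1)[OF \<tau>]] Ch_P(2)[OF \<tau>] by (simp add: cycles_def)
qed

lemma push_retract_cycles:
  assumes "m \<in> Field P" "y \<in> cycles q (below m)"
  shows "push (retract m) (below m) y \<in> cycles q (D m)"
  by (rule push_cycles[OF finite_poset_below finite_poset_obj[OF assms(1)] compat_retract[OF assms(1)] assms(2)])

lemma fibre_part_cycle:
  "x \<in> FC.Z 1 p (p + q) \<Longrightarrow> \<tau> \<in> Ch p P \<Longrightarrow> fibre_part x \<tau> \<in> cycles q (D (bot_of \<tau>))"
  unfolding fibre_part_def by (intro push_retract_cycles slice_cycle Ch_P(4))

lemma \<zeta>_hom: "\<zeta> p q \<in> hom (additive_group (FC.Z 1 p (p + q))) (E1 p q)"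
proof (rule homI)
  show "\<zeta> p q x \<in> carrier (E1 p q)" if "x \<in> carrier (additive_group (FC.Z 1 p (p + q)))" for x
    using that homology_class_closed[OF Ch_P(5) fibre_part_cycle]
    by (auto simp: \<zeta>_def H.carrier_chain_group)
  fix x y assume "x \<in> carrier (additive_group (FC.Z 1 p (p + q)))" "y \<in> carrier (additive_group (FC.Z 1 p (p + q)))"
  then have "homology_class q (D (bot_of \<tau>)) (fibre_part (x + y) \<tau>) =
      homology_class q (D (bot_of \<tau>)) (fibre_part x \<tau>) \<otimes>\<^bsub>integral_homology q (D (bot_of \<tau>))\<^esub>
      homology_class q (D (bot_of \<tau>)) (fibre_part y \<tau>)" if "\<tau> \<in> Ch p P" for \<tau>
    unfolding fibre_part_add
    by (intro homology_class_add[OF Ch_P(5)[OF that]] fibre_part_cycle) (use that in auto)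
  then show "\<zeta> p q (x \<otimes>\<^bsub>additive_group (FC.Z 1 p (p + q))\<^esub> y) = \<zeta> p q x \<otimes>\<^bsub>E1 p q\<^esub> \<zeta> p q y"
    unfolding \<zeta>_def chain_group_def additive_group_simps mult_sum_group
    by (intro restrict_ext) simp
qed

definition assemble :: "int \<Rightarrow> ('a set \<Rightarrow> ('a \<times> 'b) set \<Rightarrow> int) \<Rightarrow> (('a \<times> 'b) + 'a) set \<Rightarrow> int" where
  "assemble p y \<sigma> = (if Inr -` \<sigma> \<in> Ch p P then y (Inr -` \<sigma>) (Inl -` \<sigma>) else 0)"

lemma slice_assemble: "slice (assemble p y) \<tau> = (if \<tau> \<in> Ch p P then y \<tau> else 0)"
  by (simp add: slice_def assemble_def fun_eq_iff)

lemma assemble_F: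
  assumes "\<And>\<tau>. \<tau> \<in> Ch p P \<Longrightarrow> y \<tau> \<in> chains_on (simplices (below (bot_of \<tau>))) (n - p)"
  shows "assemble p y \<in> F p n"
proof -
  have "\<sigma> \<in> KB \<and> int (card \<sigma>) = n + 1 + 1 \<and> int (card (Inr -` \<sigma>)) \<le> p + 1" if "assemble p y \<sigma> \<noteq> 0" for \<sigma>
  proof -
    let ?s = "Inl -` \<sigma>" and ?\<tau> = "Inr -` \<sigma>"
    have \<tau>: "?\<tau> \<in> Ch p P" "y ?\<tau> ?s \<noteq> 0" using that by (auto simp: assemble_def split: if_splits)
    then have s: "?s \<in> simplices (below (bot_of ?\<tau>))" "int (card ?s) = n - p + 1"
      using assms[OF \<tau>(1)] by (auto simp: chains_on_def)
    then have "?s <+> ?\<tau> \<in> KB" using Ch_P(1)[OF \<tau>(1)] by (simp only: Plus_KB_iff)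
    then have "\<sigma> \<in> KB" by (simp only: Plus_vimage)
    then show ?thesis using KB_card(1)[of \<sigma>] s(2) Ch_P(2)[OF \<tau>(1)] by simp
  qed
  then show ?thesis unfolding F_def chains_on_def by blast
qed

lemma F_lower:
  assumes x: "x \<in> F p n" and "\<And>\<tau>. \<tau> \<in> Ch p P \<Longrightarrow> slice x \<tau> = 0"
  shows "x \<in> F (p - 1) n"
proof -
  have "int (card (Inr -` \<sigma>)) \<le> p - 1 + 1" if "x \<sigma> \<noteq> 0" for \<sigma>
  proof (rule ccontr)
    let ?s = "Inl -` \<sigma>" and ?\<tau> = "Inr -` \<sigma>"
    assume "\<not> int (card ?\<tau>) \<le> p - 1 + 1"
    moreover have "\<sigma> \<in> KB" "int (card ?\<tau>) \<le> p + 1" using x that unfolding F_def chains_on_def by blast+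
    moreover from this have "?s <+> ?\<tau> \<in> KB" by (simp only: Plus_vimage)
    then have "?\<tau> \<in> simplices P" by (simp only: Plus_KB_iff)
    ultimately have "?\<tau> \<in> Ch p P" by (simp add: Ch_iff)
    then have "slice x ?\<tau> ?s = 0" using assms(2) by simp
    then show False using that by (simp only: slice_def Plus_vimage)
  qed
  then show ?thesis using x unfolding F_def by blast
qed

text \<open>Cycles in the fibres are included by \<open>Pair\<close> and assembled into one chain
  over the \<open>p\<close>-simplices; retraction recovers them exactly, not only up to
  boundaries.\<close>

lemma \<zeta>_surj: "\<zeta> p q ` FC.Z 1 p (p + q) = carrier (E1 p q)"
proof (intro equalityI subsetI)
  fix a assume "a \<in> \<zeta> p q ` FC.Z 1 p (p + q)"
  then show "a \<in> carrier (E1 p q)" using hom_in_carrier[OF \<zeta>_hom] by auto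
next
  fix a assume a: "a \<in> carrier (E1 p q)"
  have "\<exists>c. c \<in> cycles q (D (bot_of \<tau>)) \<and> a \<tau> = homology_class q (D (bot_of \<tau>)) c" if "\<tau> \<in> Ch p P" for \<tau>
  proof -
    have "a \<tau> \<in> carrier (integral_homology q (D (bot_of \<tau>)))"
      using a that by (auto simp: H.carrier_chain_group)
    then show ?thesis using carrier_integral_homology[OF Ch_P(5)[OF that]] by auto
  qed
  then obtain c where c: "\<And>\<tau>. \<tau> \<in> Ch p P \<Longrightarrow> c \<tau> \<in> cycles q (D (bot_of \<tau>))"
    "\<And>\<tau>. \<tau> \<in> Ch p P \<Longrightarrow> a \<tau> = homology_class q (D (bot_of \<tau>)) (c \<tau>)" by metis
  define y where "y \<tau> = push (Pair (bot_of \<tau>)) (D (bot_of \<tau>)) (c \<tau>)" for \<tau>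
  have y: "y \<tau> \<in> cycles q (below (bot_of \<tau>))" if "\<tau> \<in> Ch p P" for \<tau>
    unfolding y_def
    by (rule push_cycles[OF Ch_P(5)[OF that] finite_poset_below compat_Pair[OF Ch_P(4)[OF that]] c(1)[OF that]])
  define x where "x = assemble p y"
  have slice: "slice x \<tau> = y \<tau>" if "\<tau> \<in> Ch p P" for \<tau> using that by (simp add: x_def slice_assemble)
  have xF: "x \<in> F p (p + q)" unfolding x_def by (rule assemble_F) (use y in \<open>simp add: cycles_def\<close>)
  have "\<partial> x \<in> F (p - 1) (p + q - 1)"
  proof (rule F_lower[OF FC.d_F[OF xF]])
    fix \<tau> assume \<tau>: "\<tau> \<in> Ch p P"
    have "bd (below (bot_of \<tau>)) (simplices (below (bot_of \<tau>))) (slice x \<tau>) = 0"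
      unfolding slice[OF \<tau>] using y[OF \<tau>] by (simp add: cycles_def)
    then show "slice (\<partial> x) \<tau> = 0" unfolding slice_del_top[OF xF \<tau>] by (simp add: fun_eq_iff)
  qed
  then have xZ: "x \<in> FC.Z 1 p (p + q)" using xF by (simp add: FC.Z_def)
  have "\<zeta> p q x = a"
  proof (rule extensionalityI[of _ "Ch p P"])
    show "a \<in> extensional (Ch p P)" using a by (simp add: H.carrier_chain_group PiE_def)
    fix \<tau> assume \<tau>: "\<tau> \<in> Ch p P"
    have "fibre_part x \<tau> = c \<tau>"
      unfolding fibre_part_def slice[OF \<tau>] y_def
      by (rule push_retract_Pair[OF Ch_P(4)[OF \<tau>], where n = q]) (use c(1)[OF \<tau>] in \<open>simp add: cycles_def\<close>)
    then show "\<zeta> p q x \<tau> = a \<tau>" using \<tau> c(2) by (simp add: \<zeta>_def)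
  qed (simp add: \<zeta>_def)
  then show "a \<in> \<zeta> p q ` FC.Z 1 p (p + q)" using xZ by blast
qed

lemma sign_square: "(- 1 :: int) ^ k * ((- 1) ^ k * a) = a"
  by (simp add: mult.assoc[symmetric] power_add[symmetric])

lemma \<zeta>_ker:
  assumes x: "x \<in> FC.Z 1 p (p + q)"
  shows "\<zeta> p q x = \<one>\<^bsub>E1 p q\<^esub> \<longleftrightarrow> (\<exists>w\<in>F p (p + q + 1). x - \<partial> w \<in> F (p - 1) (p + q))"
proof -
  let ?bd = "\<lambda>\<tau>. bd (below (bot_of \<tau>)) (simplices (below (bot_of \<tau>)))"
  let ?C = "\<lambda>\<tau>. chains_on (simplices (below (bot_of \<tau>))) (q + 1)"
  have xF: "x \<in> F p (p + q)" using x by (simp add: FC.Z_def)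
  have "\<zeta> p q x = \<one>\<^bsub>E1 p q\<^esub> \<longleftrightarrow> (\<forall>\<tau>\<in>Ch p P. \<zeta> p q x \<tau> = \<one>\<^bsub>E1 p q\<^esub> \<tau>)"
  proof
    assume *: "\<forall>\<tau>\<in>Ch p P. \<zeta> p q x \<tau> = \<one>\<^bsub>E1 p q\<^esub> \<tau>"
    show "\<zeta> p q x = \<one>\<^bsub>E1 p q\<^esub>"
      by (rule extensionalityI[of _ "Ch p P"]) (use * in \<open>auto simp: \<zeta>_def chain_group_def\<close>)
  qed simp
  also have "\<dots> \<longleftrightarrow> (\<forall>\<tau>\<in>Ch p P. homology_class q (D (bot_of \<tau>)) (fibre_part x \<tau>)
      = \<one>\<^bsub>integral_homology q (D (bot_of \<tau>))\<^esub>)"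
    by (simp add: \<zeta>_def chain_group_def)
  \<comment> \<open>A slice bounds iff its retraction does: one direction is \<open>bd_push\<close>,
    the other \<open>retract_injective_on_homology\<close>.\<close>
  also have "\<dots> \<longleftrightarrow> (\<forall>\<tau>\<in>Ch p P. slice x \<tau> \<in> ?bd \<tau> ` ?C \<tau>)"
  proof (rule ball_cong[OF refl])
    fix \<tau> assume \<tau>: "\<tau> \<in> Ch p P"
    note m = Ch_P(4)[OF \<tau>]
    have "homology_class q (D (bot_of \<tau>)) (fibre_part x \<tau>) = \<one>\<^bsub>integral_homology q (D (bot_of \<tau>))\<^esub> \<longleftrightarrow>
        fibre_part x \<tau> \<in> bd (D (bot_of \<tau>)) (simplices (D (bot_of \<tau>))) ` chains_on (simplices (D (bot_of \<tau>))) (q + 1)"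
      by (rule homology_class_eq_one_iff[OF Ch_P(5)[OF \<tau>] fibre_part_cycle[OF x \<tau>]])
    also have "\<dots> \<longleftrightarrow> slice x \<tau> \<in> ?bd \<tau> ` ?C \<tau>"
    proof
      assume "slice x \<tau> \<in> ?bd \<tau> ` ?C \<tau>"
      then obtain w where "w \<in> ?C \<tau>" "slice x \<tau> = ?bd \<tau> w" by blast
      moreover from this have "fibre_part x \<tau> = bd (D (bot_of \<tau>)) (simplices (D (bot_of \<tau>))) (push (retract (bot_of \<tau>)) (below (bot_of \<tau>)) w)"
        by (simp only: fibre_part_def bd_push[OF PO_below PO_D[OF m] compat_retract[OF m] fin_below fin_D[OF m]])
      ultimately show "fibre_part x \<tau> \<in> bd (D (bot_of \<tau>)) (simplices (D (bot_of \<tau>))) ` chains_on (simplices (D (bot_of \<tau>))) (q + 1)"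
        using push_chains_on[OF compat_retract[OF m]] by blast
    qed (rule retract_injective_on_homology[OF m slice_cycle[OF x \<tau>], folded fibre_part_def])
    finally show "homology_class q (D (bot_of \<tau>)) (fibre_part x \<tau>) = \<one>\<^bsub>integral_homology q (D (bot_of \<tau>))\<^esub> \<longleftrightarrow>
        slice x \<tau> \<in> ?bd \<tau> ` ?C \<tau>" .
  qed
  also have "\<dots> \<longleftrightarrow> (\<exists>w\<in>F p (p + q + 1). x - \<partial> w \<in> F (p - 1) (p + q))"
  proof
    assume "\<forall>\<tau>\<in>Ch p P. slice x \<tau> \<in> ?bd \<tau> ` ?C \<tau>"
    then have "\<forall>\<tau>\<in>Ch p P. \<exists>w. w \<in> ?C \<tau> \<and> slice x \<tau> = ?bd \<tau> w" by blast
    then obtain w where w: "\<And>\<tau>. \<tau> \<in> Ch p P \<Longrightarrow> w \<tau> \<in> ?C \<tau>" "\<And>\<tau>. \<tau> \<in> Ch p P \<Longrightarrow> slice x \<tau> = ?bd \<tau> (w \<tau>)"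
      by metis
    \<comment> \<open>The factor cancels the sign of the fibre direction in
      \<open>slice_del_top\<close>.\<close>
    define y where "y \<tau> = (\<lambda>s. (- 1) ^ card \<tau> * w \<tau> s)" for \<tau>
    let ?w = "assemble p y"
    have wF: "?w \<in> F p (p + q + 1)"
      by (rule assemble_F) (use w(1) in \<open>simp add: y_def chains_on_scale\<close>)
    have dwF: "\<partial> ?w \<in> F p (p + q)" using FC.d_F[OF wF] by simp
    have "x - \<partial> ?w \<in> F (p - 1) (p + q)"
    proof (rule F_lower[OF FC.F_diff[OF xF dwF]])
      fix \<tau> assume \<tau>: "\<tau> \<in> Ch p P"
      have "slice (\<partial> ?w) \<tau> = slice x \<tau>"
        unfolding slice_del_top[OF wF \<tau>] using \<tau> w(2)[OF \<tau>]
        by (simp add: slice_assemble y_def bd_scale sign_square)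
      then show "slice (x - \<partial> ?w) \<tau> = 0" unfolding slice_diff by simp
    qed
    then show "\<exists>w\<in>F p (p + q + 1). x - \<partial> w \<in> F (p - 1) (p + q)" using wF by blast
  next
    assume "\<exists>w\<in>F p (p + q + 1). x - \<partial> w \<in> F (p - 1) (p + q)"
    then obtain w where w: "w \<in> F p (p + q + 1)" "x - \<partial> w \<in> F (p - 1) (p + q)" by blast
    show "\<forall>\<tau>\<in>Ch p P. slice x \<tau> \<in> ?bd \<tau> ` ?C \<tau>"
    proof
      fix \<tau> assume \<tau>: "\<tau> \<in> Ch p P"
      have "slice (x - \<partial> w) \<tau> = 0" by (rule slice_F_zero[OF w(2)]) (use Ch_P(2)[OF \<tau>] in simp)
      then have "slice x \<tau> = slice (\<partial> w) \<tau>" unfolding slice_diff by simp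
      also have "\<dots> = ?bd \<tau> (\<lambda>s. (- 1) ^ card \<tau> * slice w \<tau> s)"
        unfolding slice_del_top[OF w(1) \<tau>] bd_scale ..
      finally have "slice x \<tau> = ?bd \<tau> (\<lambda>s. (- 1) ^ card \<tau> * slice w \<tau> s)" .
      moreover have "slice w \<tau> \<in> ?C \<tau>"
        by (rule slice_F[OF w(1) Ch_P(1)[OF \<tau>]]) (use Ch_P(2)[OF \<tau>] in simp)
      ultimately show "slice x \<tau> \<in> ?bd \<tau> ` ?C \<tau>" using chains_on_scale by blast
    qed
  qed
  finally show ?thesis .
qed

text \<open>Retract \<open>slice_del\<close> over a simplex \<open>\<rho>\<close> of dimension
  \<open>p - 1\<close> to the fibre at its minimum. The fibre term becomes a boundary and disappears
  in homology; the signed sum over cofaces that remains is the one in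
  \<open>chain_boundary_formula\<close>.\<close>

lemma \<zeta>_del:
  assumes x: "x \<in> FC.Z 1 p (p + q)"
  shows "E1_boundary p q (\<zeta> p q x) = \<zeta> (p - 1) q (\<partial> x)"
proof -
  have xF: "x \<in> F p (p + q)" using x by (simp add: FC.Z_def)
  have xK: "x \<in> chains_on KB (p + q + 1)" using xF by (simp add: F_def)
  have "\<zeta> p q x \<in> carrier (E1 p q)" using \<zeta>_surj x by blast
  note H.chain_boundary_formula[OF this]
  also have "(\<lambda>\<rho>\<in>Ch (p - 1) P. \<Otimes>\<^bsub>integral_homology q (D (bot_of \<rho>))\<^esub>
      t\<in>{t. t \<notin> \<rho> \<and> insert t \<rho> \<in> simplices P}. H.face_term q (\<zeta> p q x) \<rho> t) = \<zeta> (p - 1) q (\<partial> x)"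
    unfolding \<zeta>_def[of "p - 1"]
  proof (rule restrict_ext)
    fix \<rho> assume \<rho>: "\<rho> \<in> Ch (p - 1) P"
    let ?m = "bot_of \<rho>" and ?T = "{t. t \<notin> \<rho> \<and> insert t \<rho> \<in> simplices P}"
    let ?G = "integral_homology q (D ?m)"
    note \<rho>P = Ch_P[OF \<rho>]
    note m = \<rho>P(4) and Dm = \<rho>P(5)
    interpret G: comm_group ?G by (rule comm_group_integral_homology[OF Dm])
    define c where "c t = push (retract ?m) (below ?m) (slice x (insert t \<rho>))" for t
    have T: "insert t \<rho> \<in> Ch p P" if "t \<in> ?T" for t
      using that \<rho>P(2,3) by (simp add: Ch_iff)
    have le: "(bot_of (insert t \<rho>), ?m) \<in> P" if "t \<in> ?T" for t
      using bot_of_insert_le[OF \<rho>P(1)] that by simp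
    \<comment> \<open>Retracting straight to the minimum of \<open>\<rho>\<close> equals retracting
      to the possibly smaller minimum of \<open>insert t \<rho>\<close> and then applying the
      transition map, by functoriality of \<open>D\<close>.\<close>
    have c_eq: "c t = push (\<phi> (bot_of (insert t \<rho>)) ?m) (D (bot_of (insert t \<rho>))) (fibre_part x (insert t \<rho>))"
      if t: "t \<in> ?T" for t
    proof -
      let ?n = "bot_of (insert t \<rho>)"
      note n = Ch_P(4)[OF T[OF t]]
      have "push (\<phi> ?n ?m) (D ?n) (fibre_part x (insert t \<rho>)) = push (\<phi> ?n ?m \<circ> retract ?n) (below ?n) (slice x (insert t \<rho>))"
        unfolding fibre_part_def by (rule push_push[OF compat_retract[OF n] fin_below fin_D[OF n]])
      also have "\<dots> = c t"
        unfolding c_def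
      proof (rule push_restrict)
        fix \<sigma> assume "slice x (insert t \<rho>) \<sigma> \<noteq> 0"
        then have \<sigma>: "\<sigma> \<in> simplices (below ?n)"
          using slice_cycle[OF x T[OF t]] by (auto simp: cycles_def chains_on_def)
        have "z \<in> Field (below ?n)" if "z \<in> \<sigma>" for z
          using \<sigma> that by (auto simp: simplices_def Chains_def intro: FieldI1)
        then have "(\<phi> ?n ?m \<circ> retract ?n) ` \<sigma> = retract ?m ` \<sigma>"
          using retract_retract[OF le[OF t]] by (intro image_cong[OF refl]) simp
        then show "\<sigma> \<in> simplices (below ?n) \<and> \<sigma> \<in> simplices (below ?m) \<and> (\<phi> ?n ?m \<circ> retract ?n) ` \<sigma> = retract ?m ` \<sigma>"
          using \<sigma> simplices_below_mono[OF le[OF t] \<sigma>] by simp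
      qed (rule fin_below)+
      finally show ?thesis by simp
    qed
    have c_cycle: "c t \<in> cycles q (D ?m)" if t: "t \<in> ?T" for t
      unfolding c_eq[OF t]
      by (rule push_cycles[OF Ch_P(5)[OF T[OF t]] Dm order_preserving[OF le[OF t]] fibre_part_cycle[OF x T[OF t]]])
    define b where "b t = (\<lambda>s. face_sign P t \<rho> * c t s)" for t
    have b_cycle: "b t \<in> cycles q (D ?m)" if t: "t \<in> ?T" for t
      using c_cycle[OF t] unfolding b_def cycles_def by (simp add: chains_on_scale bd_scale fun_eq_iff)
    have face_term: "H.face_term q (\<zeta> p q x) \<rho> t = homology_class q (D ?m) (b t)" if t: "t \<in> ?T" for t
    proof -
      have \<zeta>t: "\<zeta> p q x (insert t \<rho>) = homology_class q (D (bot_of (insert t \<rho>))) (fibre_part x (insert t \<rho>))"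
        using T[OF t] by (simp add: \<zeta>_def)
      have bt: "homology_class q (D ?m) (b t) = homology_class q (D ?m) (c t) [^]\<^bsub>?G\<^esub> face_sign P t \<rho>"
        unfolding b_def by (rule homology_class_sign[OF Dm c_cycle[OF t] face_sign_cases])
      have vi: "bot_of (insert t \<rho>) = (if (t, ?m) \<in> P then t else ?m)"
        using H.vertex_insert[OF \<rho>P(1), of t] t by simp
      show ?thesis
      proof (cases "(t, ?m) \<in> P")
        case True
        then have n: "bot_of (insert t \<rho>) = t" using vi by simp
        have Dt: "finite_poset (D t)" using finite_poset_obj FieldI1[OF True] by blast
        have "H.face_term q (\<zeta> p q x) \<rho> t
            = induced_homology_map q (D t) (D ?m) (\<phi> t ?m) (homology_class q (D t) (fibre_part x (insert t \<rho>)))"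
          using True \<zeta>t n by (simp add: H.face_term_def)
        also have "\<dots> = homology_class q (D ?m) (c t)"
          using induced_homology_map_class[OF Dt Dm order_preserving[OF True]] fibre_part_cycle[OF x T[OF t]] c_eq[OF t] n
          by simp
        finally show ?thesis
          using bt face_sign_eq_1[OF PO_P \<rho>P(1) True] G.int_pow_1[OF homology_class_closed[OF Dm c_cycle[OF t]]]
          by simp
      next
        case False
        then have n: "bot_of (insert t \<rho>) = ?m" using vi by simp
        have "fibre_part x (insert t \<rho>) = c t" unfolding fibre_part_def c_def n ..
        then show ?thesis using False bt \<zeta>t n by (simp add: H.face_term_def)
      qed
    qed
    have "(\<Otimes>\<^bsub>?G\<^esub>t\<in>?T. H.face_term q (\<zeta> p q x) \<rho> t) = (\<Otimes>\<^bsub>?G\<^esub>t\<in>?T. homology_class q (D ?m) (b t))"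
      by (rule G.finprod_cong') (use face_term homology_class_closed[OF Dm b_cycle] in auto)
    also have "\<dots> = homology_class q (D ?m) (\<Sum>t\<in>?T. b t)"
      by (rule homology_class_sum[OF Dm b_cycle, symmetric])
    also have "\<dots> = homology_class q (D ?m) (fibre_part (\<partial> x) \<rho>)"
    proof -
      let ?bdZ = "bd (below ?m) (simplices (below ?m))" and ?bdD = "bd (D ?m) (simplices (D ?m))"
      let ?y = "push (retract ?m) (below ?m) (slice x \<rho>)"
      \<comment> \<open>One vertex fewer in \<open>P\<close> means one dimension more in the
        fibre.\<close>
      have y: "?y \<in> chains_on (simplices (D ?m)) (q + 1)"
        by (rule push_chains_on[OF compat_retract[OF m] slice_F[OF xF \<rho>P(1)]]) (use \<rho>P(2) in simp)
      have "fibre_part (\<partial> x) \<rho> = ?bdD (\<lambda>s. (- 1) ^ card \<rho> * ?y s) + (\<Sum>t\<in>?T. b t)"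
        unfolding fibre_part_def slice_del[OF xK \<rho>P(1)] push_add push_sum push_scale b_def c_def bd_scale
          bd_push[OF PO_below PO_D[OF m] compat_retract[OF m] fin_below fin_D[OF m]] ..
      then have eq: "fibre_part (\<partial> x) \<rho> - (\<Sum>t\<in>?T. b t) = ?bdD (\<lambda>s. (- 1) ^ card \<rho> * ?y s)" by simp
      have dx: "\<partial> x \<in> FC.Z 1 (p - 1) (p - 1 + q)" using FC.d_Z[OF x] by (simp add: algebra_simps)
      have "fibre_part (\<partial> x) \<rho> - (\<Sum>t\<in>?T. b t) \<in> ?bdD ` chains_on (simplices (D ?m)) (q + 1)"
        unfolding eq using chains_on_scale[OF y] by blast
      moreover have "(\<Sum>t\<in>?T. b t) \<in> cycles q (D ?m)"
        by (rule additive_subgroup_sum[OF cycles_subgroup b_cycle])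
      ultimately show ?thesis
        using homology_class_boundary_cong[OF Dm fibre_part_cycle[OF dx \<rho>]] by blast
    qed
    finally show "(\<Otimes>\<^bsub>?G\<^esub>t\<in>?T. H.face_term q (\<zeta> p q x) \<rho> t) = homology_class q (D ?m) (fibre_part (\<partial> x) \<rho>)" .
  qed
  finally show ?thesis .
qed

lemma comm_group_second_page:
  "comm_group (poset_homology p P (\<lambda>x. integral_homology q (D x))
     (\<lambda>x y. induced_homology_map q (D x) (D y) (\<phi> x y)))"
  unfolding poset_homology_def
  by (rule FC.second_page_iso(1)[where A = E1 and \<delta> = E1_boundary,
        OF H.comm_group_chain_group \<zeta>_hom \<zeta>_surj \<zeta>_ker \<zeta>_del])

lemma second_page:
  "FC.page 2 p q \<cong> poset_homology p P (\<lambda>x. integral_homology q (D x))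
     (\<lambda>x y. induced_homology_map q (D x) (D y) (\<phi> x y))"
  unfolding poset_homology_def
  by (rule FC.second_page_iso(2)[where A = E1 and \<delta> = E1_boundary,
        OF H.comm_group_chain_group \<zeta>_hom \<zeta>_surj \<zeta>_ker \<zeta>_del])

end

theorem proposition3p7:
  fixes P :: "'a rel" and D :: "'a \<Rightarrow> 'b rel" and \<phi> :: "'a \<Rightarrow> 'a \<Rightarrow> 'b \<Rightarrow> 'b"
  assumes "finite_poset P"
    and "finite_poset_functor P D \<phi>"
  shows "\<exists>E d. spectral_sequence E d \<and>
    (\<forall>p q. E 2 p q =
       poset_homology p P (\<lambda>x. integral_homology q (D x))
         (\<lambda>x y. induced_homology_map q (D x) (D y) (\<phi> x y))) \<and>
    converges_to E (\<lambda>n. integral_homology n (hocolim P D \<phi>))"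
proof -
  interpret finite_poset_diagram P D \<phi>
    using assms by (simp add: finite_poset_diagram_def finite_poset_diagram_axioms_def)
  \<comment> \<open>The filtered complex yields the second page only up to isomorphism and in
    another type; the transport replaces it by the homology group itself.\<close>
  from spectral_sequence.transport_second_page[OF FC.spectral_sequence_page comm_group_second_page second_page]
  obtain E d where E: "spectral_sequence E d"
    "\<forall>p q. E 2 p q = poset_homology p P (\<lambda>x. integral_homology q (D x))
      (\<lambda>x y. induced_homology_map q (D x) (D y) (\<phi> x y))"
    "\<forall>r p q. 2 \<le> r \<longrightarrow> FC.page r p q \<cong> E r p q"
    by (elim exE conjE)
  have "converges_to E (\<lambda>n. integral_homology n (hocolim P D \<phi>))"
    by (rule converges_to_iso[OF converges_to_hocolim]) (use E(3) in blast)
  with E(1,2) show ?thesis by blast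
qed

end
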